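(* Let $\mu$ be a strictly non-degenerate finitely supported probability measure on the group $\widetilde F$. Then for a.e. sample path $\boldsymbol g=(g_n)$ of the random walk $(\widetilde F,\mu)$ (issued from the identity) and any point $\gamma\in\Gamma\cong\mathbb{Z}[\frac12]$ the sequence $\gamma.g_n$ converges to an end $\omega_\gamma=\omega_\gamma(\boldsymbol g)\in\partial\Gamma$. This gives rise to a map $$\boldsymbol g\mapsto(\omega_\gamma)_{\gamma\in\Gamma}\in\operatorname{Fun}(\Gamma,\partial\Gamma)$$ from the path space $(\widetilde F^{\mathbb{Z}_+},\mathbf{P})$ to $\operatorname{Fun}(\Gamma,\partial\Gamma)$, and the space $\operatorname{Fun}(\Gamma,\partial\Gamma)$ endowed with the arising probability measure $\lambda$ (the image of $\mathbf{P}$ under this map) is a non-trivial $\mu$-boundary.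
   Context: **The group and its Schreier graph.** $\widetilde A,\widetilde B:\mathbb{R}\to\mathbb{R}$ are the piecewise linear homeomorphisms $\widetilde A(\gamma)=\gamma-1$ and $\widetilde B(\gamma)=\gamma$ for $\gamma\le 0$, $\widetilde B(\gamma)=\gamma/2$ for $0\le\gamma\le 2$, $\widetilde B(\gamma)=\gamma-1$ for $\gamma\ge 2$. $\widetilde F$ is the group of homeomorphisms of $\mathbb{R}$ generated by $\widetilde A,\widetilde B$ (isomorphic to Thompson's group $F$), with group operation $(g_1g_2)(\gamma)=g_2(g_1(\gamma))$, so that $\gamma.g=g(\gamma)$ is a right action. It preserves the set $\mathbb{Z}[\frac12]$ of dyadic rationals and is transitive on it. $\Gamma$ is the Schreier graph of this action: the vertex set is $\mathbb{Z}[\frac12]$, and each $\gamma$ is joined by edges to $\gamma.\widetilde A^{\pm1}$ and $\gamma.\widetilde B^{\pm1}$. $\partial\Gamma$ is the space of ends of the connected locally finite graph $\Gamma$, and convergence to an end is in the end compactification. **End fields.** $\operatorname{Fun}(\Gamma,\partial\Gamma)=(\partial\Gamma)^\Gamma$ is the space of all functions from the vertex set of $\Gamma$ to $\partial\Gamma$ (sections of the end bundle $\Gamma\times\partial\Gamma\to\Gamma$), with the product Borel structure and the left action of $\widetilde F$ given by $(\mathbf{S}^g\varphi)(\gamma)=\varphi(\gamma.g)$. **Random walks and boundaries.** For a probability measure $\mu$ on a countable group $G$, the random walk $(G,\mu)$ is the Markov chain on $G$ moving from $g$ to $gh$ with probability $\mu(h)$. The walk issued from the identity is $g_n=h_1h_2\cdots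 h_n$ with $h_i$ i.i.d. of law $\mu$; $\mathbf{P}$ is its law on the path space $G^{\mathbb{Z}_+}$. $\mu$ is strictly non-degenerate if the semigroup generated by $\operatorname{supp}\mu$ is $G$. The Poisson boundary $\partial_\mu G$ is the space of ergodic components of the time shift on $G^{\mathbb{Z}_+}$ with respect to the $\sigma$-finite Markov measure $\mathbf{P}_\#$ whose initial distribution is the counting measure on $G$; it carries the left $G$-action induced by coordinatewise left translation of paths, and the harmonic measure $\nu$, the image of $\mathbf{P}$. A $\mu$-boundary is a measure $G$-space $(B,\lambda)$ which is a $G$-equivariant measurable quotient of the Poisson boundary, with $\lambda$ the image of $\nu$. It is non-trivial if $\lambda$ is not a point measure. *)

theory Defs
  imports "HOL-Probability.Probability" "HOL-Algebra.Generated_Groups"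
begin

section \<open>The group and its Schreier graph\<close>

text \<open>The product is \<open>(f g)(x) = g (f x)\<close>, so that \<open>x.f = f x\<close> is a right action.\<close>

definition Homeo_line :: "(real \<Rightarrow> real) monoid" where
  "Homeo_line =
     \<lparr> carrier = {f. \<exists>f'. homeomorphism UNIV UNIV f f'},
       monoid.mult = (\<lambda>f g. g \<circ> f),
       one = id \<rparr>"

definition A_tilde :: "real \<Rightarrow> real" where
  "A_tilde x = x - 1"

definition B_tilde :: "real \<Rightarrow> real" where
  "B_tilde x = (if x \<le> 0 then x else if x \<le> 2 then x / 2 else x - 1)"

definition F_tilde :: "(real \<Rightarrow> real) monoid" where
  "F_tilde = Homeo_line \<lparr> carrier := generate Homeo_line {A_tilde, B_tilde} \<rparr>"

definition dyadic_rationals :: "real set" where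
  "dyadic_rationals = {of_int m / 2 ^ n | (m :: int) (n :: nat). True}"

text \<open>Multiple edges and loops are irrelevant for the ends, so only adjacency is recorded.\<close>

definition schreier_edges :: "(real \<times> real) set" where
  "schreier_edges =
     {(x, s x) | x s. x \<in> dyadic_rationals \<and>
        s \<in> {A_tilde, inv\<^bsub>F_tilde\<^esub> A_tilde, B_tilde, inv\<^bsub>F_tilde\<^esub> B_tilde}}"

section \<open>Ends of a graph\<close>

text \<open>Here \<open>V\<close> is the vertex set and \<open>E\<close> the (symmetric) adjacency relation of a connected locally
  finite graph. The second definition gives the connected components of the graph after removal of
  the vertices in \<open>K\<close>.\<close>

definition finite_parts :: "'v set \<Rightarrow> 'v set set" where
  "finite_parts V = {K. finite K \<and> K \<subseteq> V}"

definition components_off :: "'v set \<Rightarrow> ('v \<times> 'v) set \<Rightarrow> 'v set \<Rightarrow> 'v set set" where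
  "components_off V E K = (V - K) // (Restr E (V - K))\<^sup>*"

text \<open>The space of ends is the inverse limit, over the finite sets \<open>K\<close> of vertices, of the sets of
  infinite components of the complement of \<open>K\<close>.\<close>

definition ends :: "'v set \<Rightarrow> ('v \<times> 'v) set \<Rightarrow> ('v set \<Rightarrow> 'v set) set" where
  "ends V E =
     {\<omega> \<in> (\<Pi>\<^sub>E K \<in> finite_parts V. {C \<in> components_off V E K. infinite C}).
        \<forall>K \<in> finite_parts V. \<forall>K' \<in> finite_parts V. K \<subseteq> K' \<longrightarrow> \<omega> K' \<subseteq> \<omega> K}"

text \<open>In the end compactification vertices are isolated, and a component \<open>C\<close> of the complement of a
  finite \<open>K\<close> determines the open set of all vertices in \<open>C\<close> and all ends \<open>\<omega>\<close> with \<open>\<omega> K = C\<close>.\<close>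

definition end_compactification ::
    "'v set \<Rightarrow> ('v \<times> 'v) set \<Rightarrow> ('v + ('v set \<Rightarrow> 'v set)) topology" where
  "end_compactification V E = topology_generated_by
     ({{Inl v} | v. v \<in> V} \<union>
      {Inl ` C \<union> Inr ` {\<omega> \<in> ends V E. \<omega> K = C} | K C.
         K \<in> finite_parts V \<and> C \<in> components_off V E K})"

definition converges_to_end ::
    "'v set \<Rightarrow> ('v \<times> 'v) set \<Rightarrow> (nat \<Rightarrow> 'v) \<Rightarrow> ('v set \<Rightarrow> 'v set) \<Rightarrow> bool" where
  "converges_to_end V E x \<omega> \<longleftrightarrow> \<omega> \<in> ends V E \<and>
     limitin (end_compactification V E) (\<lambda>n. Inl (x n)) (Inr \<omega>) sequentially"

definition ends_topology ::
    "'v set \<Rightarrow> ('v \<times> 'v) set \<Rightarrow> ('v set \<Rightarrow> 'v set) topology" where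
  "ends_topology V E = pullback_topology (ends V E) Inr (end_compactification V E)"

definition borel_of_topology :: "'a topology \<Rightarrow> 'a measure" where
  "borel_of_topology T = sigma (topspace T) {U. openin T U}"

section \<open>End fields\<close>

type_synonym schreier_end = "real set \<Rightarrow> real set"

definition Fun_space :: "(real \<Rightarrow> schreier_end) measure" where
  "Fun_space = Pi\<^sub>M dyadic_rationals (\<lambda>_. borel_of_topology (ends_topology dyadic_rationals schreier_edges))"

definition field_shift ::
    "(real \<Rightarrow> real) \<Rightarrow> (real \<Rightarrow> schreier_end) \<Rightarrow> real \<Rightarrow> schreier_end" where
  "field_shift g \<phi> = (\<lambda>x\<in>dyadic_rationals. \<phi> (g x))"

section \<open>Random walks\<close>

definition is_prob_on :: "('g, 'b) monoid_scheme \<Rightarrow> 'g measure \<Rightarrow> bool" where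
  "is_prob_on G \<mu> \<longleftrightarrow> prob_space \<mu> \<and> sets \<mu> = Pow (carrier G)"

text \<open>Meant for a probability measure on a countable group.\<close>

definition supp :: "('g, 'b) monoid_scheme \<Rightarrow> 'g measure \<Rightarrow> 'g set" where
  "supp G \<mu> = {g \<in> carrier G. measure \<mu> {g} \<noteq> 0}"

inductive_set semigroup_generated :: "('g, 'b) monoid_scheme \<Rightarrow> 'g set \<Rightarrow> 'g set"
  for G and S where
  base: "s \<in> S \<Longrightarrow> s \<in> semigroup_generated G S"
| mult: "g \<in> semigroup_generated G S \<Longrightarrow> h \<in> semigroup_generated G S \<Longrightarrow>
    g \<otimes>\<^bsub>G\<^esub> h \<in> semigroup_generated G S"

definition strictly_nondegenerate :: "('g, 'b) monoid_scheme \<Rightarrow> 'g measure \<Rightarrow> bool" where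
  "strictly_nondegenerate G \<mu> \<longleftrightarrow> semigroup_generated G (supp G \<mu>) = carrier G"

primrec walk :: "('g, 'b) monoid_scheme \<Rightarrow> (nat \<Rightarrow> 'g) \<Rightarrow> nat \<Rightarrow> 'g" where
  "walk G h 0 = \<one>\<^bsub>G\<^esub>"
| "walk G h (Suc n) = walk G h n \<otimes>\<^bsub>G\<^esub> h n"

definition path_space :: "('g, 'b) monoid_scheme \<Rightarrow> (nat \<Rightarrow> 'g) measure" where
  "path_space G = Pi\<^sub>M UNIV (\<lambda>_. count_space (carrier G))"

text \<open>The Markov measure on the path space with initial distribution \<open>\<theta>\<close>: the path issued from \<open>g\<close>
  with i.i.d. increments \<open>h\<close> is \<open>g, g h\<^sub>0, g h\<^sub>0 h\<^sub>1, \<dots>\<close>.\<close>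

definition markov_measure ::
    "('g, 'b) monoid_scheme \<Rightarrow> 'g measure \<Rightarrow> 'g measure \<Rightarrow> (nat \<Rightarrow> 'g) measure" where
  "markov_measure G \<mu> \<theta> =
     distr (\<theta> \<Otimes>\<^sub>M Pi\<^sub>M (UNIV :: nat set) (\<lambda>_. \<mu>)) (path_space G)
       (\<lambda>(g, h) n. g \<otimes>\<^bsub>G\<^esub> walk G h n)"

definition walk_law :: "('g, 'b) monoid_scheme \<Rightarrow> 'g measure \<Rightarrow> (nat \<Rightarrow> 'g) measure" where
  "walk_law G \<mu> = markov_measure G \<mu> (return (count_space (carrier G)) \<one>\<^bsub>G\<^esub>)"

definition walk_law_count :: "('g, 'b) monoid_scheme \<Rightarrow> 'g measure \<Rightarrow> (nat \<Rightarrow> 'g) measure" where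
  "walk_law_count G \<mu> = markov_measure G \<mu> (count_space (carrier G))"

section \<open>Poisson boundary and \<open>\<mu>\<close>-boundaries\<close>

definition standard_borel :: "'a measure \<Rightarrow> bool" where
  "standard_borel M \<longleftrightarrow> (\<exists>T. completely_metrizable_space T \<and> second_countable T \<and>
     topspace T = space M \<and> sets M = sets (borel_of_topology T))"

text \<open>The space of ergodic components of a transformation \<open>T\<close> of \<open>(X, m)\<close>, in the sense of Rokhlin:
  the standard Borel space \<open>Y\<close> together with the projection \<open>\<pi>\<close> which is the quotient of \<open>X\<close>
  determined by the sigma-algebra of \<open>T\<close>-invariant sets, everything being understood modulo
  \<open>m\<close>-null sets. It is unique up to an isomorphism mod 0.\<close>

definition ergodic_components ::
    "'x measure \<Rightarrow> ('x \<Rightarrow> 'x) \<Rightarrow> 'y measure \<Rightarrow> ('x \<Rightarrow> 'y) \<Rightarrow> bool" where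
  "ergodic_components m T Y \<pi> \<longleftrightarrow>
     standard_borel Y \<and> \<pi> \<in> m \<rightarrow>\<^sub>M Y \<and>
     (AE x in m. \<pi> (T x) = \<pi> x) \<and>
     (\<forall>E \<in> sets m. (AE x in m. T x \<in> E \<longleftrightarrow> x \<in> E) \<longrightarrow>
        (\<exists>D \<in> sets Y. AE x in m. x \<in> E \<longleftrightarrow> \<pi> x \<in> D))"

text \<open>A left action by measurable maps which preserves the class of the measure.\<close>

definition measure_G_space ::
    "('g, 'b) monoid_scheme \<Rightarrow> ('g \<Rightarrow> 'y \<Rightarrow> 'y) \<Rightarrow> 'y measure \<Rightarrow> bool" where
  "measure_G_space G act M \<longleftrightarrow>
     (\<forall>g \<in> carrier G. act g \<in> M \<rightarrow>\<^sub>M M) \<and>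
     (\<forall>y \<in> space M. act \<one>\<^bsub>G\<^esub> y = y) \<and>
     (\<forall>g \<in> carrier G. \<forall>h \<in> carrier G. \<forall>y \<in> space M.
        act (g \<otimes>\<^bsub>G\<^esub> h) y = act g (act h y)) \<and>
     (\<forall>g \<in> carrier G. \<forall>N \<in> null_sets M. act g -` N \<inter> space M \<in> null_sets M)"

text \<open>\<open>Y\<close> carries the harmonic measure, which for a strictly non-degenerate \<open>\<mu>\<close> is equivalent to the
  image of the measure with the counting initial distribution.\<close>

definition poisson_boundary ::
    "('g, 'b) monoid_scheme \<Rightarrow> 'g measure \<Rightarrow> 'y measure \<Rightarrow> ('g \<Rightarrow> 'y \<Rightarrow> 'y) \<Rightarrow>
     ((nat \<Rightarrow> 'g) \<Rightarrow> 'y) \<Rightarrow> bool" where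
  "poisson_boundary G \<mu> Y act \<pi> \<longleftrightarrow>
     ergodic_components (walk_law_count G \<mu>) (\<lambda>x n. x (Suc n)) Y \<pi> \<and>
     measure_G_space G act Y \<and>
     (\<forall>g \<in> carrier G. AE x in walk_law_count G \<mu>. \<pi> (\<lambda>n. g \<otimes>\<^bsub>G\<^esub> x n) = act g (\<pi> x)) \<and>
     Y = distr (walk_law G \<mu>) Y \<pi>"

text \<open>The Poisson boundary is realized on some subset of the type \<open>nat \<Rightarrow> real\<close>, which is no
  restriction because every standard Borel space is isomorphic to a Borel subset of this type. The
  measure space \<open>M\<close> comprises both the space \<open>B\<close> and the measure \<open>\<lambda>\<close>.\<close>

definition mu_boundary ::
    "('g, 'b) monoid_scheme \<Rightarrow> 'g measure \<Rightarrow> 'y measure \<Rightarrow> ('g \<Rightarrow> 'y \<Rightarrow> 'y) \<Rightarrow> bool" where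
  "mu_boundary G \<mu> M act \<longleftrightarrow>
     measure_G_space G act M \<and>
     (\<exists>(Y :: (nat \<Rightarrow> real) measure) actY \<pi> \<psi>.
        poisson_boundary G \<mu> Y actY \<pi> \<and>
        \<psi> \<in> Y \<rightarrow>\<^sub>M M \<and>
        (\<forall>g \<in> carrier G. AE y in Y. \<psi> (actY g y) = act g (\<psi> y)) \<and>
        M = distr Y M \<psi>)"

definition is_point_measure :: "'y measure \<Rightarrow> bool" where
  "is_point_measure M \<longleftrightarrow> (\<exists>y \<in> space M. M = return M y)"

section \<open>The limit map\<close>

text \<open>The value on the null set of non-convergent paths is immaterial; there it is set to an arbitrary
  end, so that the map takes all its values in the space of end fields.\<close>

definition limit_field :: "(nat \<Rightarrow> real \<Rightarrow> real) \<Rightarrow> real \<Rightarrow> schreier_end" where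
  "limit_field g = (\<lambda>x\<in>dyadic_rationals.
     if \<exists>\<omega>. converges_to_end dyadic_rationals schreier_edges (\<lambda>n. g n x) \<omega>
     then (THE \<omega>. converges_to_end dyadic_rationals schreier_edges (\<lambda>n. g n x) \<omega>)
     else (SOME \<omega>. \<omega> \<in> ends dyadic_rationals schreier_edges))"

end

theory Submission
  imports Defs
begin

text \<open>The counting measure on the Schreier graph is stationary because the group acts by bijections,
  and by strict non-degeneracy the Dirichlet energy of the induced chain dominates that of every
  group element. A square-summable flow on the binary tree inside the graph therefore bounds point
  values of finitely supported functions by the energy; applied to truncated Green functions this
  gives transience. As the steps are bounded, a transient path
  eventually stays in one component of the complement of each finite set.

  If the limit field were deterministic, it would be constant by quasi-invariance and transitivity,
  so the walk would almost surely avoid one of two disjoint branches in the long run. The indicator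
  of that branch would then be a pointwise limit of finitely supported functions of bounded energy,
  which the flow on the subtree inside the branch rules out.\<close>

section \<open>The group acting on the dyadic rationals\<close>

text \<open>Since \<open>\<mu>\<close> is not assumed symmetric, resistance methods for reversible
  chains do not apply directly. What survives is \<open>energy_eq\<close>: the energy of u is twice
  its pairing with u - P u, where P is \<open>avg\<close>. For the truncated Green function at z
  this makes the energy at most linear in its value t at z, whereas the flow bound is quadratic in
  t; together they bound t uniformly in the truncation. The indicator b of a branch has infinite
  support, but b - P b is finitely supported, because every group element moves only finitely many
  points across the border of the branch. Its truncated Green functions telescope to b - P^N b, the
  source of the approximants of b. The flow estimate for means over generation k decays like
  (3/4)^k, while b has mean 1 on every generation of a subtree in the branch. A boundary presupposes
  an actual Poisson boundary, so one is constructed from countably many invariant events. End-valued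
  maps are controlled by the countably many events that the component off a finite set K is C;
  measurability and factorization are checked event by event.\<close>

definition A_inv :: "real \<Rightarrow> real" where
  "A_inv x = x + 1"

definition B_inv :: "real \<Rightarrow> real" where
  "B_inv x = (if x \<le> 0 then x else if x \<le> 1 then 2 * x else x + 1)"

lemma A_inv_A [simp]: "A_inv (A_tilde x) = x" "A_tilde (A_inv x) = x"
  by (simp_all add: A_inv_def A_tilde_def)

lemma B_inv_B [simp]: "B_inv (B_tilde x) = x" "B_tilde (B_inv x) = x"
  by (simp_all add: B_inv_def B_tilde_def)

lemma continuous_B_tilde: "continuous_on UNIV B_tilde"
proof -
  \<comment> \<open>A sum of clipped linear pieces, one for each interval of linearity, reduces
    continuity to that of \<open>min\<close> and \<open>max\<close>.\<close>
  have "B_tilde = (\<lambda>x. min x 0 + max 0 (min (x / 2) 1) + max 0 (x - 2))"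
    by (auto simp: B_tilde_def fun_eq_iff min_def max_def)
  then show ?thesis
    by (rule ssubst) (intro continuous_intros; simp)
qed

lemma continuous_B_inv: "continuous_on UNIV B_inv"
proof -
  have "B_inv = (\<lambda>x. min x 0 + max 0 (min (2 * x) 2) + max 0 (x - 1))"
    by (auto simp: B_inv_def fun_eq_iff min_def max_def)
  then show ?thesis
    by (rule ssubst) (intro continuous_intros; simp)
qed

lemma homeomorphism_A: "homeomorphism UNIV UNIV A_tilde A_inv"
  by (rule homeomorphismI) (auto simp: A_tilde_def[abs_def] A_inv_def[abs_def] intro!: continuous_intros)

lemma homeomorphism_B: "homeomorphism UNIV UNIV B_tilde B_inv"
  by (rule homeomorphismI) (auto simp: continuous_B_tilde continuous_B_inv)

lemma group_Homeo_line: "group Homeo_line"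
proof (rule groupI)
  fix f g assume "f \<in> carrier Homeo_line" "g \<in> carrier Homeo_line"
  then show "f \<otimes>\<^bsub>Homeo_line\<^esub> g \<in> carrier Homeo_line"
    by (auto simp: Homeo_line_def intro: homeomorphism_compose)
next
  show "\<one>\<^bsub>Homeo_line\<^esub> \<in> carrier Homeo_line"
    using homeomorphism_ident[of UNIV] by (auto simp: Homeo_line_def id_def)
next
  fix f assume "f \<in> carrier Homeo_line"
  then obtain f' where f': "homeomorphism UNIV UNIV f f'"
    by (auto simp: Homeo_line_def)
  then have "f' \<in> carrier Homeo_line" "f' \<otimes>\<^bsub>Homeo_line\<^esub> f = \<one>\<^bsub>Homeo_line\<^esub>"
    using homeomorphism_symD[OF f'] by (auto simp: Homeo_line_def homeomorphism_def fun_eq_iff)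
  then show "\<exists>g\<in>carrier Homeo_line. g \<otimes>\<^bsub>Homeo_line\<^esub> f = \<one>\<^bsub>Homeo_line\<^esub>"
    by blast
qed (auto simp: Homeo_line_def fun_eq_iff)

lemma generators_in_Homeo_line: "{A_tilde, B_tilde} \<subseteq> carrier Homeo_line"
  using homeomorphism_A homeomorphism_B by (auto simp: Homeo_line_def)

lemma subgroup_F_tilde: "subgroup (generate Homeo_line {A_tilde, B_tilde}) Homeo_line"
  by (rule group.generate_is_subgroup[OF group_Homeo_line generators_in_Homeo_line])

lemma group_F_tilde: "group F_tilde"
  unfolding F_tilde_def by (rule group.subgroup_imp_group[OF group_Homeo_line subgroup_F_tilde])

lemma F_tilde_mult [simp]: "f \<otimes>\<^bsub>F_tilde\<^esub> g = g \<circ> f"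
  by (simp add: F_tilde_def Homeo_line_def)

lemma F_tilde_one [simp]: "\<one>\<^bsub>F_tilde\<^esub> = id"
  by (simp add: F_tilde_def Homeo_line_def)

lemma F_tilde_mult_closed: "f \<in> carrier F_tilde \<Longrightarrow> g \<in> carrier F_tilde \<Longrightarrow> g \<circ> f \<in> carrier F_tilde"
  using monoid.m_closed[OF group.is_monoid[OF group_F_tilde]] by fastforce

lemma A_B_in_F_tilde: "A_tilde \<in> carrier F_tilde" "B_tilde \<in> carrier F_tilde"
  by (auto simp: F_tilde_def intro: generate.incl)

lemma Homeo_line_inv:
  assumes "homeomorphism UNIV UNIV f f'"
  shows "inv\<^bsub>Homeo_line\<^esub> f = f'"
proof (rule group.inv_equality[OF group_Homeo_line])
  show "f' \<otimes>\<^bsub>Homeo_line\<^esub> f = \<one>\<^bsub>Homeo_line\<^esub>"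
    using assms by (auto simp: Homeo_line_def homeomorphism_def fun_eq_iff)
qed (use assms homeomorphism_symD[OF assms] in \<open>auto simp: Homeo_line_def\<close>)

lemma A_B_inv_in_F_tilde: "A_inv \<in> carrier F_tilde" "B_inv \<in> carrier F_tilde"
  using generate.inv[of A_tilde "{A_tilde, B_tilde}" Homeo_line]
    generate.inv[of B_tilde "{A_tilde, B_tilde}" Homeo_line]
  by (auto simp: F_tilde_def Homeo_line_inv[OF homeomorphism_A] Homeo_line_inv[OF homeomorphism_B])

lemma inv_A_B [simp]: "inv\<^bsub>F_tilde\<^esub> A_tilde = A_inv" "inv\<^bsub>F_tilde\<^esub> B_tilde = B_inv"
  by (rule group.inv_equality[OF group_F_tilde];
      use A_B_inv_in_F_tilde A_B_in_F_tilde in \<open>auto simp: fun_eq_iff\<close>)+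

definition gens :: "(real \<Rightarrow> real) set" where
  "gens = {A_tilde, A_inv, B_tilde, B_inv}"

text \<open>Listing the inverses among \<open>gens\<close> absorbs the inverse case of
  \<open>generate\<close>; the order \<open>h \<circ> f\<close> is that of the reversed group
  product.\<close>

lemma F_tilde_induct [consumes 1, case_names one gen mult]:
  assumes "g \<in> carrier F_tilde"
    and "P id" and "\<And>s. s \<in> gens \<Longrightarrow> P s"
    and "\<And>f h. f \<in> carrier F_tilde \<Longrightarrow> h \<in> carrier F_tilde \<Longrightarrow> P f \<Longrightarrow> P h \<Longrightarrow> P (h \<circ> f)"
  shows "P g"
proof -
  from assms(1) have "g \<in> generate Homeo_line {A_tilde, B_tilde}"
    by (simp add: F_tilde_def)
  then show ?thesis
  proof induction
    case one
    then show ?case using assms(2) by (simp add: Homeo_line_def id_def)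
  next
    case (incl h)
    then show ?case using assms(3) by (auto simp: gens_def)
  next
    case (inv h)
    then show ?case using assms(3)
      by (auto simp: gens_def Homeo_line_inv[OF homeomorphism_A] Homeo_line_inv[OF homeomorphism_B])
  next
    case (eng f h)
    have "P (h \<circ> f)"
      by (rule assms(4)) (use eng in \<open>simp_all add: F_tilde_def\<close>)
    then show ?case by (simp add: Homeo_line_def o_def)
  qed
qed

lemma gens_in_F_tilde: "gens \<subseteq> carrier F_tilde"
  using A_B_in_F_tilde A_B_inv_in_F_tilde by (auto simp: gens_def)

text \<open>Every element is the composition of a finite word in the four letters of
  \<open>gens\<close>. Countability later lets null sets be combined over all starting points of the
  walk.\<close>

lemma countable_F_tilde: "countable (carrier F_tilde)"
proof -
  define W where "W = (\<lambda>w. foldr (\<lambda>s f. s \<circ> f) w (id :: real \<Rightarrow> real)) ` lists gens"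
  have W_comp: "h \<circ> f \<in> W" if W: "f \<in> W" "h \<in> W" for f h
  proof -
    obtain v w where v: "v \<in> lists gens" "f = foldr (\<lambda>s f. s \<circ> f) v id"
      and w: "w \<in> lists gens" "h = foldr (\<lambda>s f. s \<circ> f) w id"
      using W unfolding W_def by blast
    have "foldr (\<lambda>s f. s \<circ> f) w k = foldr (\<lambda>s f. s \<circ> f) w id \<circ> k" for k :: "real \<Rightarrow> real"
      by (induction w) auto
    from this[of f] have "h \<circ> f = foldr (\<lambda>s f. s \<circ> f) (w @ v) id"
      using v(2) w(2) by simp
    then show ?thesis using v w by (auto simp: W_def intro!: image_eqI[of _ _ "w @ v"])
  qed
  have "g \<in> W" if "g \<in> carrier F_tilde" for g
    using that
  proof (induction rule: F_tilde_induct)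
    case one
    show ?case by (auto simp: W_def intro!: image_eqI[of _ _ "[]"])
  next
    case (gen s)
    then show ?case by (auto simp: W_def intro!: image_eqI[of _ _ "[s]"])
  qed (rule W_comp)
  moreover have "countable W"
    unfolding W_def by (intro countable_image countable_lists) (simp add: gens_def)
  ultimately show ?thesis
    by (meson countable_subset subsetI)
qed

lemma F_tilde_bij:
  assumes "g \<in> carrier F_tilde"
  shows "bij g"
proof -
  have "g \<in> carrier Homeo_line"
    using assms subgroup.subset[OF subgroup_F_tilde] by (auto simp: F_tilde_def)
  then obtain f' where f': "homeomorphism UNIV UNIV g f'"
    by (auto simp: Homeo_line_def)
  show ?thesis
    by (rule bij_betw_byWitness[where f' = f']) (use f' in \<open>auto simp: homeomorphism_def\<close>)
qed

section \<open>Dyadic rationals: invariance and transitivity\<close>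

lemma dyadicI: "of_int m / 2 ^ n \<in> dyadic_rationals"
  by (auto simp: dyadic_rationals_def)

lemma countable_dyadic: "countable dyadic_rationals"
proof -
  have "dyadic_rationals = (\<lambda>(m, n). of_int m / 2 ^ n) ` (UNIV :: (int \<times> nat) set)"
    by (auto simp: dyadic_rationals_def)
  then show ?thesis by (metis countableI_type countable_image)
qed

lemma dyadic_gens:
  assumes "x \<in> dyadic_rationals" "s \<in> gens"
  shows "s x \<in> dyadic_rationals"
proof -
  obtain m n where x: "x = of_int m / 2 ^ n"
    using assms(1) by (auto simp: dyadic_rationals_def)
  have "x - 1 = of_int (m - 2 ^ n) / 2 ^ n" "x + 1 = of_int (m + 2 ^ n) / 2 ^ n"
    "x / 2 = of_int m / 2 ^ Suc n" "2 * x = of_int (2 * m) / 2 ^ n"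
    by (auto simp: x field_simps)
  then have "x - 1 \<in> dyadic_rationals" "x + 1 \<in> dyadic_rationals" "x / 2 \<in> dyadic_rationals"
    "2 * x \<in> dyadic_rationals"
    by (metis dyadicI)+
  with assms show ?thesis
    by (auto simp: gens_def A_tilde_def A_inv_def B_tilde_def B_inv_def)
qed

lemma dyadic_F_tilde: "g \<in> carrier F_tilde \<Longrightarrow> x \<in> dyadic_rationals \<Longrightarrow> g x \<in> dyadic_rationals"
  by (induction arbitrary: x rule: F_tilde_induct) (auto simp: dyadic_gens)

lemma F_tilde_inv_apply:
  assumes "g \<in> carrier F_tilde"
  shows "(inv\<^bsub>F_tilde\<^esub> g) (g x) = x" "g ((inv\<^bsub>F_tilde\<^esub> g) x) = x"
  using group.r_inv[OF group_F_tilde assms] group.l_inv[OF group_F_tilde assms]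
  by (auto simp: fun_eq_iff)

lemma dyadic_F_tilde_iff:
  assumes "g \<in> carrier F_tilde"
  shows "g x \<in> dyadic_rationals \<longleftrightarrow> x \<in> dyadic_rationals"
  using dyadic_F_tilde[OF assms] dyadic_F_tilde[OF group.inv_closed[OF group_F_tilde assms], of "g x"]
  by (auto simp: F_tilde_inv_apply[OF assms])

lemma translation_in_F_tilde: "(\<lambda>x. x + of_int k) \<in> carrier F_tilde"
proof (induction k rule: int_induct[of _ 0])
  case base
  show ?case using monoid.one_closed[OF group.is_monoid[OF group_F_tilde]] by (simp add: id_def)
next
  case (step1 i)
  then show ?case
    using F_tilde_mult_closed[OF step1(2) A_B_inv_in_F_tilde(1)]
    by (simp add: o_def A_inv_def algebra_simps)
next
  case (step2 i)
  then show ?case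
    using F_tilde_mult_closed[OF step2(2) A_B_in_F_tilde(1)]
    by (simp add: o_def A_tilde_def algebra_simps)
qed

text \<open>Induction on the exponent of the denominator: \<open>B_tilde\<close> halves everything
  in [0, 2], and integer translations do the rest. The base point 1/2 is the root of the tree that
  carries the flow.\<close>

lemma F_tilde_transitive:
  assumes "x \<in> dyadic_rationals"
  shows "\<exists>g \<in> carrier F_tilde. g (1/2) = x"
proof -
  have shift: "\<exists>g \<in> carrier F_tilde. g (1/2) = y + of_int k"
    if "\<exists>g \<in> carrier F_tilde. g (1/2) = y" for y k
    using that F_tilde_mult_closed[OF _ translation_in_F_tilde] by (auto simp: o_def)
  have "\<exists>g \<in> carrier F_tilde. g (1/2) = of_int m / 2 ^ n" for m n
  proof (induction n arbitrary: m)
    case 0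
    have "\<exists>g \<in> carrier F_tilde. g (1/2) = 1"
      using A_B_inv_in_F_tilde by (intro bexI[of _ B_inv]) (auto simp: B_inv_def)
    from shift[OF this, of "m - 1"] show ?case by simp
  next
    case (Suc n)
    \<comment> \<open>Reduction modulo \<open>2 ^ Suc n\<close> places k / 2^n in [0, 2), where
      \<open>B_tilde\<close> is division by 2; the discarded part is an integer translation.\<close>
    define k where "k = m mod 2 ^ Suc n"
    have k: "0 \<le> k" "k < 2 ^ Suc n" and m: "m = k + 2 ^ Suc n * (m div 2 ^ Suc n)"
      by (simp_all add: k_def)
    obtain g where g: "g \<in> carrier F_tilde" "g (1/2) = of_int k / 2 ^ n"
      using Suc by blast
    have "real_of_int k < of_int (2 ^ Suc n)"
      using k by (simp only: of_int_less_iff)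
    then have "real_of_int k / 2 ^ n < 2" "0 \<le> real_of_int k / 2 ^ n"
      using k by (simp_all add: field_simps)
    then have "B_tilde (of_int k / 2 ^ n) = of_int k / 2 ^ Suc n"
      by (auto simp: B_tilde_def)
    then have "\<exists>g \<in> carrier F_tilde. g (1/2) = of_int k / 2 ^ Suc n"
      using g F_tilde_mult_closed[OF g(1) A_B_in_F_tilde(2)] by (intro bexI[of _ "B_tilde \<circ> g"]) auto
    moreover have "real_of_int m / 2 ^ Suc n = of_int k / 2 ^ Suc n + of_int (m div 2 ^ Suc n)"
    proof -
      have "real_of_int m = of_int k + 2 ^ Suc n * of_int (m div 2 ^ Suc n)"
        using arg_cong[OF m, of real_of_int] by (simp only: of_int_add of_int_mult of_int_power of_int_numeral)
      then show ?thesis by (simp add: field_simps)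
    qed
    ultimately show ?case
      using shift[of "of_int k / 2 ^ Suc n" "m div 2 ^ Suc n"] by (simp only:)
  qed
  then show ?thesis
    using assms by (auto simp: dyadic_rationals_def)
qed

lemma schreier_edges_eq: "schreier_edges = {(x, s x) | x s. x \<in> dyadic_rationals \<and> s \<in> gens}"
  by (simp add: schreier_edges_def gens_def)

lemma gens_inverse: "s \<in> gens \<Longrightarrow> \<exists>t \<in> gens. \<forall>x. t (s x) = x"
  by (auto simp: gens_def)

lemma sym_schreier_edges: "sym schreier_edges"
proof (rule symI)
  fix x y assume "(x, y) \<in> schreier_edges"
  then obtain s where s: "x \<in> dyadic_rationals" "s \<in> gens" "y = s x"
    by (auto simp: schreier_edges_eq)
  obtain t where t: "t \<in> gens" "\<forall>x. t (s x) = x"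
    using gens_inverse[OF s(2)] by blast
  have "(y, t y) \<in> schreier_edges"
    unfolding schreier_edges_eq using t(1) dyadic_gens[OF s(1,2)] s(3) by blast
  then show "(y, x) \<in> schreier_edges"
    using s(3) t(2) by simp
qed

section \<open>Random walks on countable groups\<close>

locale random_walk = group G for G :: "('g, 'b) monoid_scheme" (structure) +
  fixes \<mu> :: "'g measure"
  assumes is_prob: "is_prob_on G \<mu>" and countable_G: "countable (carrier G)"
    and nondegenerate: "strictly_nondegenerate G \<mu>"
begin

lemma sets_\<mu>: "sets \<mu> = sets (count_space (carrier G))"
  using is_prob by (simp add: is_prob_on_def)

lemma space_\<mu>: "space \<mu> = carrier G"
  using sets_eq_imp_space_eq[OF sets_\<mu>] by simp

sublocale increment: prob_space \<mu>
  using is_prob by (simp add: is_prob_on_def)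

sublocale seq: sequence_space \<mu> ..

abbreviation steps :: "(nat \<Rightarrow> 'g) measure" where
  "steps \<equiv> Pi\<^sub>M UNIV (\<lambda>_. \<mu>)"

abbreviation paths :: "(nat \<Rightarrow> 'g) measure" where
  "paths \<equiv> path_space G"

lemma space_steps: "h \<in> space steps \<longleftrightarrow> (\<forall>n. h n \<in> carrier G)"
  by (auto simp: space_PiM space_\<mu>)

lemma space_paths: "x \<in> space paths \<longleftrightarrow> (\<forall>n. x n \<in> carrier G)"
  by (auto simp: path_space_def space_PiM)

lemma walk_closed: "(\<And>n. h n \<in> carrier G) \<Longrightarrow> walk G h n \<in> carrier G"
  by (induction n) auto

text \<open>\<open>walk\<close> appends the last increment; the Markov property needs the first one
  split off.\<close>

lemma walk_case_nat:
  assumes "s \<in> carrier G" "\<And>n. h n \<in> carrier G"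
  shows "walk G (case_nat s h) (Suc n) = s \<otimes> walk G h n"
proof (induction n)
  case (Suc n)
  then have "walk G (case_nat s h) (Suc (Suc n)) = (s \<otimes> walk G h n) \<otimes> h n"
    by simp
  then show ?case
    using assms walk_closed[OF assms(2)] by (simp add: m_assoc)
qed (use assms in simp)

lemma measurable_step: "(\<lambda>h. h n) \<in> steps \<rightarrow>\<^sub>M count_space (carrier G)"
proof -
  have "(\<lambda>h. h n) \<in> steps \<rightarrow>\<^sub>M \<mu>" by (rule measurable_component_singleton) simp
  then show ?thesis using measurable_cong_sets[OF refl sets_\<mu>] by blast
qed

lemma measurable_mult:
  assumes "f \<in> M \<rightarrow>\<^sub>M count_space (carrier G)" "g \<in> M \<rightarrow>\<^sub>M count_space (carrier G)"
  shows "(\<lambda>x. f x \<otimes> g x) \<in> M \<rightarrow>\<^sub>M count_space (carrier G)"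
proof (rule measurable_compose_countable'[OF _ assms(1) countable_G])
  fix a assume "a \<in> carrier G"
  then have "(\<lambda>b. a \<otimes> b) \<in> count_space (carrier G) \<rightarrow>\<^sub>M count_space (carrier G)"
    by simp
  then show "(\<lambda>x. a \<otimes> g x) \<in> M \<rightarrow>\<^sub>M count_space (carrier G)"
    using measurable_compose[OF assms(2)] by blast
qed

lemma measurable_walk: "(\<lambda>h. walk G h n) \<in> steps \<rightarrow>\<^sub>M count_space (carrier G)"
  by (induction n) (simp_all add: measurable_mult measurable_step)

lemma measurable_coordinate: "(\<lambda>x. x n) \<in> paths \<rightarrow>\<^sub>M count_space (carrier G)"
  unfolding path_space_def by (rule measurable_component_singleton) simp

lemma measurable_pathsI:
  "(\<And>n. (\<lambda>x. f x n) \<in> M \<rightarrow>\<^sub>M count_space (carrier G)) \<Longrightarrow> f \<in> M \<rightarrow>\<^sub>M paths"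
  unfolding path_space_def by (rule measurable_abs_UNIV)

section \<open>Path laws from arbitrary starting points and the Markov property\<close>

definition left_mult :: "'g \<Rightarrow> (nat \<Rightarrow> 'g) \<Rightarrow> nat \<Rightarrow> 'g" where
  "left_mult g x = (\<lambda>n. g \<otimes> x n)"

definition shift :: "(nat \<Rightarrow> 'g) \<Rightarrow> nat \<Rightarrow> 'g" where
  "shift x = (\<lambda>n. x (Suc n))"

definition walk_from :: "'g \<Rightarrow> (nat \<Rightarrow> 'g) measure" where
  "walk_from g = distr steps paths (\<lambda>h. left_mult g (walk G h))"

lemma measurable_left_mult: "g \<in> carrier G \<Longrightarrow> left_mult g \<in> paths \<rightarrow>\<^sub>M paths"
  unfolding left_mult_def
  by (intro measurable_pathsI measurable_mult measurable_coordinate) simp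

lemma measurable_shift: "shift \<in> paths \<rightarrow>\<^sub>M paths"
  unfolding shift_def by (intro measurable_pathsI measurable_coordinate)

lemma measurable_walk_path: "walk G \<in> steps \<rightarrow>\<^sub>M paths"
  by (intro measurable_pathsI measurable_walk)

lemma measurable_walk_from:
  "g \<in> carrier G \<Longrightarrow> (\<lambda>h. left_mult g (walk G h)) \<in> steps \<rightarrow>\<^sub>M paths"
  by (rule measurable_compose[OF measurable_walk_path measurable_left_mult])

lemma left_mult_space: "g \<in> carrier G \<Longrightarrow> x \<in> space paths \<Longrightarrow> left_mult g x \<in> space paths"
  by (auto simp: space_paths left_mult_def)

lemma left_mult_left_mult:
  "g \<in> carrier G \<Longrightarrow> k \<in> carrier G \<Longrightarrow> x \<in> space paths \<Longrightarrow>
    left_mult g (left_mult k x) = left_mult (g \<otimes> k) x"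
  by (simp add: left_mult_def space_paths m_assoc)

lemma left_mult_one: "x \<in> space paths \<Longrightarrow> left_mult \<one> x = x"
  by (simp add: left_mult_def space_paths)

lemma shift_left_mult: "shift (left_mult g x) = left_mult g (shift x)"
  by (simp add: left_mult_def shift_def)

lemma shift_space: "x \<in> space paths \<Longrightarrow> shift x \<in> space paths"
  by (simp add: space_paths shift_def)

lemma sets_walk_from [simp]: "sets (walk_from g) = sets paths"
  by (simp add: walk_from_def)

lemma space_walk_from [simp]: "space (walk_from g) = space paths"
  by (simp add: walk_from_def)

lemma prob_space_walk_from: "g \<in> carrier G \<Longrightarrow> prob_space (walk_from g)"
  unfolding walk_from_def by (intro seq.prob_space_distr measurable_walk_from)

lemma walk_path_space: "h \<in> space steps \<Longrightarrow> walk G h \<in> space paths"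
  using measurable_space[OF measurable_walk_path] .

lemma distr_left_mult:
  assumes "g \<in> carrier G" "k \<in> carrier G"
  shows "distr (walk_from k) paths (left_mult g) = walk_from (g \<otimes> k)"
proof -
  have "distr (walk_from k) paths (left_mult g) = distr steps paths (left_mult g \<circ> (\<lambda>h. left_mult k (walk G h)))"
    unfolding walk_from_def by (rule distr_distr[OF measurable_left_mult measurable_walk_from]) fact+
  also have "\<dots> = walk_from (g \<otimes> k)"
    unfolding walk_from_def using assms
    by (intro distr_cong refl) (simp add: left_mult_left_mult walk_path_space)
  finally show ?thesis .
qed

text \<open>The one-step Markov property: by \<open>seq.PiM_iter\<close> an i.i.d. sequence is a
  first increment s followed by an independent copy of the sequence, and dropping the starting point
  leaves the walk issued from g s.\<close>

lemma emeasure_shift: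
  assumes "g \<in> carrier G" "E \<in> sets paths"
  shows "emeasure (walk_from g) (shift -` E \<inter> space paths) = (\<integral>\<^sup>+s. emeasure (walk_from (g \<otimes> s)) E \<partial>\<mu>)"
proof -
  define F where "F = {h \<in> space steps. left_mult g (walk G h) \<in> shift -` E}"
  have F_eq: "F = (\<lambda>h. shift (left_mult g (walk G h))) -` E \<inter> space steps"
    by (auto simp: F_def)
  have F: "F \<in> sets steps"
    unfolding F_eq using measurable_sets[OF measurable_compose[OF measurable_walk_from[OF assms(1)] measurable_shift] assms(2)] .
  have "emeasure (walk_from g) (shift -` E \<inter> space paths) = emeasure steps F"
    unfolding walk_from_def F_eq
    by (subst emeasure_distr[OF measurable_walk_from[OF assms(1)] measurable_sets[OF measurable_shift assms(2)]])
      (auto intro!: arg_cong[where f = "emeasure steps"] simp: measurable_space[OF measurable_walk_from[OF assms(1)]])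
  also have "\<dots> = emeasure (distr (\<mu> \<Otimes>\<^sub>M steps) steps (\<lambda>(s, h). case_nat s h)) F"
    by (simp only: seq.PiM_iter)
  also have "\<dots> = emeasure (\<mu> \<Otimes>\<^sub>M steps) ((\<lambda>(s, h). case_nat s h) -` F \<inter> space (\<mu> \<Otimes>\<^sub>M steps))"
    by (rule emeasure_distr[OF _ F]) measurable
  also have "\<dots> = (\<integral>\<^sup>+s. emeasure steps (Pair s -` ((\<lambda>(s, h). case_nat s h) -` F \<inter> space (\<mu> \<Otimes>\<^sub>M steps))) \<partial>\<mu>)"
    by (intro seq.P.emeasure_pair_measure_alt measurable_sets[OF _ F]) measurable
  also have "\<dots> = (\<integral>\<^sup>+s. emeasure (walk_from (g \<otimes> s)) E \<partial>\<mu>)"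
  proof (rule nn_integral_cong)
    fix s assume "s \<in> space \<mu>"
    then have s: "s \<in> carrier G" by (simp add: space_\<mu>)
    have "Pair s -` ((\<lambda>(s, h). case_nat s h) -` F \<inter> space (\<mu> \<Otimes>\<^sub>M steps)) =
      (\<lambda>h. left_mult (g \<otimes> s) (walk G h)) -` E \<inter> space steps"
    proof (rule Set.set_eqI)
      fix h
      have "shift (left_mult g (walk G (case_nat s h))) = left_mult (g \<otimes> s) (walk G h)" if "h \<in> space steps"
      proof -
        have "walk G h n \<in> carrier G" for n
          using that by (intro walk_closed) (simp add: space_steps)
        moreover have "walk G (case_nat s h) (Suc n) = s \<otimes> walk G h n" for n
          using that by (intro walk_case_nat s) (simp add: space_steps)
        ultimately show ?thesis
          using s assms(1) unfolding shift_def left_mult_def by (simp only: m_assoc)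
      qed
      moreover have "case_nat s h \<in> space steps \<longleftrightarrow> h \<in> space steps"
        using s by (auto simp: space_steps split: nat.splits)
      ultimately show "h \<in> Pair s -` ((\<lambda>(s, h). case_nat s h) -` F \<inter> space (\<mu> \<Otimes>\<^sub>M steps)) \<longleftrightarrow>
          h \<in> (\<lambda>h. left_mult (g \<otimes> s) (walk G h)) -` E \<inter> space steps"
        using s by (auto simp: F_def space_pair_measure space_\<mu>)
    qed
    then show "emeasure steps (Pair s -` ((\<lambda>(s, h). case_nat s h) -` F \<inter> space (\<mu> \<Otimes>\<^sub>M steps))) =
        emeasure (walk_from (g \<otimes> s)) E"
      unfolding walk_from_def using s assms by (simp add: emeasure_distr measurable_walk_from)
  qed
  finally show ?thesis .
qed

text \<open>Tonelli over the starting point; one formula covers both the point mass at the identity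
  and the counting measure.\<close>

lemma emeasure_markov_measure:
  assumes "sets \<theta> = sets (count_space (carrier G))" "E \<in> sets paths"
  shows "emeasure (markov_measure G \<mu> \<theta>) E = (\<integral>\<^sup>+g. emeasure (walk_from g) E \<partial>\<theta>)"
proof -
  let ?f = "\<lambda>(g, h) n. g \<otimes> walk G h n"
  have fst: "fst \<in> \<theta> \<Otimes>\<^sub>M steps \<rightarrow>\<^sub>M count_space (carrier G)"
    using measurable_fst measurable_cong_sets[OF refl assms(1)] by blast
  have "(\<lambda>x. fst x \<otimes> walk G (snd x) n) \<in> \<theta> \<Otimes>\<^sub>M steps \<rightarrow>\<^sub>M count_space (carrier G)" for n
    by (intro measurable_mult fst measurable_compose[OF measurable_snd measurable_walk])
  then have f: "?f \<in> \<theta> \<Otimes>\<^sub>M steps \<rightarrow>\<^sub>M paths"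
    unfolding case_prod_beta by (intro measurable_pathsI)
  have space_\<theta>: "space \<theta> = carrier G"
    using sets_eq_imp_space_eq[OF assms(1)] by simp
  have "emeasure (markov_measure G \<mu> \<theta>) E = emeasure (\<theta> \<Otimes>\<^sub>M steps) (?f -` E \<inter> space (\<theta> \<Otimes>\<^sub>M steps))"
    unfolding markov_measure_def by (rule emeasure_distr[OF f assms(2)])
  also have "\<dots> = (\<integral>\<^sup>+g. emeasure steps (Pair g -` (?f -` E \<inter> space (\<theta> \<Otimes>\<^sub>M steps))) \<partial>\<theta>)"
    by (intro seq.P.emeasure_pair_measure_alt measurable_sets[OF f assms(2)])
  also have "\<dots> = (\<integral>\<^sup>+g. emeasure (walk_from g) E \<partial>\<theta>)"
  proof (rule nn_integral_cong)
    fix g assume "g \<in> space \<theta>"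
    then have g: "g \<in> carrier G" by (simp add: space_\<theta>)
    then have "Pair g -` (?f -` E \<inter> space (\<theta> \<Otimes>\<^sub>M steps)) = (\<lambda>h. left_mult g (walk G h)) -` E \<inter> space steps"
      by (auto simp: space_pair_measure space_\<theta> left_mult_def)
    then show "emeasure steps (Pair g -` (?f -` E \<inter> space (\<theta> \<Otimes>\<^sub>M steps))) = emeasure (walk_from g) E"
      unfolding walk_from_def using g assms by (simp add: emeasure_distr measurable_walk_from)
  qed
  finally show ?thesis .
qed

lemma sets_walk_law_count [simp]: "sets (walk_law_count G \<mu>) = sets paths"
  by (simp add: walk_law_count_def markov_measure_def)

lemma space_walk_law_count [simp]: "space (walk_law_count G \<mu>) = space paths"
  by (simp add: walk_law_count_def markov_measure_def)

lemma walk_law_eq: "walk_law G \<mu> = walk_from \<one>"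
proof (rule measure_eqI)
  fix E assume "E \<in> sets (walk_law G \<mu>)"
  then have E: "E \<in> sets paths" by (simp add: walk_law_def markov_measure_def)
  then have "emeasure (walk_law G \<mu>) E = (\<integral>\<^sup>+g. emeasure (walk_from g) E \<partial>return (count_space (carrier G)) \<one>)"
    unfolding walk_law_def by (rule emeasure_markov_measure[rotated]) simp
  also have "\<dots> = emeasure (walk_from \<one>) E"
    by (rule nn_integral_return) simp_all
  finally show "emeasure (walk_law G \<mu>) E = emeasure (walk_from \<one>) E" .
qed (simp add: walk_law_def markov_measure_def)

lemma null_sets_walk_law_count:
  "N \<in> null_sets (walk_law_count G \<mu>) \<longleftrightarrow> (\<forall>g \<in> carrier G. N \<in> null_sets (walk_from g))"
proof (cases "N \<in> sets paths")
  case True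
  then have "emeasure (walk_law_count G \<mu>) N = (\<integral>\<^sup>+g. emeasure (walk_from g) N \<partial>count_space (carrier G))"
    unfolding walk_law_count_def by (intro emeasure_markov_measure) simp
  also have "\<dots> = 0 \<longleftrightarrow> (\<forall>g \<in> carrier G. emeasure (walk_from g) N = 0)"
    by (subst nn_integral_0_iff_AE) (auto simp: AE_count_space)
  finally show ?thesis
    using True by (auto simp: null_sets_def)
qed (auto simp: null_sets_def)

lemma AE_walk_law_count:
  "(AE x in walk_law_count G \<mu>. P x) \<longleftrightarrow> (\<forall>g \<in> carrier G. AE x in walk_from g. P x)"
proof
  assume "AE x in walk_law_count G \<mu>. P x"
  then obtain N where "N \<in> null_sets (walk_law_count G \<mu>)" "{x \<in> space paths. \<not> P x} \<subseteq> N"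
    by (auto simp: eventually_ae_filter)
  then show "\<forall>g \<in> carrier G. AE x in walk_from g. P x"
    using null_sets_walk_law_count by (auto simp: eventually_ae_filter)
next
  assume "\<forall>g \<in> carrier G. AE x in walk_from g. P x"
  then have "\<forall>g \<in> carrier G. \<exists>N. N \<in> null_sets (walk_from g) \<and> {x \<in> space paths. \<not> P x} \<subseteq> N"
    by (auto simp: eventually_ae_filter)
  then obtain N where N: "\<And>g. g \<in> carrier G \<Longrightarrow> N g \<in> null_sets (walk_from g)"
    "\<And>g. g \<in> carrier G \<Longrightarrow> {x \<in> space paths. \<not> P x} \<subseteq> N g"
    by metis
  \<comment> \<open>Each start supplies its own null cover of the exceptional set. The intersection
    still covers that set, is measurable by countability, and is null for every start.\<close>
  let ?N = "\<Inter>g \<in> carrier G. N g"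
  have sets: "?N \<in> sets paths"
    using N(1) one_closed by (intro sets.countable_INT' countable_G) (auto simp: null_sets_def)
  have "?N \<in> null_sets (walk_from g)" if "g \<in> carrier G" for g
    by (rule null_sets_subset[OF N(1)[OF that]]) (use sets that in auto)
  then have "?N \<in> null_sets (walk_law_count G \<mu>)"
    by (simp add: null_sets_walk_law_count)
  moreover have "{x \<in> space (walk_law_count G \<mu>). \<not> P x} \<subseteq> ?N"
    using N(2) by auto
  ultimately show "AE x in walk_law_count G \<mu>. P x"
    by (rule AE_I')
qed

definition invariant_sets :: "(nat \<Rightarrow> 'g) set set" where
  "invariant_sets = {E \<in> sets paths. AE x in walk_law_count G \<mu>. shift x \<in> E \<longleftrightarrow> x \<in> E}"

text \<open>Nullity of an invariant set propagates from the identity along the semigroup generated by the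
  support, because the shift moves the walk issued from \<open>g\<close> to the one issued from \<open>g h\<close>.\<close>

lemma invariant_null:
  assumes E: "E \<in> invariant_sets" and null: "emeasure (walk_from \<one>) E = 0" and g: "g \<in> carrier G"
  shows "emeasure (walk_from g) E = 0"
proof -
  have E': "E \<in> sets paths"
    using E by (simp add: invariant_sets_def)
  have step: "emeasure (walk_from (g \<otimes> s)) E = 0"
    if g: "g \<in> carrier G" and s: "s \<in> supp G \<mu>" and "emeasure (walk_from g) E = 0" for g s
  proof -
    have "emeasure (walk_from g) (shift -` E \<inter> space paths) = emeasure (walk_from g) E"
    proof (rule emeasure_eq_AE)
      have "AE x in walk_from g. shift x \<in> E \<longleftrightarrow> x \<in> E"
        using E g unfolding invariant_sets_def AE_walk_law_count by blast
      with AE_space[of "walk_from g"]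
      show "AE x in walk_from g. x \<in> shift -` E \<inter> space paths \<longleftrightarrow> x \<in> E"
        by eventually_elim simp
    qed (use E' measurable_sets[OF measurable_shift E'] in auto)
    then have int: "(\<integral>\<^sup>+s. emeasure (walk_from (g \<otimes> s)) E \<partial>\<mu>) = 0"
      using that(3) by (simp only: emeasure_shift[OF g E'])
    have "(\<lambda>s. emeasure (walk_from (g \<otimes> s)) E) \<in> borel_measurable \<mu>"
      unfolding measurable_cong_sets[OF sets_\<mu> refl] measurable_count_space_eq1 by simp
    from nn_integral_0_iff_AE[OF this] int have "AE s in \<mu>. emeasure (walk_from (g \<otimes> s)) E = 0"
      by (rule iffD1)
    then obtain N where N: "N \<in> null_sets \<mu>" "{s \<in> space \<mu>. emeasure (walk_from (g \<otimes> s)) E \<noteq> 0} \<subseteq> N"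
      by (auto simp: eventually_ae_filter)
    have "s \<notin> N"
    proof
      assume "s \<in> N"
      then have "measure \<mu> {s} \<le> measure \<mu> N"
        using N(1) s by (intro increment.finite_measure_mono) (auto simp: null_sets_def)
      also have "measure \<mu> N = 0"
        using N(1) by (rule measure_eq_0_null_sets)
      finally show False
        using s by (simp add: supp_def measure_le_0_iff)
    qed
    then show ?thesis
      using N(2) s by (auto simp: supp_def space_\<mu>)
  qed
  \<comment> \<open>The start \<open>k\<close> is quantified inside the induction because for a
    product g h the claim for h is applied at k g.\<close>
  have gen: "g \<in> carrier G \<and> (\<forall>k \<in> carrier G. emeasure (walk_from k) E = 0 \<longrightarrow> emeasure (walk_from (k \<otimes> g)) E = 0)"
    if "g \<in> semigroup_generated G (supp G \<mu>)" for g
    using that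
  proof induction
    case (base s)
    then show ?case using step by (auto simp: supp_def)
  next
    case (mult g h)
    then show ?case by (auto simp: m_assoc[symmetric])
  qed
  have "g \<in> semigroup_generated G (supp G \<mu>)"
    using nondegenerate g by (simp add: strictly_nondegenerate_def)
  from gen[OF this] null g show ?thesis by force
qed

end

subsection \<open>Countable dense families of events\<close>

text \<open>Formal Boolean expressions over a sequence of sets. Their countability comes with the
  datatype, so the algebra generated by countably many sets is countable as a range of
  \<open>eval_term\<close>.\<close>

datatype set_term = Base nat | Compl set_term | Join set_term set_term

instance set_term :: countable by countable_datatype

primrec eval_term :: "'a set \<Rightarrow> (nat \<Rightarrow> 'a set) \<Rightarrow> set_term \<Rightarrow> 'a set" where
  "eval_term \<Omega> B (Base n) = B n"
| "eval_term \<Omega> B (Compl t) = \<Omega> - eval_term \<Omega> B t"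
| "eval_term \<Omega> B (Join s t) = eval_term \<Omega> B s \<union> eval_term \<Omega> B t"

context finite_measure
begin

lemma measure_sym_diff_triangle:
  assumes "A \<in> sets M" "B \<in> sets M" "C \<in> sets M"
  shows "measure M (sym_diff A C) \<le> measure M (sym_diff A B) + measure M (sym_diff B C)"
proof -
  have "measure M (sym_diff A C) \<le> measure M (sym_diff A B \<union> sym_diff B C)"
    using assms by (intro finite_measure_mono sets.Un sets.Diff) auto
  also have "\<dots> \<le> measure M (sym_diff A B) + measure M (sym_diff B C)"
    using assms by (intro measure_Un_le sets.Un sets.Diff)
  finally show ?thesis .
qed

text \<open>The sets approximable in measure by the countable algebra form a sigma-algebra:
  complements keep symmetric differences, and a countable union is first cut to a finite one by
  continuity from below.\<close>

lemma countable_dense_sets: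
  assumes S: "sets M = sigma_sets (space M) S" "countable S"
  obtains T where "countable T" "T \<subseteq> sets M"
    "\<And>E e. E \<in> sets M \<Longrightarrow> 0 < e \<Longrightarrow> \<exists>C \<in> T. measure M (sym_diff E C) < e"
proof -
  define B where "B = from_nat_into (insert {} S)"
  have range_B: "range B = insert {} S"
    unfolding B_def using S(2) by (intro range_from_nat_into) simp_all
  define T where "T = range (eval_term (space M) B)"
  have B_sets: "B n \<in> sets M" for n
  proof -
    have "B n \<in> insert {} S" using range_B by blast
    then show ?thesis using S(1) by (auto intro: sigma_sets.Basic)
  qed
  have eval_sets: "eval_term (space M) B t \<in> sets M" for t
    by (induction t) (auto simp: B_sets)
  have T_compl: "space M - C \<in> T" if C: "C \<in> T" for C
  proof -
    obtain t where "C = eval_term (space M) B t" using C by (auto simp: T_def)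
    then have "space M - C = eval_term (space M) B (Compl t)" by simp
    then show ?thesis unfolding T_def by (rule image_eqI) simp
  qed
  have T_Un: "C \<union> D \<in> T" if CD: "C \<in> T" "D \<in> T" for C D
  proof -
    obtain s t where "C = eval_term (space M) B s" "D = eval_term (space M) B t"
      using CD by (auto simp: T_def)
    then have "C \<union> D = eval_term (space M) B (Join s t)" by simp
    then show ?thesis unfolding T_def by (rule image_eqI) simp
  qed
  have B_T: "C \<in> T" if C: "C \<in> insert {} S" for C
  proof -
    obtain n where "C = B n" using C unfolding range_B[symmetric] by blast
    then have "C = eval_term (space M) B (Base n)" by simp
    then show ?thesis unfolding T_def by (rule image_eqI) simp
  qed
  have T_sets: "T \<subseteq> sets M"
    using eval_sets by (auto simp: T_def)
  define approx where "approx E \<longleftrightarrow> (\<forall>e>0. \<exists>C \<in> T. measure M (sym_diff E C) < e)" for E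
  have approx_Un: "approx (E \<union> F)" if E: "approx E" "E \<in> sets M" and F: "approx F" "F \<in> sets M" for E F
    unfolding approx_def
  proof (intro allI impI)
    fix e :: real assume "0 < e"
    then obtain C D where C: "C \<in> T" "measure M (sym_diff E C) < e / 2"
      and D: "D \<in> T" "measure M (sym_diff F D) < e / 2"
      using E(1) F(1) unfolding approx_def by (meson half_gt_zero)
    have "C \<in> sets M" "D \<in> sets M" using C D T_sets by auto
    have "measure M (sym_diff (E \<union> F) (C \<union> D)) \<le> measure M (sym_diff E C \<union> sym_diff F D)"
      using E F \<open>C \<in> sets M\<close> \<open>D \<in> sets M\<close> by (intro finite_measure_mono sets.Un sets.Diff) auto
    also have "\<dots> \<le> measure M (sym_diff E C) + measure M (sym_diff F D)"
      using E F \<open>C \<in> sets M\<close> \<open>D \<in> sets M\<close> by (intro measure_Un_le sets.Un sets.Diff)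
    also have "\<dots> < e" using C D by simp
    finally show "\<exists>C \<in> T. measure M (sym_diff (E \<union> F) C) < e"
      using T_Un[OF C(1) D(1)] by blast
  qed
  have "approx E" if "E \<in> sigma_sets (space M) S" for E
    using that
  proof induction
    case (Basic E)
    show ?case
      unfolding approx_def
    proof (intro allI impI)
      fix e :: real assume "0 < e"
      then show "\<exists>C \<in> T. measure M (sym_diff E C) < e"
        using B_T Basic by (intro bexI[of _ E]) simp_all
    qed
  next
    case Empty
    show ?case
      unfolding approx_def
    proof (intro allI impI)
      fix e :: real assume "0 < e"
      then show "\<exists>C \<in> T. measure M (sym_diff {} C) < e"
        using B_T by (intro bexI[of _ "{}"]) simp_all
    qed
  next
    case (Compl E)
    then have E: "E \<in> sets M" using S by simp
    show ?case
      unfolding approx_def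
    proof (intro allI impI)
      fix e :: real assume "0 < e"
      then obtain C where C: "C \<in> T" "measure M (sym_diff E C) < e"
        using Compl.IH unfolding approx_def by blast
      have "sym_diff (space M - E) (space M - C) = sym_diff E C"
        using sets.sets_into_space[OF E] sets.sets_into_space[of C] C(1) T_sets by blast
      then show "\<exists>C \<in> T. measure M (sym_diff (space M - E) C) < e"
        using C T_compl[OF C(1)] by (intro bexI[of _ "space M - C"]) simp_all
    qed
  next
    case (Union A)
    then have A: "A i \<in> sets M" for i using S by simp
    define U where "U n = (\<Union>i<n. A i)" for n
    have U: "U n \<in> sets M" for n unfolding U_def using A by auto
    have approx_U: "approx (U n)" for n
    proof (induction n)
      case 0
      show ?case
        unfolding approx_def
      proof (intro allI impI)
        fix e :: real assume "0 < e"
        then show "\<exists>C \<in> T. measure M (sym_diff (U 0) C) < e"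
          using B_T by (intro bexI[of _ "{}"]) (simp_all add: U_def)
      qed
    next
      case (Suc n)
      have "U (Suc n) = U n \<union> A n" by (auto simp: U_def less_Suc_eq)
      then show ?case using approx_Un[OF Suc U Union.IH A] by simp
    qed
    have Union_U: "(\<Union>n. U n) = (\<Union>i. A i)" by (auto simp: U_def)
    have "incseq U"
      unfolding incseq_def U_def by (intro allI impI UN_mono) auto
    then have "(\<lambda>n. measure M (U n)) \<longlonglongrightarrow> measure M (\<Union>n. U n)"
      using U by (intro finite_Lim_measure_incseq) blast+
    then have lim: "(\<lambda>n. measure M (U n)) \<longlonglongrightarrow> measure M (\<Union>i. A i)" by (simp only: Union_U)
    show ?case
      unfolding approx_def
    proof (intro allI impI)
      fix e :: real assume e: "0 < e"
      then have "eventually (\<lambda>n. measure M (\<Union>i. A i) - e / 2 < measure M (U n)) sequentially"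
        by (intro order_tendstoD(1)[OF lim]) simp
      then obtain n where n: "measure M (\<Union>i. A i) - e / 2 < measure M (U n)"
        by (auto simp: eventually_sequentially)
      obtain C where C: "C \<in> T" "measure M (sym_diff (U n) C) < e / 2"
        using approx_U e unfolding approx_def by (meson half_gt_zero)
      have sub: "U n \<subseteq> (\<Union>i. A i)" by (auto simp: U_def)
      have UA: "(\<Union>i. A i) \<in> sets M" using A by auto
      have "sym_diff (\<Union>i. A i) (U n) = (\<Union>i. A i) - U n"
        using sub by blast
      then have "measure M (sym_diff (\<Union>i. A i) (U n)) = measure M (\<Union>i. A i) - measure M (U n)"
        using finite_measure_Diff[OF UA U sub] by simp
      then have "measure M (sym_diff (\<Union>i. A i) C) < e"
        using measure_sym_diff_triangle[OF UA U, of C n] n C T_sets by fastforce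
      then show "\<exists>C \<in> T. measure M (sym_diff (\<Union>i. A i) C) < e"
        using C(1) by blast
    qed
  qed
  then have "\<exists>C \<in> T. measure M (sym_diff E C) < e" if "E \<in> sets M" "0 < e" for E e
    using that S(1) by (simp add: approx_def)
  moreover have "countable T" unfolding T_def by simp
  ultimately show ?thesis using T_sets by (intro that)
qed

text \<open>Approximants taken from the whole sigma-algebra may lie outside \<open>J\<close>. For
  each of them and each radius 1 / Suc n a nearby member of \<open>J\<close> is chosen if there is
  one, as in the proof that subspaces of separable metric spaces are separable.\<close>

lemma countable_dense_subfamily:
  assumes S: "sets M = sigma_sets (space M) S" "countable S" and J: "J \<subseteq> sets M" "J \<noteq> {}"
  obtains e :: "nat \<Rightarrow> 'a set" where "\<And>k. e k \<in> J"
    "\<And>E r. E \<in> J \<Longrightarrow> 0 < r \<Longrightarrow> \<exists>k. measure M (sym_diff E (e k)) < r"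
proof -
  obtain T where T: "countable T" "T \<subseteq> sets M"
    "\<And>E e. E \<in> sets M \<Longrightarrow> 0 < e \<Longrightarrow> \<exists>C \<in> T. measure M (sym_diff E C) < e"
    using countable_dense_sets[OF S] by metis
  define pick where "pick = (\<lambda>(C, n :: nat). SOME E. E \<in> J \<and>
    ((\<exists>F \<in> J. measure M (sym_diff F C) < 1 / Suc n) \<longrightarrow> measure M (sym_diff E C) < 1 / Suc n))"
  have pick: "pick (C, n) \<in> J \<and>
    ((\<exists>F \<in> J. measure M (sym_diff F C) < 1 / Suc n) \<longrightarrow> measure M (sym_diff (pick (C, n)) C) < 1 / Suc n)" for C n
  proof -
    have "\<exists>E. E \<in> J \<and> ((\<exists>F \<in> J. measure M (sym_diff F C) < 1 / Suc n) \<longrightarrow> measure M (sym_diff E C) < 1 / Suc n)"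
    proof (cases "\<exists>F \<in> J. measure M (sym_diff F C) < 1 / Suc n")
      case False
      obtain E where "E \<in> J" using J(2) by blast
      with False show ?thesis by (intro exI[of _ E]) (simp only: simp_thms)
    qed blast
    from someI_ex[OF this] show ?thesis by (simp add: pick_def)
  qed
  define P where "P = pick ` (T \<times> UNIV)"
  have "{} \<in> sets M" by simp
  from T(3)[OF this, of 1] have "T \<noteq> {}" by auto
  then have P: "countable P" "P \<noteq> {}" "P \<subseteq> J"
    using T(1) pick by (auto simp: P_def)
  have dense: "\<exists>k. measure M (sym_diff E (from_nat_into P k)) < r" if E: "E \<in> J" and r: "0 < r" for E r
  proof -
    obtain n where n: "1 / Suc n < r / 2"
      using r nat_approx_posE[of "r / 2"] by auto
    have ES: "E \<in> sets M" using E J by auto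
    obtain C where C: "C \<in> T" "measure M (sym_diff E C) < 1 / Suc n"
      using T(3)[OF ES, of "1 / Suc n"] by auto
    have "pick (C, n) \<in> P" using C(1) by (auto simp: P_def)
    then obtain k where k: "from_nat_into P k = pick (C, n)"
      using from_nat_into_surj[OF P(1)] by blast
    have p: "measure M (sym_diff (pick (C, n)) C) < 1 / Suc n" "pick (C, n) \<in> sets M"
      using pick[of C n] C(2) E J(1) by blast+
    have "sym_diff C (pick (C, n)) = sym_diff (pick (C, n)) C" by blast
    then have "measure M (sym_diff E (pick (C, n))) < 1 / Suc n + 1 / Suc n"
      using measure_sym_diff_triangle[OF ES _ p(2), of C] C T(2) p(1) by fastforce
    then show ?thesis using n k by (intro exI[of _ k]) simp
  qed
  show ?thesis
  proof (rule that)
    show "from_nat_into P k \<in> J" for k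
      using from_nat_into[OF P(2)] P(3) by blast
  qed (rule dense)
qed

end

subsection \<open>Poisson boundaries\<close>

lemma second_countable_euclidean:
  "second_countable (euclidean :: 'a::second_countable_topology topology)"
proof -
  obtain B :: "'a set set" where B: "countable B" "topological_basis B"
    using ex_countable_basis by blast
  show ?thesis
    unfolding second_countable_def
  proof (intro exI[of _ B] conjI ballI allI impI)
    fix V assume "V \<in> B" then show "openin euclidean V"
      using topological_basis_open[OF B(2)] by simp
  next
    fix U :: "'a set" and x assume "openin euclidean U \<and> x \<in> U"
    then show "\<exists>V \<in> B. x \<in> V \<and> V \<subseteq> U"
      using topological_basisE[OF B(2), of U x] by (metis open_openin)
  qed (rule B(1))
qed

lemma standard_borel_if_sets_eq_borel:
  fixes Y :: "'a::polish_space measure"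
  assumes "sets Y = sets borel"
  shows "standard_borel Y"
  unfolding standard_borel_def
proof (intro exI[of _ euclidean] conjI)
  show "topspace euclidean = space Y"
    using sets_eq_imp_space_eq[OF assms] by simp
  show "sets Y = sets (borel_of_topology euclidean)"
    using assms by (simp add: borel_of_topology_def borel_def)
qed (rule completely_metrizable_space_euclidean second_countable_euclidean)+

context random_walk
begin

section \<open>Harmonic measure and construction of the Poisson boundary\<close>

lemma AE_left_mult:
  assumes "AE x in walk_law_count G \<mu>. P x" "k \<in> carrier G"
  shows "AE x in walk_law_count G \<mu>. P (left_mult k x)"
  unfolding AE_walk_law_count
proof
  fix g assume g: "g \<in> carrier G"
  then have "AE x in distr (walk_from g) paths (left_mult k). P x"
    unfolding distr_left_mult[OF assms(2) g] using assms by (simp add: AE_walk_law_count)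
  moreover have "left_mult k \<in> walk_from g \<rightarrow>\<^sub>M paths"
    using measurable_left_mult[OF assms(2)] measurable_cong_sets[OF sets_walk_from refl] by blast
  ultimately show "AE x in walk_from g. P (left_mult k x)"
    by (rule AE_distrD[rotated])
qed

lemma invariant_setsI:
  assumes f: "f \<in> paths \<rightarrow>\<^sub>M M" "AE x in walk_law_count G \<mu>. f (shift x) = f x" and "D \<in> sets M"
  shows "f -` D \<inter> space paths \<in> invariant_sets"
proof -
  have "AE x in walk_law_count G \<mu>. shift x \<in> f -` D \<inter> space paths \<longleftrightarrow> x \<in> f -` D \<inter> space paths"
    using f(2) AE_space by eventually_elim (simp add: shift_space)
  then show ?thesis
    using measurable_sets[OF f(1) assms(3)] by (simp add: invariant_sets_def)
qed

lemma AE_walk_law: "(AE x in walk_law_count G \<mu>. P x) \<Longrightarrow> AE x in walk_law G \<mu>. P x"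
  unfolding walk_law_eq AE_walk_law_count using one_closed by blast

lemma measurable_walk_law: "f \<in> walk_law G \<mu> \<rightarrow>\<^sub>M M \<longleftrightarrow> f \<in> paths \<rightarrow>\<^sub>M M"
  unfolding walk_law_eq by (simp add: measurable_cong_sets[OF sets_walk_from refl])

lemma emeasure_distr_walk_law:
  assumes "f \<in> paths \<rightarrow>\<^sub>M M" "N \<in> sets M"
  shows "emeasure (distr (walk_law G \<mu>) M f) N = emeasure (walk_from \<one>) (f -` N \<inter> space paths)"
  using assms by (simp add: emeasure_distr measurable_walk_law) (simp add: walk_law_eq)

text \<open>Pulling \<open>N\<close> back by the action of g amounts to starting the walk at g. The
  preimage of \<open>N\<close> in path space is invariant and null from the identity, so
  \<open>invariant_null\<close> makes it null from g.\<close>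

lemma harmonic_measure_quasi_invariant:
  assumes f: "f \<in> paths \<rightarrow>\<^sub>M M" "AE x in walk_law_count G \<mu>. f (shift x) = f x"
    and g: "g \<in> carrier G" "a \<in> M \<rightarrow>\<^sub>M M" "\<And>x. x \<in> space paths \<Longrightarrow> f (left_mult g x) = a (f x)"
    and N: "N \<in> null_sets (distr (walk_law G \<mu>) M f)"
  shows "a -` N \<inter> space M \<in> null_sets (distr (walk_law G \<mu>) M f)"
proof -
  define E where "E = f -` N \<inter> space paths"
  have NM: "N \<in> sets M" using N by (simp add: null_sets_def)
  have E: "E \<in> invariant_sets"
    unfolding E_def using f NM by (rule invariant_setsI)
  then have E_sets: "E \<in> sets paths" by (simp add: invariant_sets_def)
  have "emeasure (walk_from \<one>) E = 0"
    using N f NM by (simp add: E_def null_sets_def emeasure_distr_walk_law)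
  then have "emeasure (walk_from g) E = 0"
    using invariant_null[OF E _ g(1)] by simp
  then have "emeasure (distr (walk_from \<one>) paths (left_mult g)) E = 0"
    using g(1) by (simp add: distr_left_mult)
  then have "emeasure (walk_from \<one>) (left_mult g -` E \<inter> space paths) = 0"
    using emeasure_distr[of "left_mult g" "walk_from \<one>" paths E] measurable_left_mult[OF g(1)] E_sets
    by (simp add: measurable_cong_sets[OF sets_walk_from refl])
  moreover have "left_mult g -` E \<inter> space paths = f -` (a -` N \<inter> space M) \<inter> space paths"
    using g(3) left_mult_space[OF g(1)] measurable_space[OF f(1)] by (auto simp: E_def)
  ultimately show ?thesis
    using f(1) measurable_sets[OF g(2) NM] by (simp add: null_sets_def emeasure_distr_walk_law)
qed

lemma sets_paths_generated:
  obtains S where "countable S" "sets paths = sigma_sets (space paths) S"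
proof
  define S where "S = (\<lambda>(n, a). {x \<in> space paths. x n = a}) ` (UNIV \<times> carrier G)"
  show "countable S"
    unfolding S_def using countable_G by (intro countable_image countable_SIGMA) simp_all
  have gen: "sets paths = sigma_sets (space paths)
      {{x \<in> space paths. x n \<in> A} | n A. A \<subseteq> carrier G}"
    unfolding path_space_def by (subst sets_PiM_single) (simp add: space_PiM)
  have cyl: "{x \<in> space paths. x n \<in> A} \<in> sigma_sets (space paths) S" if A: "A \<subseteq> carrier G" for n A
  proof -
    have "{x \<in> space paths. x n = a} \<in> sigma_sets (space paths) S" if "a \<in> A" for a
      using that A by (intro sigma_sets.Basic) (auto simp: S_def)
    moreover have "countable A" using A countable_G by (rule countable_subset)
    ultimately have "(\<Union>a \<in> A. {x \<in> space paths. x n = a}) \<in> sigma_sets (space paths) S"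
      by (intro sigma_sets_UNION[of "(\<lambda>a. {x \<in> space paths. x n = a}) ` A"]) auto
    also have "(\<Union>a \<in> A. {x \<in> space paths. x n = a}) = {x \<in> space paths. x n \<in> A}" by auto
    finally show ?thesis .
  qed
  show "sets paths = sigma_sets (space paths) S"
  proof
    show "sets paths \<subseteq> sigma_sets (space paths) S"
      unfolding gen by (rule sigma_sets_mono) (auto intro: cyl)
    show "sigma_sets (space paths) S \<subseteq> sets paths"
    proof (rule sets.sigma_sets_subset, rule subsetI)
      fix C assume "C \<in> S"
      then obtain n a where C: "a \<in> carrier G" "C = {x \<in> space paths. x n = a}"
        by (auto simp: S_def)
      then have "C = (\<lambda>x. x n) -` {a} \<inter> space paths" by auto
      then show "C \<in> sets paths"
        using measurable_sets[OF measurable_coordinate, of "{a}" n] C(1) by simp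
    qed
  qed
qed

text \<open>The coordinates of the boundary map are the indicators of the translates of a countable family
  of invariant sets that is dense among all of them with respect to the law of the walk issued from
  the identity; the group acts by permuting the coordinates.\<close>

lemma poisson_boundary_exists:
  "\<exists>(Y :: (nat \<Rightarrow> real) measure) act \<pi>. poisson_boundary G \<mu> Y act \<pi>"
proof -
  interpret W: prob_space "walk_from \<one>"
    by (rule prob_space_walk_from) simp
  obtain S where S: "countable S" "sets paths = sigma_sets (space paths) S"
    using sets_paths_generated by metis
  have empty: "{} \<in> invariant_sets" by (simp add: invariant_sets_def)
  have inv_sub: "invariant_sets \<subseteq> sets (walk_from \<one>)"
    by (auto simp: invariant_sets_def)
  obtain e :: "nat \<Rightarrow> (nat \<Rightarrow> 'g) set" where e: "\<And>k. e k \<in> invariant_sets"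
    and dense: "\<And>E r. E \<in> invariant_sets \<Longrightarrow> 0 < r \<Longrightarrow> \<exists>k. measure (walk_from \<one>) (sym_diff E (e k)) < r"
    using W.countable_dense_subfamily[of S invariant_sets] S empty inv_sub by (metis emptyE sets_walk_from space_walk_from)
  have e_sets: "e k \<in> sets paths" for k
    using e[of k] by (simp add: invariant_sets_def)
  have e_inv: "AE x in walk_law_count G \<mu>. shift x \<in> e k \<longleftrightarrow> x \<in> e k" for k
    using e[of k] by (simp add: invariant_sets_def)
  \<comment> \<open>Coordinate (k, a) will record whether the path lies in the translate of
    \<open>e k\<close> by a. The factor \<open>nat\<close> makes the index set infinite, so it can
    be enumerated bijectively by \<open>b\<close>, with inverse \<open>c\<close>.\<close>
  define I where "I = (UNIV :: nat set) \<times> carrier G"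
  have "countable I" "infinite I"
    unfolding I_def using countable_G one_closed by (auto simp: finite_cartesian_product_iff)
  then obtain b :: "nat \<Rightarrow> nat \<times> 'g" where b: "bij_betw b UNIV I"
    using bij_betw_from_nat_into by blast
  define c where "c = the_inv_into UNIV b"
  have bc: "b (c i) = i" if "i \<in> I" for i
    using f_the_inv_into_f_bij_betw[OF b, of i] that by (simp add: c_def)
  have bI: "snd (b i) \<in> carrier G" for i
  proof -
    have "b i \<in> I" using b by (auto simp: bij_betw_def)
    then show ?thesis by (simp add: I_def mem_Times_iff)
  qed
  define \<pi> where "\<pi> x i = (if left_mult (inv (snd (b i))) x \<in> e (fst (b i)) then 1 else 0 :: real)" for x i
  \<comment> \<open>The translate of a path by g lies in a \<open>e k\<close> exactly if the path
    lies in g^-1 a \<open>e k\<close>; hence only the group index moves.\<close>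
  define act where "act g y i = (y (c (fst (b i), inv g \<otimes> snd (b i))) :: real)" for g y i
  define Y where "Y = distr (walk_law G \<mu>) borel \<pi>"
  have cI: "b (c (k, g)) = (k, g)" if "g \<in> carrier G" for k g
    using that by (intro bc) (simp add: I_def)
  have \<pi>: "\<pi> \<in> paths \<rightarrow>\<^sub>M borel"
  proof (rule measurable_coordinatewise_then_product)
    fix i
    have "(\<lambda>y. if y \<in> e (fst (b i)) then 1 else 0 :: real) \<in> paths \<rightarrow>\<^sub>M borel"
      using e_sets by (intro measurable_If_set) simp_all
    from measurable_compose[OF measurable_left_mult[OF inv_closed[OF bI]] this]
    show "(\<lambda>x. \<pi> x i) \<in> borel_measurable paths"
      unfolding \<pi>_def .
  qed
  have act: "act g \<in> borel \<rightarrow>\<^sub>M borel" for g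
    unfolding act_def by (rule measurable_coordinatewise_then_product) (rule measurable_product_coordinates)
  have equivariant: "\<pi> (left_mult g x) = act g (\<pi> x)" if "g \<in> carrier G" "x \<in> space paths" for g x
  proof
    fix i
    have "left_mult (inv (snd (b i))) (left_mult g x) = left_mult (inv (inv g \<otimes> snd (b i))) x"
      using that bI by (simp add: left_mult_left_mult inv_mult_group)
    then show "\<pi> (left_mult g x) i = act g (\<pi> x) i"
      using that bI by (simp add: \<pi>_def act_def cI)
  qed
  have shift_inv: "AE x in walk_law_count G \<mu>. \<pi> (shift x) = \<pi> x"
  proof -
    have "AE x in walk_law_count G \<mu>. \<pi> (shift x) i = \<pi> x i" for i
      using AE_left_mult[OF e_inv[of "fst (b i)"] inv_closed[OF bI[of i]]]
      by eventually_elim (simp add: \<pi>_def shift_left_mult)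
    then have "AE x in walk_law_count G \<mu>. \<forall>i. \<pi> (shift x) i = \<pi> x i"
      by (simp add: AE_all_countable)
    then show ?thesis
      by eventually_elim auto
  qed
  have sets_Y: "sets Y = sets borel" by (simp add: Y_def)
  have space_Y: "space Y = UNIV" by (simp add: Y_def)
  have Yb: "M \<rightarrow>\<^sub>M Y = M \<rightarrow>\<^sub>M borel" for M :: "'z measure"
    by (rule measurable_cong_sets) (simp_all add: sets_Y)
  have factor: "\<exists>D \<in> sets Y. AE x in walk_law_count G \<mu>. x \<in> E \<longleftrightarrow> \<pi> x \<in> D"
    if E: "E \<in> invariant_sets" for E
  proof -
    have E_sets: "E \<in> sets paths" and E_inv: "AE x in walk_law_count G \<mu>. shift x \<in> E \<longleftrightarrow> x \<in> E"
      using E by (simp_all add: invariant_sets_def)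
    \<comment> \<open>Summable radii allow Borel-Cantelli: almost surely only finitely many of the
      chosen sets disagree with \<open>E\<close>, so \<open>E\<close> is their limit superior, which
      is visible in the coordinates whose group index is the identity.\<close>
    have "\<exists>k. measure (walk_from \<one>) (sym_diff E (e k)) < (1/2) ^ j" for j
      by (rule dense[OF E]) simp
    then obtain k where k: "\<And>j. measure (walk_from \<one>) (sym_diff E (e (k j))) < (1/2) ^ j"
      by metis
    define D where "D = {y :: nat \<Rightarrow> real. \<forall>m. \<exists>j \<ge> m. y (c (k j, \<one>)) = 1}"
    have D: "D \<in> sets borel"
      unfolding D_def by measurable
    define N where "N = {x \<in> space paths. \<not> (x \<in> E \<longleftrightarrow> (\<forall>m. \<exists>j \<ge> m. x \<in> e (k j)))}"
    have N: "N \<in> sets paths"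
      unfolding N_def using E_sets e_sets by measurable
    have "AE x in walk_law_count G \<mu>. \<forall>j. shift x \<in> e (k j) \<longleftrightarrow> x \<in> e (k j)"
      using e_inv by (simp add: AE_all_countable)
    with E_inv AE_space have "AE x in walk_law_count G \<mu>. shift x \<in> N \<longleftrightarrow> x \<in> N"
      by eventually_elim (simp add: N_def shift_space)
    \<comment> \<open>Density and Borel-Cantelli speak only of the walk from the identity;
      invariance of the exceptional set \<open>N\<close> lets \<open>invariant_null\<close> carry
      its nullity to all starts.\<close>
    then have N_inv: "N \<in> invariant_sets" using N by (simp add: invariant_sets_def)
    have "AE x in walk_from \<one>. eventually (\<lambda>j. x \<in> space (walk_from \<one>) - sym_diff E (e (k j))) sequentially"
    proof (rule borel_cantelli_AE1)
      show "sym_diff E (e (k j)) \<in> sets (walk_from \<one>)" for j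
        using E_sets e_sets by auto
      show "emeasure (walk_from \<one>) (sym_diff E (e (k j))) < \<infinity>" for j
        unfolding infinity_ennreal_def less_top[symmetric] by (rule W.emeasure_finite)
      show "summable (\<lambda>j. measure (walk_from \<one>) (sym_diff E (e (k j))))"
        by (rule summable_comparison_test'[where g = "\<lambda>j. (1/2) ^ j" and N = 0])
          (use k in \<open>auto simp: less_imp_le summable_geometric\<close>)
    qed
    then have "AE x in walk_from \<one>. x \<notin> N"
    proof eventually_elim
      case (elim x)
      then obtain m where m: "\<And>j. j \<ge> m \<Longrightarrow> x \<in> E \<longleftrightarrow> x \<in> e (k j)"
        by (auto simp: eventually_sequentially)
      have "x \<in> E \<longleftrightarrow> (\<forall>n. \<exists>j \<ge> n. x \<in> e (k j))"
      proof
        assume "x \<in> E"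
        then have "x \<in> e (k (max n m))" for n using m[of "max n m"] by simp
        then show "\<forall>n. \<exists>j \<ge> n. x \<in> e (k j)"
          by (meson max.cobounded1)
      next
        assume "\<forall>n. \<exists>j \<ge> n. x \<in> e (k j)"
        then show "x \<in> E" using m by blast
      qed
      then show ?case by (simp add: N_def)
    qed
    then have "N \<in> null_sets (walk_from \<one>)"
      using N by (subst AE_iff_null_sets) simp_all
    then have "emeasure (walk_from \<one>) N = 0" by (rule null_setsD1)
    then have "N \<in> null_sets (walk_law_count G \<mu>)"
      unfolding null_sets_walk_law_count using invariant_null[OF N_inv] N by (auto intro: null_setsI)
    then have "AE x in walk_law_count G \<mu>. x \<notin> N" by (rule AE_not_in)
    with AE_space have "AE x in walk_law_count G \<mu>. x \<in> E \<longleftrightarrow> \<pi> x \<in> D"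
    proof eventually_elim
      case (elim x)
      then have "\<pi> x (c (k j, \<one>)) = 1 \<longleftrightarrow> x \<in> e (k j)" for j
        by (simp add: \<pi>_def cI left_mult_one)
      with elim show ?case by (simp add: D_def N_def)
    qed
    then show ?thesis using D sets_Y by (intro bexI[of _ D]) simp_all
  qed
  have "poisson_boundary G \<mu> Y act \<pi>"
    unfolding poisson_boundary_def
  proof (intro conjI ballI)
    show "ergodic_components (walk_law_count G \<mu>) (\<lambda>x n. x (Suc n)) Y \<pi>"
      unfolding ergodic_components_def
    proof (intro conjI ballI impI)
      show "standard_borel Y"
        by (rule standard_borel_if_sets_eq_borel[OF sets_Y])
      show "\<pi> \<in> walk_law_count G \<mu> \<rightarrow>\<^sub>M Y"
        using \<pi> measurable_cong_sets[OF sets_walk_law_count sets_Y] by blast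
      show "AE x in walk_law_count G \<mu>. \<pi> (\<lambda>n. x (Suc n)) = \<pi> x"
        using shift_inv by (simp add: shift_def)
      fix E assume "E \<in> sets (walk_law_count G \<mu>)"
        "AE x in walk_law_count G \<mu>. (\<lambda>n. x (Suc n)) \<in> E \<longleftrightarrow> x \<in> E"
      then show "\<exists>D \<in> sets Y. AE x in walk_law_count G \<mu>. x \<in> E \<longleftrightarrow> \<pi> x \<in> D"
        by (intro factor) (simp add: invariant_sets_def shift_def)
    qed
    show "measure_G_space G act Y"
      unfolding measure_G_space_def
    proof (intro conjI ballI)
      fix g assume g: "g \<in> carrier G"
      show "act g \<in> Y \<rightarrow>\<^sub>M Y"
        using act measurable_cong_sets[OF sets_Y sets_Y] by blast
      show "act (g \<otimes> h) y = act g (act h y)" if h: "h \<in> carrier G" for h y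
      proof
        fix i
        have "inv (g \<otimes> h) \<otimes> snd (b i) = inv h \<otimes> (inv g \<otimes> snd (b i))"
          using g h bI by (simp add: inv_mult_group m_assoc)
        moreover have "b (c (fst (b i), inv g \<otimes> snd (b i))) = (fst (b i), inv g \<otimes> snd (b i))"
          using g bI by (intro cI) simp
        ultimately show "act (g \<otimes> h) y i = act g (act h y) i"
          by (simp add: act_def)
      qed
      fix N assume "N \<in> null_sets Y"
      then show "act g -` N \<inter> space Y \<in> null_sets Y"
        using harmonic_measure_quasi_invariant[OF \<pi> shift_inv g act equivariant[OF g], of N]
        by (simp add: Y_def)
    next
      show "act \<one> y = y" for y
      proof
        fix i
        have "b (c (b i)) = b i"
          by (rule bc) (use bij_betwE[OF b] in blast)
        then have "c (b i) = i"
          using b by (simp add: bij_betw_def inj_eq)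
        then show "act \<one> y i = y i" using bI by (simp add: act_def)
      qed
    qed
    show "AE x in walk_law_count G \<mu>. \<pi> (\<lambda>n. g \<otimes> x n) = act g (\<pi> x)" if "g \<in> carrier G" for g
      using AE_space by eventually_elim (use equivariant[OF that] in \<open>simp add: left_mult_def\<close>)
    show "Y = distr (walk_law G \<mu>) Y \<pi>"
      unfolding Y_def by (rule distr_cong) simp_all
  qed
  then show ?thesis by blast
qed

text \<open>The criterion applied to the limit field. The hypothesis \<open>factor\<close> asks that
  f descend along every map through which all invariant sets descend; this is the only property of
  the boundary map from which \<open>\<psi>\<close> is produced.\<close>

lemma mu_boundaryI:
  assumes f: "f \<in> paths \<rightarrow>\<^sub>M M" "\<And>x. x \<in> space paths \<Longrightarrow> f (shift x) = f x"
    and equivariant: "\<And>g x. g \<in> carrier G \<Longrightarrow> x \<in> space paths \<Longrightarrow> f (left_mult g x) = act g (f x)"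
    and act: "\<And>g. g \<in> carrier G \<Longrightarrow> act g \<in> M \<rightarrow>\<^sub>M M" "\<And>y. y \<in> space M \<Longrightarrow> act \<one> y = y"
      "\<And>g h y. g \<in> carrier G \<Longrightarrow> h \<in> carrier G \<Longrightarrow> y \<in> space M \<Longrightarrow> act (g \<otimes> h) y = act g (act h y)"
    and separating: "countable U" "U \<subseteq> sets M"
      "\<And>y z. y \<in> space M \<Longrightarrow> z \<in> space M \<Longrightarrow> (\<And>A. A \<in> U \<Longrightarrow> y \<in> A \<longleftrightarrow> z \<in> A) \<Longrightarrow> y = z"
    and factor: "\<And>(Y :: (nat \<Rightarrow> real) measure) \<pi>. \<pi> \<in> paths \<rightarrow>\<^sub>M Y \<Longrightarrow>
      (\<And>E. E \<in> invariant_sets \<Longrightarrow> \<exists>D \<in> sets Y. AE x in walk_law_count G \<mu>. x \<in> E \<longleftrightarrow> \<pi> x \<in> D) \<Longrightarrow>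
      \<exists>\<psi> \<in> Y \<rightarrow>\<^sub>M M. AE x in walk_law_count G \<mu>. \<psi> (\<pi> x) = f x"
  shows "mu_boundary G \<mu> (distr (walk_law G \<mu>) M f) act"
proof -
  let ?M = "distr (walk_law G \<mu>) M f"
  have f_shift: "AE x in walk_law_count G \<mu>. f (shift x) = f x"
    using AE_space by eventually_elim (simp add: f(2))
  have G_space: "measure_G_space G act ?M"
    unfolding measure_G_space_def
  proof (intro conjI ballI)
    fix g N assume g: "g \<in> carrier G" and "N \<in> null_sets ?M"
    from harmonic_measure_quasi_invariant[OF f(1) f_shift g act(1)[OF g] equivariant[OF g] this(2)]
    show "act g -` N \<inter> space ?M \<in> null_sets ?M" by simp
  qed (use act in simp_all)
  obtain Y :: "(nat \<Rightarrow> real) measure" and actY \<pi> where pb: "poisson_boundary G \<mu> Y actY \<pi>"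
    using poisson_boundary_exists by blast
  have \<pi>: "\<pi> \<in> paths \<rightarrow>\<^sub>M Y"
    using pb measurable_cong_sets[OF sets_walk_law_count refl]
    unfolding poisson_boundary_def ergodic_components_def by blast
  have Y: "Y = distr (walk_law G \<mu>) Y \<pi>"
    using pb unfolding poisson_boundary_def by blast
  have "\<forall>E \<in> sets (walk_law_count G \<mu>). (AE x in walk_law_count G \<mu>. (\<lambda>n. x (Suc n)) \<in> E \<longleftrightarrow> x \<in> E) \<longrightarrow>
        (\<exists>D \<in> sets Y. AE x in walk_law_count G \<mu>. x \<in> E \<longleftrightarrow> \<pi> x \<in> D)"
    using pb unfolding poisson_boundary_def ergodic_components_def by blast
  then have "\<exists>D \<in> sets Y. AE x in walk_law_count G \<mu>. x \<in> E \<longleftrightarrow> \<pi> x \<in> D" if "E \<in> invariant_sets" for E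
    using that unfolding invariant_sets_def shift_def sets_walk_law_count by blast
  from factor[OF \<pi> this] obtain \<psi> where \<psi>: "\<psi> \<in> Y \<rightarrow>\<^sub>M M" "AE x in walk_law_count G \<mu>. \<psi> (\<pi> x) = f x"
    by blast
  have equi: "AE y in Y. \<psi> (actY g y) = act g (\<psi> y)" if g: "g \<in> carrier G" for g
  proof -
    have actY: "actY g \<in> Y \<rightarrow>\<^sub>M Y"
      using pb g unfolding poisson_boundary_def measure_G_space_def by blast
    \<comment> \<open>The failure of equivariance is known to be null on path space and must be
      measurable to be transported to \<open>Y\<close>. The separating family writes it as a
      countable union of measurable sets.\<close>
    define N where "N = {y \<in> space Y. \<exists>A \<in> U. \<not> (\<psi> (actY g y) \<in> A \<longleftrightarrow> act g (\<psi> y) \<in> A)}"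
    have "N = (\<Union>A \<in> U. sym_diff ((\<lambda>y. \<psi> (actY g y)) -` A \<inter> space Y) ((\<lambda>y. act g (\<psi> y)) -` A \<inter> space Y))"
      by (auto simp: N_def)
    moreover have "(\<lambda>y. \<psi> (actY g y)) -` A \<inter> space Y \<in> sets Y" "(\<lambda>y. act g (\<psi> y)) -` A \<inter> space Y \<in> sets Y"
      if "A \<in> U" for A
      using that separating(2) measurable_sets[OF measurable_compose[OF actY \<psi>(1)], of A]
        measurable_sets[OF measurable_compose[OF \<psi>(1) act(1)[OF g]], of A] by auto
    ultimately have N: "N \<in> sets Y"
      using separating(1) by (auto intro!: sets.countable_UN'')
    have "AE x in walk_law_count G \<mu>. \<pi> (\<lambda>n. g \<otimes> x n) = actY g (\<pi> x)"
      using pb g unfolding poisson_boundary_def by blast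
    with \<psi>(2) AE_left_mult[OF \<psi>(2) g] AE_space
    have "AE x in walk_law_count G \<mu>. \<pi> x \<notin> N"
    proof eventually_elim
      case (elim x)
      then show ?case
        using equivariant[OF g, of x] by (simp add: N_def left_mult_def)
    qed
    then have "AE x in walk_law G \<mu>. \<pi> x \<notin> N" by (rule AE_walk_law)
    then have "AE y in distr (walk_law G \<mu>) Y \<pi>. y \<notin> N"
      using N \<pi> by (subst AE_distr_iff) (auto simp: measurable_walk_law)
    then have "AE y in Y. y \<notin> N" unfolding Y[symmetric] .
    with AE_space show ?thesis
    proof eventually_elim
      case (elim y)
      have "\<psi> (actY g y) \<in> space M" "act g (\<psi> y) \<in> space M"
        using elim(1) measurable_space[OF \<psi>(1)] measurable_space[OF actY] measurable_space[OF act(1)[OF g]]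
        by auto
      then show ?case
        using elim by (intro separating(3)) (auto simp: N_def)
    qed
  qed
  have "?M = distr Y ?M \<psi>"
  proof -
    have "distr (distr (walk_law G \<mu>) Y \<pi>) M \<psi> = distr (walk_law G \<mu>) M (\<psi> \<circ> \<pi>)"
      using \<psi>(1) \<pi> by (intro distr_distr) (simp_all add: measurable_walk_law)
    also have "\<dots> = ?M"
      using AE_walk_law[OF \<psi>(2)] f(1) measurable_comp[OF \<pi> \<psi>(1)]
      by (intro distr_cong_AE) (simp_all add: measurable_walk_law)
    finally have "?M = distr Y M \<psi>" unfolding Y[symmetric] by (rule sym)
    also have "\<dots> = distr Y ?M \<psi>" by (rule distr_cong) simp_all
    finally show ?thesis .
  qed
  moreover have "\<psi> \<in> Y \<rightarrow>\<^sub>M ?M" using \<psi>(1) by simp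
  ultimately show ?thesis
    unfolding mu_boundary_def using G_space pb equi by blast
qed

end

section \<open>The end compactification of a countable graph\<close>

lemma pred_countable_Ball:
  assumes "countable I" "\<And>i. i \<in> I \<Longrightarrow> Measurable.pred M (P i)"
  shows "Measurable.pred M (\<lambda>x. \<forall>i\<in>I. P i x)"
proof -
  have "{x \<in> space M. \<forall>i\<in>I. P i x} = space M - (\<Union>i\<in>I. space M - {x \<in> space M. P i x})"
    by auto
  moreover have "\<dots> \<in> sets M"
    using assms by (intro sets.Diff sets.countable_UN'') (auto simp: pred_def)
  ultimately show ?thesis by (simp add: pred_def)
qed

lemma pred_countable_Bex:
  assumes "countable I" "\<And>i. i \<in> I \<Longrightarrow> Measurable.pred M (P i)"
  shows "Measurable.pred M (\<lambda>x. \<exists>i\<in>I. P i x)"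
proof -
  have "{x \<in> space M. \<exists>i\<in>I. P i x} = (\<Union>i\<in>I. {x \<in> space M. P i x})"
    by auto
  moreover have "\<dots> \<in> sets M"
    using assms by (intro sets.countable_UN'') (auto simp: pred_def)
  ultimately show ?thesis by (simp add: pred_def)
qed

locale end_graph =
  fixes V :: "'v set" and E :: "('v \<times> 'v) set"
  assumes countable_V: "countable V" and sym_E: "sym E"
begin

abbreviation adj_off :: "'v set \<Rightarrow> ('v \<times> 'v) set" where
  "adj_off K \<equiv> (Restr E (V - K))\<^sup>*"

definition inf_components :: "'v set \<Rightarrow> 'v set set" where
  "inf_components K = {C \<in> components_off V E K. infinite C}"

lemma sym_adj_off: "sym (adj_off K)"
  using sym_E by (intro sym_rtrancl) (auto simp: sym_def)

lemma component_containing: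
  assumes "x \<in> V - K"
  shows "adj_off K `` {x} \<in> components_off V E K" "x \<in> adj_off K `` {x}"
  using assms by (auto simp: components_off_def quotient_def)

lemma component_eq:
  assumes "C \<in> components_off V E K" "x \<in> C"
  shows "C = adj_off K `` {x}"
proof -
  obtain a where a: "C = adj_off K `` {a}"
    using assms(1) by (auto simp: components_off_def quotient_def)
  then have "(a, x) \<in> adj_off K" "(x, a) \<in> adj_off K"
    using assms(2) symD[OF sym_adj_off] by auto
  then show ?thesis
    unfolding a by (auto intro: rtrancl_trans)
qed

lemma components_eqI:
  assumes "C \<in> components_off V E K" "C' \<in> components_off V E K" "x \<in> C" "x \<in> C'"
  shows "C = C'"
  using component_eq[OF assms(1,3)] component_eq[OF assms(2,4)] by simp

lemma component_subset:
  assumes "C \<in> components_off V E K"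
  shows "C \<subseteq> V - K"
proof -
  obtain a where a: "a \<in> V - K" "C = adj_off K `` {a}"
    using assms by (auto simp: components_off_def quotient_def)
  have "x \<in> V - K" if "(a, x) \<in> adj_off K" for x
    using that a(1) by (induction rule: rtrancl_induct) auto
  then show ?thesis using a by auto
qed

lemma component_nonempty: "C \<in> components_off V E K \<Longrightarrow> C \<noteq> {}"
  by (auto simp: components_off_def quotient_def)

lemma countable_components: "countable (components_off V E K)"
proof -
  have "components_off V E K = (\<lambda>x. adj_off K `` {x}) ` (V - K)"
    by (auto simp: components_off_def quotient_def)
  then show ?thesis using countable_V by simp
qed

lemma countable_inf_components: "countable (inf_components K)"
  by (rule countable_subset[OF _ countable_components[of K]]) (auto simp: inf_components_def)

lemma countable_finite_parts: "countable (finite_parts V)"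
  using countable_Collect_finite_subset[OF countable_V] by (simp add: finite_parts_def conj_commute)

lemma finite_parts_Un: "K \<in> finite_parts V \<Longrightarrow> K' \<in> finite_parts V \<Longrightarrow> K \<union> K' \<in> finite_parts V"
  by (auto simp: finite_parts_def)

lemma ends_component: "\<omega> \<in> ends V E \<Longrightarrow> K \<in> finite_parts V \<Longrightarrow> \<omega> K \<in> inf_components K"
  by (auto simp: ends_def inf_components_def)

lemma inf_components_components: "C \<in> inf_components K \<Longrightarrow> C \<in> components_off V E K"
  by (simp add: inf_components_def)

lemma ends_mono:
  "\<omega> \<in> ends V E \<Longrightarrow> K \<in> finite_parts V \<Longrightarrow> K' \<in> finite_parts V \<Longrightarrow> K \<subseteq> K' \<Longrightarrow> \<omega> K' \<subseteq> \<omega> K"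
  by (auto simp: ends_def)

lemma ends_eqI:
  assumes "\<omega> \<in> ends V E" "\<omega>' \<in> ends V E" "\<And>K. K \<in> finite_parts V \<Longrightarrow> \<omega> K = \<omega>' K"
  shows "\<omega> = \<omega>'"
  using assms by (auto simp: ends_def intro: PiE_ext)

text \<open>Cylinders form a neighbourhood base at an end: two conditions, at K and K', both follow
  from the one at the union, because the component off a larger set determines those off smaller
  ones.\<close>

lemma end_neighbourhood:
  assumes "openin (end_compactification V E) U" "Inr \<omega> \<in> U" "\<omega> \<in> ends V E"
  shows "\<exists>K \<in> finite_parts V. Inl ` (\<omega> K) \<union> Inr ` {\<omega>' \<in> ends V E. \<omega>' K = \<omega> K} \<subseteq> U"
proof -
  from assms(1) have "generate_topology_on ({{Inl v} | v. v \<in> V} \<union>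
      {Inl ` C \<union> Inr ` {\<omega> \<in> ends V E. \<omega> K = C} | K C.
         K \<in> finite_parts V \<and> C \<in> components_off V E K}) U"
    unfolding end_compactification_def by (rule openin_topology_generated_by)
  then show ?thesis
    using assms(2)
  proof induction
    case Empty
    then show ?case by simp
  next
    case (Int a b)
    have mem: "Inr \<omega> \<in> a" "Inr \<omega> \<in> b" using Int.prems by simp_all
    obtain K where K1: "K \<in> finite_parts V"
      and a: "Inl ` (\<omega> K) \<union> Inr ` {\<omega>' \<in> ends V E. \<omega>' K = \<omega> K} \<subseteq> a"
      using Int.IH(1)[OF mem(1)] ..
    obtain K' where K2: "K' \<in> finite_parts V"
      and b: "Inl ` (\<omega> K') \<union> Inr ` {\<omega>' \<in> ends V E. \<omega>' K' = \<omega> K'} \<subseteq> b"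
      using Int.IH(2)[OF mem(2)] ..
    note K = K1 K2
    let ?K = "K \<union> K'"
    have *: "\<omega> ?K \<subseteq> \<omega> L \<and> (\<forall>\<omega>' \<in> ends V E. \<omega>' ?K = \<omega> ?K \<longrightarrow> \<omega>' L = \<omega> L)"
      if L: "L \<in> finite_parts V" "L \<subseteq> ?K" for L
    proof (intro conjI ballI impI)
      show "\<omega> ?K \<subseteq> \<omega> L"
        using ends_mono[OF assms(3) L(1) finite_parts_Un[OF K] L(2)] .
      fix \<omega>' assume \<omega>': "\<omega>' \<in> ends V E" "\<omega>' ?K = \<omega> ?K"
      have "\<omega> ?K \<noteq> {}"
        using ends_component[OF assms(3) finite_parts_Un[OF K]]
        by (intro component_nonempty inf_components_components)
      then obtain x where "x \<in> \<omega> ?K" by auto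
      then have "x \<in> \<omega> L" "x \<in> \<omega>' L"
        using \<omega>'(2) \<open>\<omega> ?K \<subseteq> \<omega> L\<close> ends_mono[OF \<omega>'(1) L(1) finite_parts_Un[OF K] L(2)] by blast+
      then show "\<omega>' L = \<omega> L"
        by (intro components_eqI[of "\<omega>' L" L] inf_components_components ends_component L(1) \<omega>'(1) assms(3))
    qed
    have nbhd: "Inl ` (\<omega> ?K) \<union> Inr ` {\<omega>' \<in> ends V E. \<omega>' ?K = \<omega> ?K}
        \<subseteq> Inl ` (\<omega> L) \<union> Inr ` {\<omega>' \<in> ends V E. \<omega>' L = \<omega> L}"
      if "L \<in> finite_parts V" "L \<subseteq> ?K" for L
      using *[OF that] by (intro Un_mono image_mono) auto
    show ?case
      using subset_trans[OF nbhd[OF K(1)] a] subset_trans[OF nbhd[OF K(2)] b]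
      by (intro bexI[OF _ finite_parts_Un[OF K]] Int_greatest) simp_all
  next
    case (UN S)
    then obtain k where k: "k \<in> S" "Inr \<omega> \<in> k" by blast
    from UN.IH[OF this] obtain K where K: "K \<in> finite_parts V"
      and sub: "Inl ` (\<omega> K) \<union> Inr ` {\<omega>' \<in> ends V E. \<omega>' K = \<omega> K} \<subseteq> k" ..
    have "k \<subseteq> \<Union>S" using k(1) by (rule Sup_upper)
    with sub K show ?case by (intro bexI[of _ K]) (rule subset_trans)
  next
    case (Basis s)
    have "s \<notin> {{Inl v} | v. v \<in> V}"
      using Basis.prems by auto
    with Basis.hyps have "s \<in> {Inl ` C \<union> Inr ` {\<omega> \<in> ends V E. \<omega> K = C} | K C.
         K \<in> finite_parts V \<and> C \<in> components_off V E K}"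
      by (simp only: Un_iff simp_thms)
    then obtain K C where K: "K \<in> finite_parts V" and s: "s = Inl ` C \<union> Inr ` {\<omega> \<in> ends V E. \<omega> K = C}"
      by (elim CollectE exE conjE)
    from Basis.prems have \<omega>K: "\<omega> K = C" unfolding s by blast
    show ?case unfolding s \<omega>K[symmetric] by (rule bexI[OF subset_refl K])
  qed
qed

lemma openin_end_basic:
  assumes "K \<in> finite_parts V" "C \<in> components_off V E K"
  shows "openin (end_compactification V E) (Inl ` C \<union> Inr ` {\<omega> \<in> ends V E. \<omega> K = C})"
  unfolding end_compactification_def using assms by (intro topology_generated_by_Basis) blast

lemma Inr_end_in_topspace:
  assumes "\<omega> \<in> ends V E"
  shows "Inr \<omega> \<in> topspace (end_compactification V E)"
proof -
  have "{} \<in> finite_parts V" by (simp add: finite_parts_def)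
  then have "openin (end_compactification V E) (Inl ` \<omega> {} \<union> Inr ` {\<omega>' \<in> ends V E. \<omega>' {} = \<omega> {}})"
    using openin_end_basic ends_component[OF assms] inf_components_components by blast
  then show ?thesis
    using assms by (auto dest!: openin_subset)
qed

text \<open>Replaces the topology by countably many eventual memberships, the form on which both
  measurability and the path argument rest.\<close>

lemma converges_to_end_iff:
  "converges_to_end V E x \<omega> \<longleftrightarrow>
     \<omega> \<in> ends V E \<and> (\<forall>K \<in> finite_parts V. eventually (\<lambda>n. x n \<in> \<omega> K) sequentially)"
proof (cases "\<omega> \<in> ends V E")
  case \<omega>: True
  show ?thesis
  proof
    assume "converges_to_end V E x \<omega>"
    then have lim: "limitin (end_compactification V E) (\<lambda>n. Inl (x n)) (Inr \<omega>) sequentially"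
      by (simp add: converges_to_end_def)
    have "eventually (\<lambda>n. x n \<in> \<omega> K) sequentially" if K: "K \<in> finite_parts V" for K
    proof -
      have "eventually (\<lambda>n. Inl (x n) \<in> Inl ` \<omega> K \<union> Inr ` {\<omega>' \<in> ends V E. \<omega>' K = \<omega> K}) sequentially"
        using lim openin_end_basic[OF K inf_components_components[OF ends_component[OF \<omega> K]]] \<omega>
        by (auto simp: limitin_def)
      then show ?thesis by (rule eventually_mono) auto
    qed
    then show "\<omega> \<in> ends V E \<and> (\<forall>K \<in> finite_parts V. eventually (\<lambda>n. x n \<in> \<omega> K) sequentially)"
      using \<omega> by blast
  next
    assume ev: "\<omega> \<in> ends V E \<and> (\<forall>K \<in> finite_parts V. eventually (\<lambda>n. x n \<in> \<omega> K) sequentially)"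
    have "eventually (\<lambda>n. Inl (x n) \<in> U) sequentially"
      if U: "openin (end_compactification V E) U" "Inr \<omega> \<in> U" for U
    proof -
      obtain K where "K \<in> finite_parts V" "Inl ` (\<omega> K) \<subseteq> U"
        using end_neighbourhood[OF U \<omega>] by auto
      then have "eventually (\<lambda>n. x n \<in> \<omega> K) sequentially" "\<And>v. v \<in> \<omega> K \<Longrightarrow> Inl v \<in> U"
        using ev by blast+
      then show ?thesis by (rule eventually_mono)
    qed
    then show "converges_to_end V E x \<omega>"
      unfolding converges_to_end_def limitin_def using \<omega> Inr_end_in_topspace[OF \<omega>] by blast
  qed
qed (simp add: converges_to_end_def)

lemma converges_to_end_unique:
  assumes "converges_to_end V E x \<omega>" "converges_to_end V E x \<omega>'"
  shows "\<omega> = \<omega>'"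
proof (rule ends_eqI)
  show \<omega>: "\<omega> \<in> ends V E" and \<omega>': "\<omega>' \<in> ends V E"
    using assms by (auto simp: converges_to_end_def)
  fix K assume K: "K \<in> finite_parts V"
  then have "eventually (\<lambda>n. x n \<in> \<omega> K \<and> x n \<in> \<omega>' K) sequentially"
    using assms by (auto simp: converges_to_end_iff eventually_conj_iff)
  then obtain n where "x n \<in> \<omega> K" "x n \<in> \<omega>' K"
    by (auto simp: eventually_sequentially)
  then show "\<omega> K = \<omega>' K"
    using ends_component[OF \<omega> K] ends_component[OF \<omega>' K]
    by (meson components_eqI inf_components_components)
qed

section \<open>Borel structure on the space of ends and decoding of end-valued maps\<close>

abbreviation ends_borel :: "('v set \<Rightarrow> 'v set) measure" where
  "ends_borel \<equiv> borel_of_topology (ends_topology V E)"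

lemma topspace_ends: "topspace (ends_topology V E) = ends V E"
  using Inr_end_in_topspace by (auto simp: ends_topology_def topspace_pullback_topology)

lemma space_ends_borel: "space ends_borel = ends V E"
  by (simp add: borel_of_topology_def topspace_ends space_measure_of_conv)

lemma openin_ends_cylinder:
  assumes "K \<in> finite_parts V"
  shows "openin (ends_topology V E) {\<omega> \<in> ends V E. \<omega> K = C}"
proof (cases "C \<in> components_off V E K")
  case True
  have "{\<omega> \<in> ends V E. \<omega> K = C} = Inr -` (Inl ` C \<union> Inr ` {\<omega> \<in> ends V E. \<omega> K = C}) \<inter> ends V E"
    by auto
  then show ?thesis
    unfolding ends_topology_def openin_pullback_topology
    using openin_end_basic[OF assms True] by blast
next
  case False
  then have "{\<omega> \<in> ends V E. \<omega> K = C} = {}"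
    using ends_component[OF _ assms] inf_components_components by blast
  then show ?thesis by (simp only: openin_empty)
qed

lemma sets_ends_borel_cylinder:
  assumes "K \<in> finite_parts V"
  shows "{\<omega> \<in> ends V E. \<omega> K = C} \<in> sets ends_borel"
  unfolding borel_of_topology_def
  by (subst sets_measure_of)
    (use openin_ends_cylinder[OF assms] openin_subset in \<open>auto intro: sigma_sets.Basic\<close>)

text \<open>There are only countably many pairs (K, C), so every open set of ends is a countable
  union of cylinders.\<close>

lemma measurable_ends_borelI:
  assumes "f \<in> space M \<rightarrow> ends V E"
    and "\<And>K C. K \<in> finite_parts V \<Longrightarrow> C \<in> inf_components K \<Longrightarrow> Measurable.pred M (\<lambda>x. f x K = C)"
  shows "f \<in> M \<rightarrow>\<^sub>M ends_borel"
  unfolding borel_of_topology_def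
proof (rule measurable_measure_of)
  show "{U. openin (ends_topology V E) U} \<subseteq> Pow (topspace (ends_topology V E))"
    by (auto dest: openin_subset)
  show "f \<in> space M \<rightarrow> topspace (ends_topology V E)"
    using assms(1) by (simp add: topspace_ends)
  fix W assume "W \<in> {U. openin (ends_topology V E) U}"
  then obtain U where U: "openin (end_compactification V E) U" and W: "W = Inr -` U \<inter> ends V E"
    by (auto simp: ends_topology_def openin_pullback_topology)
  define J where "J = {(K, C) \<in> Sigma (finite_parts V) inf_components. {\<omega> \<in> ends V E. \<omega> K = C} \<subseteq> W}"
  have "\<omega> \<in> W \<longleftrightarrow> (\<exists>j \<in> J. \<omega> (fst j) = snd j)" if \<omega>: "\<omega> \<in> ends V E" for \<omega>
  proof
    assume "\<omega> \<in> W"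
    then have "Inr \<omega> \<in> U" by (auto simp: W)
    from end_neighbourhood[OF U this \<omega>] obtain K
      where K: "K \<in> finite_parts V" "Inr ` {\<omega>' \<in> ends V E. \<omega>' K = \<omega> K} \<subseteq> U" by auto
    then have "(K, \<omega> K) \<in> J"
      using ends_component[OF \<omega> K(1)] by (auto simp: J_def W)
    then show "\<exists>j \<in> J. \<omega> (fst j) = snd j"
      by (rule rev_bexI) simp
  qed (use \<omega> in \<open>auto simp: J_def\<close>)
  then have "f -` W \<inter> space M = {x \<in> space M. \<exists>j \<in> J. f x (fst j) = snd j}"
    using assms(1) by (auto simp: Pi_iff)
  moreover have "Measurable.pred M (\<lambda>x. \<exists>j \<in> J. f x (fst j) = snd j)"
  proof (rule pred_countable_Bex)
    show "countable J"
      by (rule countable_subset[of _ "Sigma (finite_parts V) inf_components"])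
        (auto simp: J_def intro!: countable_SIGMA countable_finite_parts countable_inf_components)
  qed (auto simp: J_def intro: assms(2))
  ultimately show "f -` W \<inter> space M \<in> sets M"
    by (simp add: pred_def)
qed

text \<open>A relation between finite sets and components that is the graph of an end can be decoded; all
  end-valued maps below are measurable because they arise in this way.\<close>

definition coherent :: "('v set \<Rightarrow> 'v set \<Rightarrow> bool) \<Rightarrow> bool" where
  "coherent D \<longleftrightarrow> (\<forall>K \<in> finite_parts V. \<exists>C \<in> inf_components K. D K C) \<and>
     (\<forall>K \<in> finite_parts V. \<forall>K' \<in> finite_parts V. \<forall>C \<in> inf_components K. \<forall>C' \<in> inf_components K'.
        K \<subseteq> K' \<longrightarrow> D K C \<longrightarrow> D K' C' \<longrightarrow> C' \<subseteq> C)"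

definition decode :: "('v set \<Rightarrow> 'v set) \<Rightarrow> ('v set \<Rightarrow> 'v set \<Rightarrow> bool) \<Rightarrow> 'v set \<Rightarrow> 'v set" where
  "decode \<omega>\<^sub>0 D = (if coherent D then (\<lambda>K \<in> finite_parts V. THE C. C \<in> inf_components K \<and> D K C) else \<omega>\<^sub>0)"

lemma decode_coherent:
  assumes "coherent D" "K \<in> finite_parts V" "C \<in> inf_components K"
  shows "decode \<omega>\<^sub>0 D K = C \<longleftrightarrow> D K C"
proof -
  note ex = assms(1)[unfolded coherent_def, THEN conjunct1, rule_format]
  note sub = assms(1)[unfolded coherent_def, THEN conjunct2, rule_format]
  obtain C\<^sub>1 where C1: "C\<^sub>1 \<in> inf_components K" "D K C\<^sub>1"
    using ex[OF assms(2)] by blast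
  have uniq: "C' = C\<^sub>1" if "C' \<in> inf_components K" "D K C'" for C'
    using sub[OF assms(2,2) C1(1) that(1) subset_refl C1(2) that(2)]
      sub[OF assms(2,2) that(1) C1(1) subset_refl that(2) C1(2)] by (rule equalityI)
  have "(THE C. C \<in> inf_components K \<and> D K C) = C\<^sub>1"
    by (rule the_equality) (use C1 uniq in blast)+
  then have "decode \<omega>\<^sub>0 D K = C\<^sub>1"
    using assms(1,2) by (simp add: decode_def)
  with C1(2) uniq[OF assms(3)] show ?thesis
    by metis
qed

lemma decode_coherent_in_ends:
  assumes True: "coherent D"
  shows "decode \<omega>\<^sub>0 D \<in> ends V E"
proof -
  have *: "decode \<omega>\<^sub>0 D K \<in> inf_components K \<and> D K (decode \<omega>\<^sub>0 D K)" if "K \<in> finite_parts V" for K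
  proof -
    obtain C where "C \<in> inf_components K" "D K C"
      using True \<open>K \<in> finite_parts V\<close> unfolding coherent_def by blast
    then show ?thesis
      using decode_coherent[OF True that, of C] by metis
  qed
  have "decode \<omega>\<^sub>0 D \<in> extensional (finite_parts V)"
    using True by (simp add: decode_def)
  moreover have "decode \<omega>\<^sub>0 D K' \<subseteq> decode \<omega>\<^sub>0 D K"
    if "K \<in> finite_parts V" "K' \<in> finite_parts V" "K \<subseteq> K'" for K K'
    using True[unfolded coherent_def, THEN conjunct2, rule_format, OF that(1,2) _ _ that(3)]
      *[OF that(1)] *[OF that(2)] by blast
  ultimately show ?thesis
    using * by (auto simp: ends_def PiE_def inf_components_def)
qed

lemma decode_in_ends:
  assumes "\<omega>\<^sub>0 \<in> ends V E"
  shows "decode \<omega>\<^sub>0 D \<in> ends V E"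
  using decode_coherent_in_ends assms by (cases "coherent D") (simp_all add: decode_def)

lemma coherent_end:
  assumes "\<omega> \<in> ends V E" "\<And>K C. K \<in> finite_parts V \<Longrightarrow> C \<in> inf_components K \<Longrightarrow> D K C \<longleftrightarrow> C = \<omega> K"
  shows "coherent D"
  unfolding coherent_def
proof (intro conjI ballI impI)
  fix K assume "K \<in> finite_parts V"
  then show "\<exists>C \<in> inf_components K. D K C"
    using assms(2) ends_component[OF assms(1)] by blast
next
  fix K K' C C'
  assume "K \<in> finite_parts V" "K' \<in> finite_parts V" "C \<in> inf_components K" "C' \<in> inf_components K'"
    "K \<subseteq> K'" "D K C" "D K' C'"
  then show "C' \<subseteq> C"
    using assms(2) ends_mono[OF assms(1)] by metis
qed

lemma decode_end:
  assumes "\<omega> \<in> ends V E" "\<And>K C. K \<in> finite_parts V \<Longrightarrow> C \<in> inf_components K \<Longrightarrow> D K C \<longleftrightarrow> C = \<omega> K"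
    and "\<omega>\<^sub>0 \<in> ends V E"
  shows "decode \<omega>\<^sub>0 D = \<omega>"
proof (rule ends_eqI[OF decode_in_ends[OF assms(3)] assms(1)])
  have coh: "coherent D"
    by (rule coherent_end[OF assms(1)]) (rule assms(2))
  fix K assume "K \<in> finite_parts V"
  then show "decode \<omega>\<^sub>0 D K = \<omega> K"
    using decode_coherent[OF coh _ ends_component[OF assms(1)]] assms(2) ends_component[OF assms(1)]
    by simp
qed

lemma measurable_decode:
  assumes "\<omega>\<^sub>0 \<in> ends V E"
    and D: "\<And>K C. K \<in> finite_parts V \<Longrightarrow> C \<in> inf_components K \<Longrightarrow> Measurable.pred M (\<lambda>x. D x K C)"
  shows "(\<lambda>x. decode \<omega>\<^sub>0 (D x)) \<in> M \<rightarrow>\<^sub>M ends_borel"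
proof (rule measurable_ends_borelI)
  show "(\<lambda>x. decode \<omega>\<^sub>0 (D x)) \<in> space M \<rightarrow> ends V E"
    using decode_in_ends[OF assms(1)] by auto
  have coh: "Measurable.pred M (\<lambda>x. coherent (D x))"
    unfolding coherent_def
    by (intro pred_intros_logic pred_countable_Ball pred_countable_Bex countable_finite_parts
        countable_inf_components; simp add: D)
  fix K C assume K: "K \<in> finite_parts V" "C \<in> inf_components K"
  have "(decode \<omega>\<^sub>0 (D x) K = C) = (if coherent (D x) then D x K C else \<omega>\<^sub>0 K = C)" for x
    using decode_coherent[OF _ K] by (auto simp: decode_def)
  moreover have "Measurable.pred M (\<lambda>x. if coherent (D x) then D x K C else \<omega>\<^sub>0 K = C)"
    using coh D[OF K] by measurable
  ultimately show "Measurable.pred M (\<lambda>x. decode \<omega>\<^sub>0 (D x) K = C)"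
    by simp
qed

text \<open>Nesting is automatic: two components that contain a common late point of the sequence
  are nested whenever their finite sets are, since removing more vertices only disconnects further.
  Only the existence of a component for each K remains to be checked.\<close>

lemma coherent_eventually:
  assumes "\<And>K. K \<in> finite_parts V \<Longrightarrow> \<exists>C \<in> inf_components K. eventually (\<lambda>n. p n \<in> C) sequentially"
  shows "coherent (\<lambda>K C. eventually (\<lambda>n. p n \<in> C) sequentially)"
  unfolding coherent_def
proof (intro conjI ballI impI)
  fix K K' C C'
  assume K: "K \<subseteq> K'" and C: "C \<in> inf_components K" "C' \<in> inf_components K'"
    and ev: "eventually (\<lambda>n. p n \<in> C) sequentially" "eventually (\<lambda>n. p n \<in> C') sequentially"
  from ev have "eventually (\<lambda>n. p n \<in> C \<and> p n \<in> C') sequentially"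
    by (rule eventually_conj)
  then obtain n where n: "p n \<in> C" "p n \<in> C'"
    by (auto simp: eventually_sequentially)
  have "adj_off K' \<subseteq> adj_off K"
    using K by (intro rtrancl_mono) auto
  then show "C' \<subseteq> C"
    using component_eq[OF inf_components_components[OF C(1)] n(1)]
      component_eq[OF inf_components_components[OF C(2)] n(2)] by auto
qed (rule assms)

lemma converges_decode:
  assumes "coherent (\<lambda>K C. eventually (\<lambda>n. p n \<in> C) sequentially)"
  shows "converges_to_end V E p (decode \<omega>\<^sub>0 (\<lambda>K C. eventually (\<lambda>n. p n \<in> C) sequentially))"
  unfolding converges_to_end_iff
proof (intro conjI ballI)
  show lim_end: "decode \<omega>\<^sub>0 (\<lambda>K C. eventually (\<lambda>n. p n \<in> C) sequentially) \<in> ends V E"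
    by (rule decode_coherent_in_ends[OF assms])
  fix K assume K: "K \<in> finite_parts V"
  show "eventually (\<lambda>n. p n \<in> decode \<omega>\<^sub>0 (\<lambda>K C. eventually (\<lambda>n. p n \<in> C) sequentially) K) sequentially"
    using decode_coherent[OF assms K ends_component[OF lim_end K]] by blast
qed

lemma converges_iff_coherent:
  "(\<exists>\<omega>. converges_to_end V E p \<omega>) \<longleftrightarrow> coherent (\<lambda>K C. eventually (\<lambda>n. p n \<in> C) sequentially)"
proof
  assume "\<exists>\<omega>. converges_to_end V E p \<omega>"
  then obtain \<omega> where \<omega>: "\<omega> \<in> ends V E" "\<And>K. K \<in> finite_parts V \<Longrightarrow> eventually (\<lambda>n. p n \<in> \<omega> K) sequentially"
    by (auto simp: converges_to_end_iff)
  show "coherent (\<lambda>K C. eventually (\<lambda>n. p n \<in> C) sequentially)"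
    by (rule coherent_eventually) (use \<omega> ends_component in blast)
qed (rule exI, rule converges_decode)

text \<open>Turns the definite description used for the limit into a decoded relation, to which
  \<open>measurable_decode\<close> applies.\<close>

lemma limit_eq_decode:
  "(if \<exists>\<omega>. converges_to_end V E p \<omega> then THE \<omega>. converges_to_end V E p \<omega> else \<omega>\<^sub>0) =
     decode \<omega>\<^sub>0 (\<lambda>K C. eventually (\<lambda>n. p n \<in> C) sequentially)"
proof (cases "\<exists>\<omega>. converges_to_end V E p \<omega>")
  case True
  then have "converges_to_end V E p (decode \<omega>\<^sub>0 (\<lambda>K C. eventually (\<lambda>n. p n \<in> C) sequentially))"
    unfolding converges_iff_coherent by (rule converges_decode)
  with True show ?thesis
    using converges_to_end_unique by (simp add: the_equality)
next
  case False
  then have "\<not> coherent (\<lambda>K C. eventually (\<lambda>n. p n \<in> C) sequentially)"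
    unfolding converges_iff_coherent .
  with False show ?thesis
    by (simp add: decode_def)
qed

end

section \<open>Dirichlet energy of finitely supported functions\<close>

definition finsupp :: "('a \<Rightarrow> real) \<Rightarrow> bool" where
  "finsupp f \<longleftrightarrow> finite {x. f x \<noteq> 0}"

text \<open>Summation over the whole type, later the real line: group elements are bijections of it,
  so sums can be reindexed without carrying the dyadics along.\<close>

definition total :: "('a \<Rightarrow> real) \<Rightarrow> real" where
  "total f = infsum f UNIV"

definition variation :: "('a \<Rightarrow> 'a) \<Rightarrow> ('a \<Rightarrow> real) \<Rightarrow> real" where
  "variation g u = total (\<lambda>x. (u x - u (g x))\<^sup>2)"

lemma finsupp_subset: "finsupp f \<Longrightarrow> (\<And>x. f x = 0 \<Longrightarrow> g x = 0) \<Longrightarrow> finsupp g"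
  unfolding finsupp_def by (rule finite_subset[rotated]) auto

lemma finsupp_subset2:
  assumes "finsupp f" "finsupp g" "\<And>x. f x = 0 \<Longrightarrow> g x = 0 \<Longrightarrow> h x = 0"
  shows "finsupp h"
proof -
  have "finite ({x. f x \<noteq> 0} \<union> {x. g x \<noteq> 0})"
    using assms(1,2) by (simp add: finsupp_def)
  then show ?thesis
    unfolding finsupp_def by (rule finite_subset[rotated]) (use assms(3) in auto)
qed

lemma finsupp_add: "finsupp f \<Longrightarrow> finsupp g \<Longrightarrow> finsupp (\<lambda>x. f x + g x)"
  by (erule (1) finsupp_subset2) simp

lemma finsupp_cmult: "finsupp f \<Longrightarrow> finsupp (\<lambda>x. c * f x)"
  by (erule finsupp_subset) simp

lemma finsupp_sum: "(\<And>i. i \<in> I \<Longrightarrow> finsupp (f i)) \<Longrightarrow> finsupp (\<lambda>x. \<Sum>i\<in>I. f i x)"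
  by (induction I rule: infinite_finite_induct) (simp_all add: finsupp_add, simp_all add: finsupp_def)

lemma finsupp_bij:
  assumes "finsupp f" "bij g"
  shows "finsupp (\<lambda>x. f (g x))"
proof -
  have "finite (g -` {x. f x \<noteq> 0})"
    using assms by (intro finite_vimageI) (auto simp: finsupp_def bij_def)
  then show ?thesis by (simp add: finsupp_def vimage_def)
qed

lemma summable_finsupp: "finsupp f \<Longrightarrow> f summable_on UNIV"
  by (rule finite_nonzero_values_imp_summable_on) (simp add: finsupp_def)

lemma total_eq_sum:
  assumes "finite A" "\<And>x. x \<notin> A \<Longrightarrow> f x = 0"
  shows "total f = sum f A"
proof -
  have "total f = infsum f A"
    unfolding total_def using assms(2) by (intro infsum_cong_neutral) auto
  then show ?thesis using assms(1) by simp
qed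

lemma total_add: "finsupp f \<Longrightarrow> finsupp g \<Longrightarrow> total (\<lambda>x. f x + g x) = total f + total g"
  unfolding total_def by (intro infsum_add summable_finsupp)

lemma total_cmult: "total (\<lambda>x. c * f x) = c * total f"
  unfolding total_def by (rule infsum_cmult_right')

lemma total_sum: "(\<And>i. i \<in> I \<Longrightarrow> finsupp (f i)) \<Longrightarrow> total (\<lambda>x. \<Sum>i\<in>I. f i x) = (\<Sum>i\<in>I. total (f i))"
  by (induction I rule: infinite_finite_induct)
    (simp_all add: total_add finsupp_sum, simp_all add: total_def)

lemma total_mono: "finsupp f \<Longrightarrow> finsupp g \<Longrightarrow> (\<And>x. f x \<le> g x) \<Longrightarrow> total f \<le> total g"
  unfolding total_def by (intro infsum_mono summable_finsupp)

lemma total_nonneg: "(\<And>x. 0 \<le> f x) \<Longrightarrow> 0 \<le> total f"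
  unfolding total_def by (rule infsum_nonneg)

lemma total_bij: "bij g \<Longrightarrow> total (\<lambda>x. f (g x)) = total f"
  unfolding total_def by (rule infsum_reindex_bij_betw)

lemma sum_le_total: "finsupp f \<Longrightarrow> (\<And>x. 0 \<le> f x) \<Longrightarrow> finite B \<Longrightarrow> sum f B \<le> total f"
  unfolding total_def by (intro finite_sum_le_infsum summable_finsupp) auto

lemma finsupp_gradient: "finsupp u \<Longrightarrow> bij g \<Longrightarrow> finsupp (\<lambda>x. (u x - u (g x))\<^sup>2)"
  by (rule finsupp_subset2[of u "\<lambda>x. u (g x)"]) (simp_all add: finsupp_bij)

lemma variation_nonneg: "0 \<le> variation g u"
  unfolding variation_def by (rule total_nonneg) simp

lemma square_sum_le: "(a + b)\<^sup>2 \<le> 2 * a\<^sup>2 + 2 * (b::real)\<^sup>2"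
  using zero_le_power2[of "a - b"] by (simp add: power2_eq_square algebra_simps)

text \<open>The difference is split at the intermediate point g x, and bijectivity of g reindexes
  the second sum; the factors 2 come from \<open>square_sum_le\<close>.\<close>

lemma variation_comp:
  assumes "finsupp u" "bij g" "bij h"
  shows "variation (h \<circ> g) u \<le> 2 * variation g u + 2 * variation h u"
proof -
  have fh: "finsupp (\<lambda>x. (u (g x) - u (h (g x)))\<^sup>2)"
    using finsupp_bij[OF finsupp_gradient[OF assms(1,3)] assms(2)] .
  have fg: "finsupp (\<lambda>x. (u x - u (g x))\<^sup>2)"
    using finsupp_gradient[OF assms(1,2)] .
  have "variation (h \<circ> g) u \<le> total (\<lambda>x. 2 * (u x - u (g x))\<^sup>2 + 2 * (u (g x) - u (h (g x)))\<^sup>2)"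
    unfolding variation_def
  proof (rule total_mono)
    show "finsupp (\<lambda>x. (u x - u ((h \<circ> g) x))\<^sup>2)"
      by (rule finsupp_gradient[OF assms(1) bij_comp[OF assms(2,3)]])
    show "(u x - u ((h \<circ> g) x))\<^sup>2 \<le> 2 * (u x - u (g x))\<^sup>2 + 2 * (u (g x) - u (h (g x)))\<^sup>2" for x
      using square_sum_le[of "u x - u (g x)" "u (g x) - u (h (g x))"] by simp
  qed (intro finsupp_add finsupp_cmult fg fh)
  also have "\<dots> = 2 * variation g u + 2 * total (\<lambda>x. (u (g x) - u (h (g x)))\<^sup>2)"
    unfolding variation_def by (simp add: total_add total_cmult finsupp_cmult fg fh)
  also have "total (\<lambda>x. (u (g x) - u (h (g x)))\<^sup>2) = variation h u"
    unfolding variation_def by (rule total_bij[OF assms(2), of "\<lambda>y. (u y - u (h y))\<^sup>2"])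
  finally show ?thesis .
qed

lemma variation_add:
  assumes "finsupp u" "finsupp v" "bij g"
  shows "variation g (\<lambda>x. u x + v x) \<le> 2 * variation g u + 2 * variation g v"
proof -
  have "variation g (\<lambda>x. u x + v x) \<le> total (\<lambda>x. 2 * (u x - u (g x))\<^sup>2 + 2 * (v x - v (g x))\<^sup>2)"
    unfolding variation_def
  proof (rule total_mono)
    show "(u x + v x - (u (g x) + v (g x)))\<^sup>2 \<le> 2 * (u x - u (g x))\<^sup>2 + 2 * (v x - v (g x))\<^sup>2" for x
      using square_sum_le[of "u x - u (g x)" "v x - v (g x)"] by (simp add: algebra_simps)
  qed (intro finsupp_add finsupp_cmult finsupp_gradient assms)+
  also have "\<dots> = 2 * variation g u + 2 * variation g v"
    unfolding variation_def
    by (simp add: total_add total_cmult finsupp_cmult finsupp_gradient assms)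
  finally show ?thesis .
qed

lemma variation_cmult: "variation g (\<lambda>x. c * u x) = c\<^sup>2 * variation g u"
  unfolding variation_def total_cmult[symmetric]
  by (rule arg_cong[where f = total]) (simp add: fun_eq_iff power2_eq_square algebra_simps)

text \<open>As g permutes the points, both squares of the expansion have the same total, and only
  the cross term depends on g. This is the stationarity behind \<open>energy_eq\<close>.\<close>

lemma variation_eq:
  assumes "finsupp u" "bij g"
  shows "variation g u = 2 * total (\<lambda>x. (u x)\<^sup>2) - 2 * total (\<lambda>x. u x * u (g x))"
proof -
  have fs: "finsupp (\<lambda>x. (u x)\<^sup>2)" "finsupp (\<lambda>x. (u (g x))\<^sup>2)" "finsupp (\<lambda>x. -2 * (u x * u (g x)))"
    using finsupp_bij[OF assms] by (auto intro: finsupp_subset[OF assms(1)] finsupp_subset)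
  have "variation g u = total (\<lambda>x. ((u x)\<^sup>2 + (u (g x))\<^sup>2) + (-2) * (u x * u (g x)))"
    unfolding variation_def
    by (rule arg_cong[where f = total]) (simp add: fun_eq_iff power2_eq_square algebra_simps)
  also have "\<dots> = total (\<lambda>x. (u x)\<^sup>2) + total (\<lambda>x. (u (g x))\<^sup>2) + (-2) * total (\<lambda>x. u x * u (g x))"
    using fs by (simp only: total_add finsupp_add total_cmult)
  also have "total (\<lambda>x. (u (g x))\<^sup>2) = total (\<lambda>x. (u x)\<^sup>2)"
    by (rule total_bij[OF assms(2)])
  finally show ?thesis by simp
qed

section \<open>A flow on the binary tree inside the Schreier graph\<close>

text \<open>The points \<open>(j + v) / 2 ^ k\<close> with \<open>j < 2 ^ k\<close> are the descendants of generation \<open>k\<close> of \<open>v\<close> in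
  the binary tree on \<open>(0, 1)\<close> in which the children of \<open>y\<close> are \<open>y / 2\<close> and \<open>(y + 1) / 2\<close>; these
  are the images of \<open>y\<close> under \<open>B\<close> and under \<open>A\<^sup>-\<^sup>1 B\<close>.\<close>

definition level_mean :: "nat \<Rightarrow> (real \<Rightarrow> real) \<Rightarrow> real \<Rightarrow> real" where
  "level_mean k u v = (\<Sum>j<2 ^ k. u ((real j + v) / 2 ^ k)) / 2 ^ k"

lemma sum_lessThan_add: "(\<Sum>i<m + (n::nat). f i) = (\<Sum>i<m. f i) + (\<Sum>j<n. f (m + j) :: real)"
  by (induction n) simp_all

text \<open>Going down one generation changes the mean by the sum of the edge differences
  \<open>p j\<close> and \<open>q j\<close>, each with weight 1 / 2 ^ Suc k. Cauchy-Schwarz over the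
  2^k vertices turns this even spreading of the flow into the gain (1/2)^k.\<close>

lemma level_mean_step:
  assumes "finsupp u" and v: "0 < v" "v < 1"
  shows "(level_mean k u v - level_mean (Suc k) u v)\<^sup>2
    \<le> (1/2) ^ k * (variation B_tilde u + variation (B_tilde \<circ> A_inv) u)"
proof -
  define y where "y j = (real j + v) / 2 ^ k" for j
  define p where "p j = u (y j) - u (B_tilde (y j))" for j
  define q where "q j = u (y j) - u (B_tilde (A_inv (y j)))" for j
  have y: "0 < y j" "y j < 1" if "j < 2 ^ k" for j
  proof -
    have "real j + 1 \<le> 2 ^ k"
      using that by (metis Suc_leI of_nat_Suc of_nat_le_iff of_nat_numeral of_nat_power add.commute)
    then show "0 < y j" "y j < 1" using v by (simp_all add: y_def field_simps)
  qed
  have By: "B_tilde (y j) = (real j + v) / 2 ^ Suc k"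
    and BAy: "B_tilde (A_inv (y j)) = (real (2 ^ k + j) + v) / 2 ^ Suc k" if "j < 2 ^ k" for j
    using y[OF that] by (auto simp: B_tilde_def A_inv_def y_def field_simps)
  have inj: "inj_on y {..<2 ^ k}"
    by (auto simp: inj_on_def y_def)
  have "(\<Sum>j<2 ^ Suc k. u ((real j + v) / 2 ^ Suc k)) =
      (\<Sum>j<2 ^ k. u ((real j + v) / 2 ^ Suc k)) + (\<Sum>j<2 ^ k. u ((real (2 ^ k + j) + v) / 2 ^ Suc k))"
    using sum_lessThan_add[of "\<lambda>j. u ((real j + v) / 2 ^ Suc k)" "2 ^ k" "2 ^ k"] by (simp only: power_Suc mult_2)
  also have "\<dots> = (\<Sum>j<2 ^ k. u (B_tilde (y j))) + (\<Sum>j<2 ^ k. u (B_tilde (A_inv (y j))))"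
    by (intro arg_cong2[where f = "(+)"] sum.cong refl) (simp_all add: By BAy)
  finally have "level_mean (Suc k) u v =
      ((\<Sum>j<2 ^ k. u (B_tilde (y j))) + (\<Sum>j<2 ^ k. u (B_tilde (A_inv (y j))))) / 2 ^ Suc k"
    by (simp only: level_mean_def)
  moreover have "level_mean k u v = (2 * (\<Sum>j<2 ^ k. u (y j))) / 2 ^ Suc k"
    by (simp add: level_mean_def y_def)
  moreover have "(\<Sum>j<2 ^ k. p j + q j) = 2 * (\<Sum>j<2 ^ k. u (y j)) -
      ((\<Sum>j<2 ^ k. u (B_tilde (y j))) + (\<Sum>j<2 ^ k. u (B_tilde (A_inv (y j)))))"
    by (simp add: p_def q_def sum.distrib sum_subtractf sum_negf sum_distrib_left)
  ultimately have "level_mean k u v - level_mean (Suc k) u v = (\<Sum>j<2 ^ k. p j + q j) / 2 ^ Suc k"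
    by (simp only: diff_divide_distrib)
  then have "(level_mean k u v - level_mean (Suc k) u v)\<^sup>2 = (\<Sum>j<2 ^ k. p j + q j)\<^sup>2 / (2 ^ Suc k)\<^sup>2"
    by (simp add: power_divide)
  also have "\<dots> \<le> ((\<Sum>j<2 ^ k. (p j + q j)\<^sup>2) * 2 ^ k) / (2 ^ Suc k)\<^sup>2"
    using sum_squared_le_sum_of_squares[of "\<lambda>j. p j + q j" "{..<2 ^ k}"] by (intro divide_right_mono) simp_all
  also have "\<dots> \<le> ((2 * (\<Sum>j<2 ^ k. (p j)\<^sup>2) + 2 * (\<Sum>j<2 ^ k. (q j)\<^sup>2)) * 2 ^ k) / (2 ^ Suc k)\<^sup>2"
    unfolding sum_distrib_left sum.distrib[symmetric]
    by (intro divide_right_mono mult_right_mono sum_mono square_sum_le) simp_all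
  also have "\<dots> = (1/2) ^ k * ((\<Sum>j<2 ^ k. (p j)\<^sup>2) + (\<Sum>j<2 ^ k. (q j)\<^sup>2)) / 2"
    by (simp add: power2_eq_square power_one_over field_simps)
  also have "\<dots> \<le> (1/2) ^ k * ((\<Sum>j<2 ^ k. (p j)\<^sup>2) + (\<Sum>j<2 ^ k. (q j)\<^sup>2))"
    by (simp add: sum_nonneg)
  also have "\<dots> \<le> (1/2) ^ k * (variation B_tilde u + variation (B_tilde \<circ> A_inv) u)"
  proof (intro mult_left_mono add_mono)
    have bij: "bij B_tilde" "bij (B_tilde \<circ> A_inv)"
      by (intro F_tilde_bij F_tilde_mult_closed A_B_in_F_tilde A_B_inv_in_F_tilde)+
    have "(\<Sum>j<2 ^ k. (p j)\<^sup>2) = (\<Sum>x\<in>y ` {..<2 ^ k}. (u x - u (B_tilde x))\<^sup>2)"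
      unfolding p_def by (simp add: sum.reindex[OF inj])
    also have "\<dots> \<le> variation B_tilde u"
      unfolding variation_def by (intro sum_le_total finsupp_gradient assms(1) bij) simp_all
    finally show "(\<Sum>j<2 ^ k. (p j)\<^sup>2) \<le> variation B_tilde u" .
    have "(\<Sum>j<2 ^ k. (q j)\<^sup>2) = (\<Sum>x\<in>y ` {..<2 ^ k}. (u x - u ((B_tilde \<circ> A_inv) x))\<^sup>2)"
      unfolding q_def by (simp add: sum.reindex[OF inj])
    also have "\<dots> \<le> variation (B_tilde \<circ> A_inv) u"
      unfolding variation_def by (intro sum_le_total finsupp_gradient assms(1) bij) simp_all
    finally show "(\<Sum>j<2 ^ k. (q j)\<^sup>2) \<le> variation (B_tilde \<circ> A_inv) u" .
  qed simp
  finally show ?thesis .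
qed

text \<open>The points of one generation are distinct, so their values sum to at most the l1 norm of
  \<open>u\<close>, against the weight 2^-k.\<close>

lemma level_mean_tendsto_0:
  assumes "finsupp u"
  shows "(\<lambda>k. level_mean k u v) \<longlonglongrightarrow> 0"
proof (rule Lim_null_comparison)
  have fs: "finsupp (\<lambda>x. \<bar>u x\<bar>)" using assms by (rule finsupp_subset) simp
  have "\<bar>level_mean k u v\<bar> \<le> (1/2) ^ k * total (\<lambda>x. \<bar>u x\<bar>)" for k
  proof -
    have "\<bar>\<Sum>j<2 ^ k. u ((real j + v) / 2 ^ k)\<bar> \<le> (\<Sum>j<2 ^ k. \<bar>u ((real j + v) / 2 ^ k)\<bar>)"
      by (rule sum_abs)
    also have "\<dots> = (\<Sum>x\<in>(\<lambda>j. (real j + v) / 2 ^ k) ` {..<2 ^ k}. \<bar>u x\<bar>)"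
      by (subst sum.reindex) (auto simp: inj_on_def)
    also have "\<dots> \<le> total (\<lambda>x. \<bar>u x\<bar>)"
      by (rule sum_le_total[OF fs]) simp_all
    finally show ?thesis
      by (simp add: level_mean_def power_one_over field_simps)
  qed
  then show "eventually (\<lambda>k. norm (level_mean k u v) \<le> (1/2) ^ k * total (\<lambda>x. \<bar>u x\<bar>)) sequentially"
    by simp
  show "(\<lambda>k. (1/2) ^ k * total (\<lambda>x. \<bar>u x\<bar>)) \<longlonglongrightarrow> 0"
    by (intro tendsto_mult_left_zero LIMSEQ_realpow_zero) simp_all
qed

text \<open>Differences are telescoped from generation k downwards. The ratio 3/4 is a rational
  majorant of the square root of 1/2, as 1/2 \<le> 9/16, and 4 (3/4)^k is the sum of the geometric
  tail. Generation 0 serves transience; the decay in k serves non-triviality.\<close>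

lemma level_mean_bound:
  assumes "finsupp u" and v: "0 < v" "v < 1"
  shows "\<bar>level_mean k u v\<bar> \<le> 4 * (3/4) ^ k * sqrt (variation B_tilde u + variation (B_tilde \<circ> A_inv) u)"
proof -
  define s where "s = sqrt (variation B_tilde u + variation (B_tilde \<circ> A_inv) u)"
  have s: "0 \<le> s" "s\<^sup>2 = variation B_tilde u + variation (B_tilde \<circ> A_inv) u"
    by (simp_all add: s_def variation_nonneg)
  have step: "\<bar>level_mean m u v - level_mean (Suc m) u v\<bar> \<le> (3/4) ^ m * s" for m
  proof (rule power2_le_imp_le)
    have "(level_mean m u v - level_mean (Suc m) u v)\<^sup>2 \<le> (1/2) ^ m * s\<^sup>2"
      using level_mean_step[OF assms] s by simp
    also have "\<dots> \<le> (9/16) ^ m * s\<^sup>2"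
      by (intro mult_right_mono power_mono) simp_all
    also have "(9/16 :: real) ^ m = ((3/4) ^ m)\<^sup>2"
      by (simp add: power2_eq_square power_mult_distrib[symmetric])
    finally show "\<bar>level_mean m u v - level_mean (Suc m) u v\<bar>\<^sup>2 \<le> ((3/4) ^ m * s)\<^sup>2"
      by (simp add: power_mult_distrib)
  qed (use s in simp)
  have "\<bar>level_mean k u v\<bar> \<le> \<bar>level_mean (k + n) u v\<bar> + 4 * (3/4) ^ k * s" for n
  proof -
    have "\<bar>level_mean k u v\<bar> \<le> \<bar>level_mean (k + n) u v\<bar> + 4 * (3/4) ^ k * s - 4 * (3/4) ^ (k + n) * s"
    proof (induction n)
      case (Suc n)
      then show ?case using step[of "k + n"] by (simp add: algebra_simps)
    qed simp
    moreover have "0 \<le> 4 * (3/4) ^ (k + n) * s" using s by simp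
    ultimately show ?thesis by linarith
  qed
  moreover have "(\<lambda>n. \<bar>level_mean (k + n) u v\<bar> + 4 * (3/4) ^ k * s) \<longlonglongrightarrow> \<bar>0\<bar> + 4 * (3/4) ^ k * s"
    using LIMSEQ_ignore_initial_segment[OF level_mean_tendsto_0[OF assms(1), of v], of k]
    by (intro tendsto_intros) (simp add: add.commute)
  ultimately have "\<bar>level_mean k u v\<bar> \<le> \<bar>0\<bar> + 4 * (3/4) ^ k * s"
    by (intro LIMSEQ_le_const) auto
  then show ?thesis by (simp add: s_def)
qed

section \<open>Transience\<close>

locale F_walk = random_walk F_tilde \<mu> for \<mu> :: "(real \<Rightarrow> real) measure" +
  assumes finite_supp: "finite (supp F_tilde \<mu>)"
begin

abbreviation "S \<equiv> supp F_tilde \<mu>"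

abbreviation w :: "(real \<Rightarrow> real) \<Rightarrow> real" where
  "w s \<equiv> measure \<mu> {s}"

lemma S_in_F: "s \<in> S \<Longrightarrow> s \<in> carrier F_tilde"
  by (simp add: supp_def)

lemma S_bij: "s \<in> S \<Longrightarrow> bij s"
  by (rule F_tilde_bij[OF S_in_F])

lemma w_pos: "s \<in> S \<Longrightarrow> 0 < w s"
  using measure_nonneg[of \<mu> "{s}"] by (simp add: supp_def less_le)

lemma AE_in_S: "AE s in \<mu>. s \<in> S"
proof -
  have "carrier F_tilde - S \<in> null_sets \<mu>"
  proof -
    have "(\<Union>s \<in> carrier F_tilde - S. {s}) \<in> null_sets \<mu>"
    proof (rule null_sets_UN')
      show "countable (carrier F_tilde - S)"
        using countable_G by (rule countable_subset[rotated]) auto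
      fix s assume s: "s \<in> carrier F_tilde - S"
      then have "{s} \<in> sets \<mu>" by (simp add: sets_\<mu>)
      moreover have "measure \<mu> {s} = 0" using s by (simp add: supp_def)
      ultimately show "{s} \<in> null_sets \<mu>"
        by (intro null_setsI) (simp_all add: increment.emeasure_eq_measure)
    qed
    then show ?thesis by simp
  qed
  then show ?thesis
    by (rule AE_I') (auto simp: space_\<mu>)
qed

lemma nn_integral_\<mu>: "(\<integral>\<^sup>+s. f s \<partial>\<mu>) = (\<Sum>s\<in>S. f s * ennreal (w s))"
proof -
  have sets: "{s} \<in> sets \<mu>" if "s \<in> S" for s
    using S_in_F[OF that] by (simp add: sets_\<mu>)
  have "(\<integral>\<^sup>+s. f s \<partial>\<mu>) = (\<integral>\<^sup>+s. (\<Sum>a\<in>S. f a * indicator {a} s) \<partial>\<mu>)"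
  proof (rule nn_integral_cong_AE)
    show "AE s in \<mu>. f s = (\<Sum>a\<in>S. f a * indicator {a} s)"
      using AE_in_S
    proof eventually_elim
      case (elim s)
      have "(\<Sum>a\<in>S. f a * indicator {a} s) = (\<Sum>a\<in>S. if a = s then f a else 0)"
        by (intro sum.cong refl) (auto simp: indicator_def)
      also have "\<dots> = f s"
        using elim finite_supp by (subst sum.delta) simp_all
      finally show ?case by (rule sym)
    qed
  qed
  also have "\<dots> = (\<Sum>a\<in>S. \<integral>\<^sup>+s. f a * indicator {a} s \<partial>\<mu>)"
    using sets by (intro nn_integral_sum borel_measurable_times borel_measurable_indicator) simp_all
  also have "\<dots> = (\<Sum>s\<in>S. f s * ennreal (w s))"
    using sets by (intro sum.cong refl) (simp add: nn_integral_cmult_indicator increment.emeasure_eq_measure)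
  finally show ?thesis .
qed

lemma sum_w: "(\<Sum>s\<in>S. w s) = 1"
proof -
  have "ennreal (\<Sum>s\<in>S. w s) = (\<Sum>s\<in>S. 1 * ennreal (w s))"
    by (subst sum_ennreal[symmetric]) simp_all
  also have "\<dots> = (\<integral>\<^sup>+s. 1 \<partial>\<mu>)"
    by (rule nn_integral_\<mu>[symmetric])
  also have "\<dots> = 1"
    by (simp only: nn_integral_const increment.emeasure_space_1) simp
  finally show ?thesis by (simp only: ennreal_eq_1)
qed

section \<open>The Markov operator on points and its energy\<close>

definition avg :: "(real \<Rightarrow> real) \<Rightarrow> real \<Rightarrow> real" where
  "avg u x = (\<Sum>s\<in>S. w s * u (s x))"

definition energy :: "(real \<Rightarrow> real) \<Rightarrow> real" where
  "energy u = (\<Sum>s\<in>S. w s * variation s u)"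

lemma finsupp_avg:
  assumes "finsupp u"
  shows "finsupp (avg u)"
  unfolding avg_def[abs_def]
  by (rule finsupp_sum, rule finsupp_cmult, rule finsupp_bij[OF assms S_bij])

lemma finsupp_avg_power: "finsupp u \<Longrightarrow> finsupp ((avg ^^ n) u)"
  by (induction n) (simp_all add: finsupp_avg)

lemma avg_nonneg: "(\<And>x. 0 \<le> u x) \<Longrightarrow> 0 \<le> avg u x"
  unfolding avg_def by (intro sum_nonneg mult_nonneg_nonneg) simp_all

lemma avg_power_nonneg: "(\<And>x. 0 \<le> u x) \<Longrightarrow> 0 \<le> (avg ^^ n) u x"
  by (induction n arbitrary: x) (simp_all add: avg_nonneg)

lemma avg_add: "avg (\<lambda>x. u x + v x) = (\<lambda>x. avg u x + avg v x)"
  by (simp add: avg_def fun_eq_iff algebra_simps sum.distrib)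

lemma avg_diff: "avg (\<lambda>x. u x - v x) = (\<lambda>x. avg u x - avg v x)"
  by (simp add: avg_def fun_eq_iff algebra_simps sum_subtractf)

lemma avg_cmult: "avg (\<lambda>x. c * u x) = (\<lambda>x. c * avg u x)"
  by (simp add: avg_def fun_eq_iff sum_distrib_left algebra_simps)

lemma avg_sum: "avg (\<lambda>x. \<Sum>i\<in>I. f i x) = (\<lambda>x. \<Sum>i\<in>I. avg (f i) x)"
  unfolding avg_def fun_eq_iff sum_distrib_left by (intro allI sum.swap)

lemma avg_power_add: "(avg ^^ n) (\<lambda>x. u x + v x) = (\<lambda>x. (avg ^^ n) u x + (avg ^^ n) v x)"
  by (induction n) (simp_all add: avg_add)

lemma avg_power_diff: "(avg ^^ n) (\<lambda>x. u x - v x) = (\<lambda>x. (avg ^^ n) u x - (avg ^^ n) v x)"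
  by (induction n) (simp_all add: avg_diff)

lemma avg_power_cmult: "(avg ^^ n) (\<lambda>x. c * u x) = (\<lambda>x. c * (avg ^^ n) u x)"
  by (induction n) (simp_all add: avg_cmult)

lemma energy_nonneg: "0 \<le> energy u"
  unfolding energy_def by (intro sum_nonneg mult_nonneg_nonneg variation_nonneg) simp

lemma energy_add: "finsupp u \<Longrightarrow> finsupp v \<Longrightarrow> energy (\<lambda>x. u x + v x) \<le> 2 * energy u + 2 * energy v"
  unfolding energy_def sum_distrib_left sum.distrib[symmetric]
proof (rule sum_mono)
  fix s assume "finsupp u" "finsupp v" "s \<in> S"
  then have "w s * variation s (\<lambda>x. u x + v x) \<le> w s * (2 * variation s u + 2 * variation s v)"
    by (intro mult_left_mono variation_add S_bij) simp_all
  then show "w s * variation s (\<lambda>x. u x + v x) \<le> 2 * (w s * variation s u) + 2 * (w s * variation s v)"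
    by (simp add: algebra_simps)
qed

lemma energy_cmult: "energy (\<lambda>x. c * u x) = c\<^sup>2 * energy u"
  by (simp add: energy_def variation_cmult sum_distrib_left algebra_simps)

text \<open>Stationarity of the counting measure takes the place of reversibility here.\<close>

lemma energy_eq:
  assumes "finsupp u"
  shows "energy u = 2 * total (\<lambda>x. u x * (u x - avg u x))"
proof -
  have fs: "finsupp (\<lambda>x. (u x)\<^sup>2)" by (rule finsupp_subset[OF assms]) simp
  have fs': "finsupp (\<lambda>x. u x * u (s x))" for s by (rule finsupp_subset[OF assms]) simp
  have fs'': "finsupp (\<lambda>x. \<Sum>s\<in>S. w s * (u x * u (s x)))"
    by (intro finsupp_sum finsupp_cmult fs')
  have "energy u = (\<Sum>s\<in>S. w s * (2 * total (\<lambda>x. (u x)\<^sup>2)) - 2 * (w s * total (\<lambda>x. u x * u (s x))))"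
    unfolding energy_def by (intro sum.cong refl) (simp add: variation_eq[OF assms S_bij] algebra_simps)
  also have "\<dots> = (\<Sum>s\<in>S. w s) * (2 * total (\<lambda>x. (u x)\<^sup>2)) - 2 * (\<Sum>s\<in>S. w s * total (\<lambda>x. u x * u (s x)))"
    by (simp only: sum_subtractf sum_distrib_right sum_distrib_left)
  also have "(\<Sum>s\<in>S. w s * total (\<lambda>x. u x * u (s x))) = total (\<lambda>x. \<Sum>s\<in>S. w s * (u x * u (s x)))"
    by (subst total_sum) (simp_all add: total_cmult finsupp_cmult fs')
  finally have "energy u = 2 * (total (\<lambda>x. (u x)\<^sup>2) + (-1) * total (\<lambda>x. \<Sum>s\<in>S. w s * (u x * u (s x))))"
    by (simp add: sum_w)
  also have "\<dots> = 2 * total (\<lambda>x. (u x)\<^sup>2 + (-1) * (\<Sum>s\<in>S. w s * (u x * u (s x))))"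
    by (simp only: total_add[OF fs finsupp_cmult[OF fs'']] total_cmult)
  also have "(\<lambda>x. (u x)\<^sup>2 + (-1) * (\<Sum>s\<in>S. w s * (u x * u (s x)))) = (\<lambda>x. u x * (u x - avg u x))"
    by (simp add: fun_eq_iff avg_def power2_eq_square algebra_simps sum_distrib_left sum_negf)
  finally show ?thesis .
qed

text \<open>A support element s has the constant 1 / w s, and products are handled by
  \<open>variation_comp\<close>. The constant depends on the semigroup word for g, never on
  \<open>u\<close>.\<close>

lemma variation_le_energy:
  assumes "g \<in> carrier F_tilde"
  shows "\<exists>C \<ge> 0. \<forall>u. finsupp u \<longrightarrow> variation g u \<le> C * energy u"
proof -
  have "g \<in> semigroup_generated F_tilde S"
    using nondegenerate assms by (simp add: strictly_nondegenerate_def)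
  then have "g \<in> carrier F_tilde \<and> (\<exists>C \<ge> 0. \<forall>u. finsupp u \<longrightarrow> variation g u \<le> C * energy u)"
  proof induction
    case (base s)
    have "variation s u \<le> (1 / w s) * energy u" for u
    proof -
      have "w s * variation s u \<le> energy u"
        unfolding energy_def using base finite_supp
        by (intro member_le_sum mult_nonneg_nonneg variation_nonneg) simp_all
      then show ?thesis using w_pos[OF base] by (simp add: field_simps)
    qed
    then show ?case using w_pos[OF base] S_in_F[OF base] by (intro conjI exI[of _ "1 / w s"]) simp_all
  next
    case (mult g h)
    then obtain C D where C: "C \<ge> 0" "\<And>u. finsupp u \<Longrightarrow> variation g u \<le> C * energy u"
      and D: "D \<ge> 0" "\<And>u. finsupp u \<Longrightarrow> variation h u \<le> D * energy u" by blast
    have bound: "variation (h \<circ> g) u \<le> (2 * C + 2 * D) * energy u" if "finsupp u" for u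
    proof -
      have "variation (h \<circ> g) u \<le> 2 * variation g u + 2 * variation h u"
        using mult.IH by (intro variation_comp[OF that] F_tilde_bij) simp_all
      also have "\<dots> \<le> 2 * (C * energy u) + 2 * (D * energy u)"
        using C(2)[OF that] D(2)[OF that] by simp
      finally show ?thesis by (simp add: algebra_simps)
    qed
    have "h \<circ> g \<in> carrier F_tilde"
      using mult.IH by (intro F_tilde_mult_closed) blast+
    moreover have "0 \<le> 2 * C + 2 * D" using C(1) D(1) by simp
    ultimately show ?case
      unfolding F_tilde_mult using bound by blast
  qed
  then show ?thesis by blast
qed

lemma level_mean_energy:
  "\<exists>C \<ge> 0. \<forall>u k v. finsupp u \<longrightarrow> 0 < v \<longrightarrow> v < 1 \<longrightarrow> \<bar>level_mean k u v\<bar> \<le> (3/4) ^ k * sqrt (C * energy u)"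
proof -
  obtain C where C: "C \<ge> 0" "\<And>u. finsupp u \<Longrightarrow> variation B_tilde u \<le> C * energy u"
    using variation_le_energy[OF A_B_in_F_tilde(2)] by blast
  obtain D where D: "D \<ge> 0" "\<And>u. finsupp u \<Longrightarrow> variation (B_tilde \<circ> A_inv) u \<le> D * energy u"
    using variation_le_energy[OF F_tilde_mult_closed[OF A_B_inv_in_F_tilde(1) A_B_in_F_tilde(2)]] by blast
  \<comment> \<open>16 is the square of the prefactor in \<open>level_mean_bound\<close>, moved
    under the root.\<close>
  have "\<bar>level_mean k u v\<bar> \<le> (3/4) ^ k * sqrt (16 * (C + D) * energy u)"
    if u: "finsupp u" "0 < v" "v < 1" for u k v
  proof -
    have "\<bar>level_mean k u v\<bar> \<le> 4 * (3/4) ^ k * sqrt (variation B_tilde u + variation (B_tilde \<circ> A_inv) u)"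
      by (rule level_mean_bound[OF u])
    also have "\<dots> \<le> 4 * (3/4) ^ k * sqrt ((C + D) * energy u)"
      using C(2)[OF u(1)] D(2)[OF u(1)] by (intro mult_left_mono real_sqrt_le_mono) (simp_all add: algebra_simps)
    also have "\<dots> = (3/4) ^ k * sqrt (16 * (C + D) * energy u)"
    proof -
      have "sqrt 16 = (4 :: real)" by (rule real_sqrt_unique) simp_all
      then have "sqrt (16 * (C + D) * energy u) = 4 * sqrt ((C + D) * energy u)"
        by (simp only: mult.assoc real_sqrt_mult[of 16])
      then show ?thesis by simp
    qed
    finally show ?thesis .
  qed
  then show ?thesis
    using C(1) D(1) by (intro exI[of _ "16 * (C + D)"]) simp
qed

text \<open>The mean over generation 0 with root 1/2 is the value at 1/2 itself; a group element
  taking 1/2 to z carries the bound there at the cost of its variation.\<close>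

lemma point_le_energy:
  assumes "z \<in> dyadic_rationals"
  shows "\<exists>C \<ge> 0. \<forall>u. finsupp u \<longrightarrow> (u z)\<^sup>2 \<le> C * energy u"
proof -
  obtain g where g: "g \<in> carrier F_tilde" "g (1/2) = z"
    using F_tilde_transitive[OF assms] by blast
  obtain C where C: "C \<ge> 0" "\<And>u k v. finsupp u \<Longrightarrow> 0 < v \<Longrightarrow> v < 1 \<Longrightarrow> \<bar>level_mean k u v\<bar> \<le> (3/4) ^ k * sqrt (C * energy u)"
    using level_mean_energy by blast
  obtain D where D: "D \<ge> 0" "\<And>u. finsupp u \<Longrightarrow> variation g u \<le> D * energy u"
    using variation_le_energy[OF g(1)] by blast
  have "(u z)\<^sup>2 \<le> (2 * C + 2 * D) * energy u" if u: "finsupp u" for u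
  proof -
    have "\<bar>u (1/2)\<bar> \<le> sqrt (C * energy u)"
      using C(2)[OF u, of "1/2" 0] by (simp add: level_mean_def)
    then have "\<bar>u (1/2)\<bar>\<^sup>2 \<le> (sqrt (C * energy u))\<^sup>2"
      by (intro power_mono) simp_all
    then have half: "(u (1/2))\<^sup>2 \<le> C * energy u"
      using C(1) energy_nonneg[of u] by simp
    have "(\<Sum>x\<in>{1/2}. (u x - u (g x))\<^sup>2) \<le> variation g u"
      unfolding variation_def
      by (intro sum_le_total finsupp_gradient u F_tilde_bij g(1)) simp_all
    then have "(u (1/2) - u z)\<^sup>2 \<le> D * energy u"
      using D(2)[OF u] g(2) by simp
    moreover have "(u z)\<^sup>2 \<le> 2 * (u (1/2))\<^sup>2 + 2 * (u (1/2) - u z)\<^sup>2"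
      using square_sum_le[of "u (1/2)" "u z - u (1/2)"] by (simp add: power2_commute)
    ultimately show ?thesis using half by (simp add: algebra_simps)
  qed
  then show ?thesis using C(1) D(1) by (intro exI[of _ "2 * C + 2 * D"]) simp
qed

section \<open>Truncated Green functions and almost sure transience\<close>

definition green :: "nat \<Rightarrow> (real \<Rightarrow> real) \<Rightarrow> real \<Rightarrow> real" where
  "green N f x = (\<Sum>n<N. (avg ^^ n) f x)"

lemma finsupp_green: "finsupp f \<Longrightarrow> finsupp (green N f)"
  unfolding green_def[abs_def] by (rule finsupp_sum) (rule finsupp_avg_power)

lemma green_diff: "green N f x - avg (green N f) x = f x - (avg ^^ N) f x"
proof -
  have "avg (green N f) = (\<lambda>x. \<Sum>n<N. (avg ^^ Suc n) f x)"
    unfolding green_def[abs_def] avg_sum by simp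
  then have "green N f x - avg (green N f) x = (\<Sum>n<N. (avg ^^ n) f x - (avg ^^ Suc n) f x)"
    by (simp add: green_def sum_subtractf)
  also have "\<dots> = (avg ^^ 0) f x - (avg ^^ N) f x"
    by (rule sum_lessThan_telescope')
  finally show ?thesis by simp
qed

abbreviation point :: "real \<Rightarrow> real \<Rightarrow> real" where
  "point z \<equiv> indicator {z}"

lemma finsupp_point: "finsupp (point z)"
  by (simp add: finsupp_def indicator_def)

lemma green_point_nonneg: "0 \<le> green N (point z) x"
  unfolding green_def by (intro sum_nonneg avg_power_nonneg) simp

text \<open>By \<open>green_diff\<close>, the Green function paired with its own Laplacian gives its
  value at z minus a nonnegative term from the N-th step.\<close>

lemma energy_green_point: "energy (green N (point z)) \<le> 2 * green N (point z) z"
proof -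
  let ?u = "green N (point z)"
  have "energy ?u = 2 * total (\<lambda>x. ?u x * (point z x - (avg ^^ N) (point z) x))"
    by (simp only: energy_eq[OF finsupp_green[OF finsupp_point]] green_diff)
  also have "\<dots> \<le> 2 * total (\<lambda>x. ?u x * point z x)"
  proof (rule mult_left_mono[OF total_mono])
    show "?u x * (point z x - (avg ^^ N) (point z) x) \<le> ?u x * point z x" for x
      using avg_power_nonneg[of "point z" N x] by (intro mult_left_mono green_point_nonneg) simp
    show "finsupp (\<lambda>x. ?u x * (point z x - (avg ^^ N) (point z) x))"
      "finsupp (\<lambda>x. ?u x * point z x)"
      by (rule finsupp_subset[OF finsupp_green[OF finsupp_point[of z], of N]]; simp)+
  qed simp
  also have "total (\<lambda>x. ?u x * point z x) = ?u z"
    by (subst total_eq_sum[of "{z}"]) simp_all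
  finally show ?thesis .
qed

lemma energy_green_point_bounded:
  assumes "z \<in> dyadic_rationals"
  shows "\<exists>C. \<forall>N. energy (green N (point z)) \<le> C"
proof -
  obtain C where C: "C \<ge> 0" "\<And>u. finsupp u \<Longrightarrow> (u z)\<^sup>2 \<le> C * energy u"
    using point_le_energy[OF assms] by blast
  have "energy (green N (point z)) \<le> 2 * (2 * C)" for N
  proof -
    let ?u = "green N (point z)"
    \<comment> \<open>The flow bound is quadratic in the value at z and the energy bound linear;
      dividing by the value leaves a bound independent of \<open>N\<close>.\<close>
    have "?u z * ?u z \<le> C * energy ?u"
      using C(2)[OF finsupp_green[OF finsupp_point]] by (simp add: power2_eq_square)
    also have "\<dots> \<le> C * (2 * ?u z)"
      by (intro mult_left_mono energy_green_point C(1))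
    finally have "?u z * ?u z \<le> (2 * C) * ?u z" by (simp add: algebra_simps)
    then have "?u z \<le> 2 * C"
      using green_point_nonneg[of N z z] C(1) by (cases "?u z = 0") (simp_all add: less_le)
    then show ?thesis
      using energy_green_point[of N z] by linarith
  qed
  then show ?thesis by blast
qed

lemma green_point_bounded:
  assumes "z \<in> dyadic_rationals" "x \<in> dyadic_rationals"
  shows "\<exists>C. \<forall>N. green N (point z) x \<le> C"
proof -
  obtain C where C: "\<And>N. energy (green N (point z)) \<le> C"
    using energy_green_point_bounded[OF assms(1)] by blast
  obtain D where D: "D \<ge> 0" "\<And>u. finsupp u \<Longrightarrow> (u x)\<^sup>2 \<le> D * energy u"
    using point_le_energy[OF assms(2)] by blast
  have "green N (point z) x \<le> 1 + D * C" for N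
  proof -
    let ?t = "green N (point z) x"
    have "?t\<^sup>2 \<le> D * energy (green N (point z))"
      by (rule D(2)[OF finsupp_green[OF finsupp_point]])
    also have "\<dots> \<le> D * C" by (intro mult_left_mono C D(1))
    finally have "?t\<^sup>2 \<le> D * C" .
    moreover have "?t \<le> 1 + ?t\<^sup>2"
      using zero_le_power2[of "?t - 1"] green_point_nonneg[of N z x] by (simp add: power2_eq_square algebra_simps)
    ultimately show ?thesis by linarith
  qed
  then show ?thesis by blast
qed

lemma summable_avg_power_point:
  assumes "z \<in> dyadic_rationals" "x \<in> dyadic_rationals"
  shows "summable (\<lambda>n. (avg ^^ n) (point z) x)"
proof -
  obtain C where "\<And>N. green N (point z) x \<le> C"
    using green_point_bounded[OF assms] by blast
  then show ?thesis
    by (intro summableI_nonneg_bounded[of _ C] avg_power_nonneg) (simp_all add: green_def)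
qed

lemma green_add: "green N (\<lambda>x. f x + g x) = (\<lambda>x. green N f x + green N g x)"
  by (simp add: green_def avg_power_add sum.distrib fun_eq_iff)

lemma green_cmult: "green N (\<lambda>x. c * f x) = (\<lambda>x. c * green N f x)"
  by (simp add: green_def avg_power_cmult sum_distrib_left fun_eq_iff)

text \<open>Linearity over the points of the support; the factors 2 of \<open>energy_add\<close>
  accumulate but do not depend on N. The function may change sign, as the Laplacian of a branch
  indicator does.\<close>

lemma energy_green_bounded:
  assumes "finite A" "A \<subseteq> dyadic_rationals" "\<And>x. x \<notin> A \<Longrightarrow> f x = 0"
  shows "\<exists>C. \<forall>N. energy (green N f) \<le> C"
  using assms
proof (induction A arbitrary: f rule: finite_induct)
  case empty
  then have "f = (\<lambda>x. 0 * point 0 x)" by (simp add: fun_eq_iff)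
  then have "energy (green N f) = 0" for N
    by (simp only: green_cmult energy_cmult) simp
  then show ?case by (intro exI[of _ 0]) simp
next
  case (insert z A)
  define h where "h = f(z := 0)"
  have h: "h x = 0" if "x \<notin> A" for x
    using insert.prems(2)[of x] that by (auto simp: h_def)
  have "finsupp h"
    unfolding finsupp_def by (rule finite_subset[OF _ insert.hyps(1)]) (use h in auto)
  obtain C where C: "\<And>N. energy (green N h) \<le> C"
    using insert.IH[of h] h insert.prems(1) by auto
  obtain D where D: "\<And>N. energy (green N (point z)) \<le> D"
    using energy_green_point_bounded[of z] insert.prems(1) by blast
  have f: "f = (\<lambda>x. h x + f z * point z x)"
    by (auto simp: h_def fun_eq_iff indicator_def)
  have "energy (green N f) \<le> 2 * C + 2 * ((f z)\<^sup>2 * D)" for N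
  proof -
    have "green N f = (\<lambda>x. green N h x + f z * green N (point z) x)"
      by (subst f) (simp only: green_add green_cmult)
    then have "energy (green N f) \<le> 2 * energy (green N h) + 2 * energy (\<lambda>x. f z * green N (point z) x)"
      using \<open>finsupp h\<close> by (simp add: energy_add finsupp_green finsupp_cmult finsupp_point)
    also have "\<dots> \<le> 2 * C + 2 * ((f z)\<^sup>2 * D)"
      unfolding energy_cmult by (intro add_mono mult_left_mono C D) simp_all
    finally show ?thesis .
  qed
  then show ?case by blast
qed

text \<open>First-step analysis in which the point \<open>x\<close> moves in place of the start:
  translating paths on the left by s turns the event at x into the event at s x, so the walk from
  the identity suffices.\<close>

lemma walk_prob:
  "measure (walk_from \<one>\<^bsub>F_tilde\<^esub>) {y \<in> space paths. y n x \<in> A} = (avg ^^ n) (indicator A) x"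
proof -
  define E where "E n x = {y \<in> space paths. y n x \<in> A}" for n x
  have E_sets: "E n x \<in> sets paths" for n x
  proof -
    have "E n x = (\<lambda>y. y n) -` {g \<in> carrier F_tilde. g x \<in> A} \<inter> space paths"
      by (auto simp: E_def space_paths)
    then show ?thesis
      using measurable_sets[OF measurable_coordinate, of "{g \<in> carrier F_tilde. g x \<in> A}" n] by simp
  qed
  have "emeasure (walk_from \<one>\<^bsub>F_tilde\<^esub>) (E n x) = ennreal ((avg ^^ n) (indicator A) x)" for x
  proof (induction n arbitrary: x)
    case 0
    have "(\<lambda>h. left_mult \<one>\<^bsub>F_tilde\<^esub> (walk F_tilde h)) -` E 0 x \<inter> space steps = (if x \<in> A then space steps else {})"
      using measurable_space[OF measurable_walk_from[OF one_closed]] by (auto simp: E_def left_mult_def)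
    then show ?case
      unfolding walk_from_def
      by (subst emeasure_distr[OF measurable_walk_from[OF one_closed] E_sets])
        (simp_all add: seq.P.emeasure_space_1)
  next
    case (Suc n)
    have "shift -` E n x \<inter> space paths = E (Suc n) x"
      using shift_space by (auto simp: E_def shift_def)
    then have "emeasure (walk_from \<one>\<^bsub>F_tilde\<^esub>) (E (Suc n) x) = (\<integral>\<^sup>+s. emeasure (walk_from (\<one>\<^bsub>F_tilde\<^esub> \<otimes>\<^bsub>F_tilde\<^esub> s)) (E n x) \<partial>\<mu>)"
      using emeasure_shift[OF one_closed E_sets, of n x] by simp
    also have "\<dots> = (\<Sum>s\<in>S. emeasure (walk_from (\<one>\<^bsub>F_tilde\<^esub> \<otimes>\<^bsub>F_tilde\<^esub> s)) (E n x) * ennreal (w s))"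
      by (rule nn_integral_\<mu>)
    also have "\<dots> = (\<Sum>s\<in>S. ennreal ((avg ^^ n) (indicator A) (s x)) * ennreal (w s))"
    proof (rule sum.cong[OF refl])
      fix s assume "s \<in> S"
      then have s: "s \<in> carrier F_tilde" by (rule S_in_F)
      have "walk_from (\<one>\<^bsub>F_tilde\<^esub> \<otimes>\<^bsub>F_tilde\<^esub> s) = distr (walk_from \<one>\<^bsub>F_tilde\<^esub>) paths (left_mult s)"
        using s by (simp only: distr_left_mult one_closed l_one r_one)
      also have "emeasure \<dots> (E n x) = emeasure (walk_from \<one>\<^bsub>F_tilde\<^esub>) (left_mult s -` E n x \<inter> space paths)"
        using measurable_left_mult[OF s] E_sets
        by (subst emeasure_distr) (simp_all add: measurable_cong_sets[OF sets_walk_from refl])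
      also have "left_mult s -` E n x \<inter> space paths = E n (s x)"
        using left_mult_space[OF s] by (auto simp: E_def left_mult_def)
      finally show "emeasure (walk_from (\<one>\<^bsub>F_tilde\<^esub> \<otimes>\<^bsub>F_tilde\<^esub> s)) (E n x) * ennreal (w s) =
          ennreal ((avg ^^ n) (indicator A) (s x)) * ennreal (w s)"
        by (simp only: Suc)
    qed
    also have "\<dots> = ennreal ((avg ^^ Suc n) (indicator A) x)"
      by (simp add: avg_def ennreal_mult[symmetric] sum_ennreal avg_power_nonneg mult.commute)
    finally show ?case .
  qed
  then show ?thesis
    by (simp add: E_def[symmetric] measure_def avg_power_nonneg)
qed

text \<open>The probabilities of being at \<open>z\<close> at time n sum to a finite Green function,
  so Borel-Cantelli applies to each of the countably many pairs of points.\<close>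

lemma AE_leaves_points:
  "AE y in walk_from \<one>\<^bsub>F_tilde\<^esub>. \<forall>x \<in> dyadic_rationals. \<forall>z \<in> dyadic_rationals.
    eventually (\<lambda>n. y n x \<noteq> z) sequentially"
proof -
  interpret W: prob_space "walk_from \<one>\<^bsub>F_tilde\<^esub>"
    by (rule prob_space_walk_from) (rule one_closed)
  have "AE y in walk_from \<one>\<^bsub>F_tilde\<^esub>. eventually (\<lambda>n. y n x \<noteq> z) sequentially"
    if x: "x \<in> dyadic_rationals" and z: "z \<in> dyadic_rationals" for x z
  proof -
    have "AE y in walk_from \<one>\<^bsub>F_tilde\<^esub>. eventually (\<lambda>n. y \<in> space (walk_from \<one>\<^bsub>F_tilde\<^esub>) - {y \<in> space paths. y n x \<in> {z}}) sequentially"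
    proof (rule borel_cantelli_AE1)
      fix n
      have "{y \<in> space paths. y n x \<in> {z}} = (\<lambda>y. y n) -` {g \<in> carrier F_tilde. g x \<in> {z}} \<inter> space paths"
        by (auto simp: space_paths)
      then show "{y \<in> space paths. y n x \<in> {z}} \<in> sets (walk_from \<one>\<^bsub>F_tilde\<^esub>)"
        using measurable_sets[OF measurable_coordinate, of "{g \<in> carrier F_tilde. g x \<in> {z}}" n] by simp
      show "emeasure (walk_from \<one>\<^bsub>F_tilde\<^esub>) {y \<in> space paths. y n x \<in> {z}} < \<infinity>"
        unfolding infinity_ennreal_def less_top[symmetric] by (rule W.emeasure_finite)
      show "summable (\<lambda>n. measure (walk_from \<one>\<^bsub>F_tilde\<^esub>) {y \<in> space paths. y n x \<in> {z}})"
        unfolding walk_prob by (rule summable_avg_power_point[OF z x])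
    qed
    then show ?thesis
      by eventually_elim (auto elim: eventually_mono)
  qed
  then show ?thesis
    by (simp add: AE_ball_countable countable_dyadic)
qed

lemma AE_steps_in_S:
  "AE y in walk_from \<one>\<^bsub>F_tilde\<^esub>. \<forall>n. \<exists>s \<in> S. \<forall>x. y (Suc n) x = s (y n x)"
proof -
  have "AE h in steps. h n \<in> S" for n
  proof -
    have "distr steps \<mu> (\<lambda>h. h n) = \<mu>"
      by (rule seq.PiM_component) simp
    then have "AE s in distr steps \<mu> (\<lambda>h. h n). s \<in> S"
      using AE_in_S by (simp only:)
    then show ?thesis
      by (rule AE_distrD[rotated]) (rule measurable_component_singleton, simp)
  qed
  then have "AE h in steps. \<forall>n. h n \<in> S"
    by (simp add: AE_all_countable)
  then have "AE h in steps. \<forall>n. \<exists>s \<in> S. \<forall>x. left_mult \<one>\<^bsub>F_tilde\<^esub> (walk F_tilde h) (Suc n) x = s (left_mult \<one>\<^bsub>F_tilde\<^esub> (walk F_tilde h) n x)"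
    by eventually_elim (auto simp: left_mult_def)
  \<comment> \<open>Passing from increments to the law on paths requires a measurable event; two
    consecutive positions range over a countable discrete set.\<close>
  moreover have "Measurable.pred paths (\<lambda>y. \<forall>n. \<exists>s \<in> S. \<forall>x. y (Suc n) x = s (y n x))"
  proof (rule pred_intros_countable(1))
    fix n
    have "(\<lambda>y. (y n, y (Suc n))) \<in> paths \<rightarrow>\<^sub>M count_space (carrier F_tilde \<times> carrier F_tilde)"
      using countable_G by (subst pair_measure_countable[symmetric]) (auto intro!: measurable_Pair measurable_coordinate)
    from measurable_compose[OF this, of "\<lambda>p. \<exists>s \<in> S. \<forall>x. snd p x = s (fst p x)" "count_space UNIV"]
    show "Measurable.pred paths (\<lambda>y. \<exists>s \<in> S. \<forall>x. y (Suc n) x = s (y n x))"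
      by simp
  qed
  ultimately show ?thesis
    unfolding walk_from_def
    by (subst AE_distr_iff[OF measurable_walk_from[OF one_closed]]) (simp_all add: pred_def)
qed

end

section \<open>Convergence to the ends of the Schreier graph\<close>

interpretation Schreier: end_graph dyadic_rationals schreier_edges
  by unfold_locales (rule countable_dyadic sym_schreier_edges)+

lemma finite_vimage_F_tilde:
  assumes "g \<in> carrier F_tilde" "finite K"
  shows "finite (g -` K)"
  using assms F_tilde_bij[OF assms(1)] by (intro finite_vimageI) (auto simp: bij_def)

text \<open>A generator moves along an edge, so it separates x from its image only if one of them is
  in \<open>K\<close>. Under composition the exceptional set is pulled back by a bijection and stays
  finite, which covers the arbitrary group elements in the support of \<open>\<mu>\<close>.\<close>

lemma finite_component_changes:
  assumes K: "K \<in> finite_parts dyadic_rationals" and g: "g \<in> carrier F_tilde"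
  shows "finite {x \<in> dyadic_rationals. \<not> (x \<notin> K \<and> g x \<notin> K \<and> (x, g x) \<in> Schreier.adj_off K)}" (is "finite (?bad g)")
proof -
  have finK: "finite K" using K by (simp add: finite_parts_def)
  show ?thesis
    using g
  proof (induction rule: F_tilde_induct)
    case one
    show ?case by (rule finite_subset[OF _ finK]) auto
  next
    case (gen s)
    then have s: "s \<in> carrier F_tilde" using gens_in_F_tilde by blast
    have "(x, s x) \<in> Schreier.adj_off K" if "x \<in> dyadic_rationals" "x \<notin> K" "s x \<notin> K" for x
    proof -
      have "(x, s x) \<in> schreier_edges"
        unfolding schreier_edges_eq using that gen by blast
      then show ?thesis
        using that dyadic_gens[OF that(1) gen] by (intro r_into_rtrancl) simp
    qed
    then have "?bad s \<subseteq> K \<union> s -` K" by blast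
    then show ?case
      by (rule finite_subset) (simp add: finK finite_vimage_F_tilde[OF s])
  next
    case (mult f h)
    have "?bad (h \<circ> f) \<subseteq> ?bad f \<union> f -` ?bad h"
    proof
      fix x assume x: "x \<in> ?bad (h \<circ> f)"
      show "x \<in> ?bad f \<union> f -` ?bad h"
      proof (rule ccontr)
        assume n: "x \<notin> ?bad f \<union> f -` ?bad h"
        have "f x \<in> dyadic_rationals" using x dyadic_F_tilde[OF mult.hyps(1)] by simp
        with n x have "x \<notin> K" "h (f x) \<notin> K" "(x, f x) \<in> Schreier.adj_off K" "(f x, h (f x)) \<in> Schreier.adj_off K"
          by simp_all
        moreover from this(3,4) have "(x, h (f x)) \<in> Schreier.adj_off K" by (rule rtrancl_trans)
        ultimately show False using x by simp
      qed
    qed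
    then show ?case
      by (rule finite_subset)
        (intro finite_UnI mult.IH(1) finite_vimage_F_tilde[OF mult.hyps(1) mult.IH(2)])
  qed
qed

text \<open>A path with steps in a finite set crosses between different components of the complement of \<open>K\<close>
  only near \<open>K\<close>, hence finitely often if it leaves every finite set.\<close>

lemma transient_path_converges:
  assumes S: "finite S" "S \<subseteq> carrier F_tilde"
    and p: "p 0 \<in> dyadic_rationals" "\<And>n. \<exists>s \<in> S. p (Suc n) = s (p n)"
    and leaves: "\<And>z. z \<in> dyadic_rationals \<Longrightarrow> eventually (\<lambda>n. p n \<noteq> z) sequentially"
  shows "\<exists>\<omega>. converges_to_end dyadic_rationals schreier_edges p \<omega>"
  unfolding Schreier.converges_iff_coherent
proof (rule Schreier.coherent_eventually)
  have pD: "p n \<in> dyadic_rationals" for n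
  proof (induction n)
    case (Suc n)
    obtain s where "s \<in> S" "p (Suc n) = s (p n)" using p(2) by blast
    then show ?case using Suc S(2) dyadic_F_tilde by auto
  qed (rule p(1))
  have leaves_set: "eventually (\<lambda>n. p n \<notin> F) sequentially" if F: "finite F" "F \<subseteq> dyadic_rationals" for F
  proof -
    have "eventually (\<lambda>n. \<forall>z \<in> F. p n \<noteq> z) sequentially"
      using F leaves by (intro eventually_ball_finite) auto
    then show ?thesis by (rule eventually_mono) blast
  qed
  fix K assume K: "K \<in> finite_parts dyadic_rationals"
  define bad where "bad g = {x \<in> dyadic_rationals. \<not> (x \<notin> K \<and> g x \<notin> K \<and> (x, g x) \<in> Schreier.adj_off K)}" for g
  have "finite (\<Union>s \<in> S. bad s)" "(\<Union>s \<in> S. bad s) \<subseteq> dyadic_rationals"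
    using S finite_component_changes[OF K] by (auto simp: bad_def)
  then obtain N where N: "\<And>n. n \<ge> N \<Longrightarrow> p n \<notin> (\<Union>s \<in> S. bad s)"
    using leaves_set unfolding eventually_sequentially by blast
  have step: "p n \<notin> K \<and> (p n, p (Suc n)) \<in> Schreier.adj_off K" if n: "n \<ge> N" for n
  proof -
    obtain s where s: "s \<in> S" "p (Suc n) = s (p n)" using p(2) by blast
    then have "p n \<notin> bad s" using N[OF n] by blast
    then show ?thesis using pD s(2) by (simp add: bad_def)
  qed
  define C where "C = Schreier.adj_off K `` {p N}"
  have "p (N + m) \<in> C" for m
  proof (induction m)
    case (Suc m)
    then show ?case using step[of "N + m"] by (auto simp: C_def intro: rtrancl_trans)
  qed (simp add: C_def)
  then have ev: "eventually (\<lambda>n. p n \<in> C) sequentially"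
    unfolding eventually_sequentially by (metis le_iff_add)
  have C: "C \<in> components_off dyadic_rationals schreier_edges K"
    unfolding C_def using pD step[of N] by (intro Schreier.component_containing) simp
  \<comment> \<open>A finite component would itself be a finite set of dyadics, which the path
    leaves.\<close>
  have "infinite C"
  proof
    assume "finite C"
    moreover have "C \<subseteq> dyadic_rationals"
      using Schreier.component_subset[OF C] by blast
    ultimately have "eventually (\<lambda>n. p n \<notin> C) sequentially" by (rule leaves_set)
    with ev have "eventually (\<lambda>n. False) sequentially" by eventually_elim blast
    then show False by simp
  qed
  with C ev show "\<exists>C \<in> Schreier.inf_components K. eventually (\<lambda>n. p n \<in> C) sequentially"
    by (auto simp: Schreier.inf_components_def)
qed

section \<open>Two disjoint branches of the Schreier graph\<close>

text \<open>For c = 1 or 3 these fractions are in lowest terms with denominator at least 4. The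
  residue of the numerator modulo 4 survives integer translations and halving.\<close>

definition branch :: "int \<Rightarrow> real set" where
  "branch c = {of_int m / 2 ^ n | m n. 2 \<le> n \<and> m mod 4 = c}"

text \<open>The exits of the two branches: doubling 1/4 gives 1/2, and doubling 3/4 gives
  3/2.\<close>

definition gate :: "real set" where
  "gate = {1/2, 3/2}"

lemma gate_finite_part: "gate \<in> finite_parts dyadic_rationals"
  using dyadicI[of 1 1] dyadicI[of 3 1] by (simp add: finite_parts_def gate_def)

lemma branchI: "2 \<le> n \<Longrightarrow> m mod 4 = c \<Longrightarrow> of_int m / 2 ^ n \<in> branch c"
  by (auto simp: branch_def)

lemma branch_dyadic: "branch c \<subseteq> dyadic_rationals"
  by (auto simp: branch_def dyadicI)

text \<open>Uniqueness of lowest terms makes the numerator modulo 4 an invariant of the point, which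
  separates the two branches.\<close>

lemma dyadic_normal_form:
  assumes "odd m" "odd m'" and eq: "real_of_int m / 2 ^ n = of_int m' / 2 ^ n'"
  shows "n = n' \<and> m = m'"
proof -
  have "real_of_int (m * 2 ^ n') = real_of_int (m' * 2 ^ n)"
    using eq by (simp add: field_simps)
  then have eq': "m * 2 ^ n' = m' * 2 ^ n" by (simp only: of_int_eq_iff)
  have not_less: False if "k < l" "odd a" "a * 2 ^ l = b * 2 ^ k" "odd b" for a b :: int and k l :: nat
  proof -
    have "a * (2 ^ (l - k) * 2 ^ k) = b * 2 ^ k"
      using that by (simp add: power_add[symmetric])
    then have "a * 2 ^ (l - k) = b" by simp
    moreover have "even (a * 2 ^ (l - k))" using that(1) by simp
    ultimately show False using that(4) by blast
  qed
  have "n = n'"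
    using not_less[of n n' m m'] not_less[of n' n m' m] eq' assms(1,2) by (cases n n' rule: linorder_cases) auto
  then show ?thesis using eq' by simp
qed

lemma odd_mod_4: "m mod 4 = c \<Longrightarrow> c \<in> {1, 3} \<Longrightarrow> odd (m :: int)"
  by (elim insertE emptyE) presburger+

lemma branches_disjoint: "branch 1 \<inter> branch 3 = {}"
proof -
  have False if x: "x \<in> branch 1" "x \<in> branch 3" for x
  proof -
    obtain m n where m: "x = of_int m / 2 ^ n" "m mod 4 = 1" using x(1) by (auto simp: branch_def)
    obtain m' n' where m': "x = of_int m' / 2 ^ n'" "m' mod 4 = 3" using x(2) by (auto simp: branch_def)
    have "m = m'"
      using dyadic_normal_form[of m m' n n'] m m' odd_mod_4[of m 1] odd_mod_4[of m' 3] by simp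
    then show False using m m' by simp
  qed
  then show ?thesis by blast
qed

lemma branch_closed:
  assumes c: "c \<in> {1, 3}" and x: "x \<in> branch c" and s: "s \<in> gens" "s x \<notin> gate"
  shows "s x \<in> branch c"
proof -
  obtain m n where n: "2 \<le> n" "m mod 4 = c" "x = of_int m / 2 ^ n"
    using x by (auto simp: branch_def)
  \<comment> \<open>The bound 2 \<le> n enters here: a translation by 1 changes the numerator by a
    multiple of 4.\<close>
  have "(2 :: int) ^ n = 2 ^ 2 * 2 ^ (n - 2)"
    by (simp only: power_add[symmetric] le_add_diff_inverse n(1))
  then obtain q :: int where "2 ^ n = 4 * q" by simp
  then have mod: "(m - 2 ^ n) mod 4 = c" "(m + 2 ^ n) mod 4 = c"
    using n(2) by presburger+
  have minus: "x - 1 \<in> branch c"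
    using branchI[OF n(1) mod(1)] by (simp add: n(3) field_simps)
  have plus: "x + 1 \<in> branch c"
    using branchI[OF n(1) mod(2)] by (simp add: n(3) field_simps)
  have half: "x / 2 \<in> branch c"
    using branchI[of "Suc n" m c] n by (simp add: mult.commute)
  \<comment> \<open>Doubling lowers the exponent by one, so only n = 2 can leave the branch, and
    then x is 1/4 or 3/4.\<close>
  have double: "2 * x \<in> branch c \<or> 2 * x \<in> gate" if x01: "0 < x" "x \<le> 1"
  proof (cases "n = 2")
    case True
    then have "0 < m" "m \<le> 4" using x01 n(3) by simp_all
    then have "m = c" using n(2) c by (cases "m = 4") auto
    then show ?thesis using True n(3) c by (auto simp: gate_def)
  next
    case False
    then obtain k where "n = Suc k" "2 \<le> k" using n(1) by (cases n) auto
    then have "2 * x = of_int m / 2 ^ k" using n(3) by simp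
    then show ?thesis using branchI[OF \<open>2 \<le> k\<close> n(2)] by simp
  qed
  show ?thesis
    using s x minus plus half double
    by (auto simp: gens_def A_tilde_def A_inv_def B_tilde_def B_inv_def split: if_splits)
qed

text \<open>A generator leaves a branch only into \<open>gate\<close>; a point entering the branch
  is treated by the inverse generator, which puts the point itself in \<open>gate\<close>.
  Finiteness makes the Laplacian of the branch indicator finitely supported.\<close>

lemma finite_branch_boundary:
  assumes c: "c \<in> {1, 3}" and g: "g \<in> carrier F_tilde"
  shows "finite {x. (x \<in> branch c) \<noteq> (g x \<in> branch c)}"
  using g
proof (induction rule: F_tilde_induct)
  case (gen s)
  then have s: "s \<in> carrier F_tilde" using gens_in_F_tilde by blast
  obtain t where t: "t \<in> gens" "\<And>x. t (s x) = x" using gens_inverse[OF gen] by blast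
  have "{x. (x \<in> branch c) \<noteq> (s x \<in> branch c)} \<subseteq> gate \<union> s -` gate"
  proof
    fix x assume "x \<in> {x. (x \<in> branch c) \<noteq> (s x \<in> branch c)}"
    then consider "x \<in> branch c" "s x \<notin> branch c" | "x \<notin> branch c" "s x \<in> branch c" by blast
    then show "x \<in> gate \<union> s -` gate"
    proof cases
      case 1
      then show ?thesis using branch_closed[OF c 1(1) gen] by blast
    next
      case 2
      then show ?thesis using branch_closed[OF c 2(2) t(1)] t(2) by auto
    qed
  qed
  then show ?case
    by (rule finite_subset) (intro finite_UnI finite_vimage_F_tilde[OF s]; simp add: gate_def)
next
  case (mult f h)
  have "{x. (x \<in> branch c) \<noteq> ((h \<circ> f) x \<in> branch c)} \<subseteq>
      {x. (x \<in> branch c) \<noteq> (f x \<in> branch c)} \<union> f -` {x. (x \<in> branch c) \<noteq> (h x \<in> branch c)}"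
    by auto
  then show ?case
    by (rule finite_subset)
      (intro finite_UnI mult.IH(1) finite_vimage_F_tilde[OF mult.hyps(1) mult.IH(2)])
qed simp

lemma component_in_branch:
  assumes c: "c \<in> {1, 3}" and C: "C \<in> components_off dyadic_rationals schreier_edges gate"
    and x: "x \<in> C" "x \<in> branch c"
  shows "C \<subseteq> branch c"
proof -
  have "y \<in> branch c" if "(x, y) \<in> Schreier.adj_off gate" for y
    using that
  proof (induction rule: rtrancl_induct)
    case (step y z)
    then obtain s where "s \<in> gens" "z = s y" "z \<notin> gate"
      by (auto simp: schreier_edges_eq)
    then show ?case using branch_closed[OF c step.IH] by simp
  qed (rule x(2))
  then show ?thesis
    using Schreier.component_eq[OF C x(1)] by auto
qed

section \<open>The limit field\<close>

abbreviation default_end :: schreier_end where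
  "default_end \<equiv> SOME \<omega>. \<omega> \<in> ends dyadic_rationals schreier_edges"

lemma limit_field_eq_decode:
  "limit_field y = (\<lambda>x\<in>dyadic_rationals.
     Schreier.decode default_end (\<lambda>K C. eventually (\<lambda>n. y n x \<in> C) sequentially))"
  unfolding limit_field_def Schreier.limit_eq_decode ..

lemma limit_field_shift: "limit_field (\<lambda>n. y (Suc n)) = limit_field y"
  unfolding limit_field_eq_decode by (simp only: eventually_sequentially_Suc[of "\<lambda>n. y n _ \<in> _"])

lemma limit_field_left_mult:
  assumes "g \<in> carrier F_tilde"
  shows "limit_field (\<lambda>n. g \<otimes>\<^bsub>F_tilde\<^esub> y n) = field_shift g (limit_field y)"
  unfolding limit_field_eq_decode field_shift_def
  by (rule restrict_ext) (simp add: dyadic_F_tilde[OF assms])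

lemma space_Fun_space:
  "space Fun_space = (\<Pi>\<^sub>E x\<in>dyadic_rationals. ends dyadic_rationals schreier_edges)"
  by (simp add: Fun_space_def space_PiM Schreier.space_ends_borel)

lemma sets_field_cylinder:
  assumes "x \<in> dyadic_rationals" "K \<in> finite_parts dyadic_rationals"
  shows "{\<phi> \<in> space Fun_space. \<phi> x K = C} \<in> sets Fun_space"
proof -
  have "(\<lambda>\<phi>. \<phi> x) \<in> Fun_space \<rightarrow>\<^sub>M Schreier.ends_borel"
    unfolding Fun_space_def by (rule measurable_component_singleton[OF assms(1)])
  from measurable_sets[OF this Schreier.sets_ends_borel_cylinder[OF assms(2), of C]]
  have "(\<lambda>\<phi>. \<phi> x) -` {\<omega> \<in> ends dyadic_rationals schreier_edges. \<omega> K = C} \<inter> space Fun_space \<in> sets Fun_space" .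
  also have "(\<lambda>\<phi>. \<phi> x) -` {\<omega> \<in> ends dyadic_rationals schreier_edges. \<omega> K = C} \<inter> space Fun_space =
      {\<phi> \<in> space Fun_space. \<phi> x K = C}"
    using assms(1) by (auto simp: space_Fun_space)
  finally show ?thesis .
qed

lemma measurable_field_shift:
  assumes "g \<in> carrier F_tilde"
  shows "field_shift g \<in> Fun_space \<rightarrow>\<^sub>M Fun_space"
  unfolding field_shift_def[abs_def] Fun_space_def
  by (rule measurable_restrict, rule measurable_component_singleton, rule dyadic_F_tilde[OF assms])

context F_walk
begin

section \<open>The almost sure limit field and its factorization through the Poisson
  boundary\<close>

lemma AE_converges:
  "AE y in walk_from \<one>\<^bsub>F_tilde\<^esub>. \<forall>x \<in> dyadic_rationals.
     \<exists>\<omega>. converges_to_end dyadic_rationals schreier_edges (\<lambda>n. y n x) \<omega>"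
  using AE_leaves_points AE_steps_in_S AE_space
proof eventually_elim
  case (elim y)
  show ?case
  proof
    fix x assume x: "x \<in> dyadic_rationals"
    show "\<exists>\<omega>. converges_to_end dyadic_rationals schreier_edges (\<lambda>n. y n x) \<omega>"
    proof (rule transient_path_converges[OF finite_supp])
      show "S \<subseteq> carrier F_tilde" using S_in_F by blast
      have "y 0 \<in> carrier F_tilde" using elim(3) by (simp add: space_paths)
      then show "y 0 x \<in> dyadic_rationals" by (rule dyadic_F_tilde[OF _ x])
      show "\<exists>s \<in> S. y (Suc n) x = s (y n x)" for n using elim(2) by blast
      show "eventually (\<lambda>n. y n x \<noteq> z) sequentially" if "z \<in> dyadic_rationals" for z
        using elim(1) x that by blast
    qed
  qed
qed

text \<open>The existence of an end is read off from the walk: almost every path yields one.\<close>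

lemma default_end_in_ends: "default_end \<in> ends dyadic_rationals schreier_edges"
proof -
  have "ae_filter (walk_from \<one>\<^bsub>F_tilde\<^esub>) \<noteq> bot"
    by (rule prob_space.ae_filter_bot[OF prob_space_walk_from[OF one_closed]])
  from eventually_happens'[OF this AE_converges]
  obtain y where "\<forall>x \<in> dyadic_rationals. \<exists>\<omega>. converges_to_end dyadic_rationals schreier_edges (\<lambda>n. y n x) \<omega>"
    by blast
  then have "\<exists>\<omega>. \<omega> \<in> ends dyadic_rationals schreier_edges"
    using dyadicI[of 0 0] by (auto simp: converges_to_end_def)
  then show ?thesis by (rule someI_ex)
qed

lemma AE_limit_field:
  "AE y in walk_from \<one>\<^bsub>F_tilde\<^esub>. \<forall>x \<in> dyadic_rationals.
     converges_to_end dyadic_rationals schreier_edges (\<lambda>n. y n x) (limit_field y x)"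
  using AE_converges
proof eventually_elim
  case (elim y)
  then show ?case
    unfolding limit_field_eq_decode
    using Schreier.converges_decode Schreier.converges_iff_coherent by simp
qed

lemma measurable_limit_field: "limit_field \<in> paths \<rightarrow>\<^sub>M Fun_space"
  unfolding limit_field_eq_decode[abs_def] Fun_space_def
proof (rule measurable_restrict, rule Schreier.measurable_decode[OF default_end_in_ends])
  fix x :: real and K C
  have "Measurable.pred paths (\<lambda>y. y n x \<in> C)" for n
    by (rule measurable_compose[OF measurable_coordinate]) simp
  then show "Measurable.pred paths (\<lambda>y. eventually (\<lambda>n. y n x \<in> C) sequentially)"
    unfolding eventually_sequentially by measurable
qed

text \<open>The event that the limit at x has component C off K is invariant, hence visible in
  \<open>Y\<close> as a set \<open>D x K C\<close>. Countably many such events determine the field,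
  and decoding them gives \<open>\<psi>\<close>.\<close>

lemma limit_field_boundary_map:
  fixes Y :: "'y measure"
  assumes \<pi>: "\<pi> \<in> paths \<rightarrow>\<^sub>M Y"
    and inv: "\<And>E. E \<in> invariant_sets \<Longrightarrow> \<exists>D \<in> sets Y. AE x in walk_law_count F_tilde \<mu>. x \<in> E \<longleftrightarrow> \<pi> x \<in> D"
  shows "\<exists>\<psi> \<in> Y \<rightarrow>\<^sub>M Fun_space. AE y in walk_law_count F_tilde \<mu>. \<psi> (\<pi> y) = limit_field y"
proof -
  let ?P = "finite_parts dyadic_rationals"
  have "\<exists>D. D \<in> sets Y \<and> (AE y in walk_law_count F_tilde \<mu>. limit_field y x K = C \<longleftrightarrow> \<pi> y \<in> D)"
    if x: "x \<in> dyadic_rationals" and K: "K \<in> ?P" for x K C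
  proof -
    have "limit_field -` {\<phi> \<in> space Fun_space. \<phi> x K = C} \<inter> space paths \<in> invariant_sets"
      by (rule invariant_setsI[OF measurable_limit_field _ sets_field_cylinder[OF x K]])
        (simp add: shift_def limit_field_shift)
    from inv[OF this] obtain D where D: "D \<in> sets Y"
      "AE y in walk_law_count F_tilde \<mu>. y \<in> limit_field -` {\<phi> \<in> space Fun_space. \<phi> x K = C} \<inter> space paths \<longleftrightarrow> \<pi> y \<in> D"
      by blast
    from D(2) AE_space have "AE y in walk_law_count F_tilde \<mu>. limit_field y x K = C \<longleftrightarrow> \<pi> y \<in> D"
    proof eventually_elim
      case (elim y)
      then have "limit_field y \<in> space Fun_space"
        by (intro measurable_space[OF measurable_limit_field]) simp
      with elim show ?case by simp
    qed
    from conjI[OF D(1) this] show ?thesis by (rule exI)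
  qed
  note ex = this
  define D where "D x K C = (SOME D. D \<in> sets Y \<and>
    (AE y in walk_law_count F_tilde \<mu>. limit_field y x K = C \<longleftrightarrow> \<pi> y \<in> D))" for x K C
  have D: "D x K C \<in> sets Y" "AE y in walk_law_count F_tilde \<mu>. limit_field y x K = C \<longleftrightarrow> \<pi> y \<in> D x K C"
    if "x \<in> dyadic_rationals" "K \<in> ?P" for x K C
    using someI_ex[OF ex[OF that, of C]] unfolding D_def by (rule conjunct1, rule conjunct2)
  \<comment> \<open>Outside a null set the sets \<open>D x K C\<close> may fail to describe an end;
    the decoder then returns the default end, which keeps \<open>\<psi>\<close> total and
    measurable.\<close>
  define \<psi> where "\<psi> z = (\<lambda>x\<in>dyadic_rationals. Schreier.decode default_end (\<lambda>K C. z \<in> D x K C))" for z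
  have "\<psi> \<in> Y \<rightarrow>\<^sub>M Fun_space"
    unfolding \<psi>_def[abs_def] Fun_space_def
    by (rule measurable_restrict, rule Schreier.measurable_decode[OF default_end_in_ends])
      (simp add: pred_def D(1) sets.Int_space_eq2 Int_def[symmetric] conj_commute)
  moreover have "AE y in walk_law_count F_tilde \<mu>. \<forall>x \<in> dyadic_rationals. \<forall>K \<in> ?P. \<forall>C \<in> Schreier.inf_components K.
      limit_field y x K = C \<longleftrightarrow> \<pi> y \<in> D x K C"
    using D(2)
    by (simp add: AE_ball_countable countable_dyadic Schreier.countable_finite_parts Schreier.countable_inf_components)
  with AE_space have "AE y in walk_law_count F_tilde \<mu>. \<psi> (\<pi> y) = limit_field y"
  proof eventually_elim
    case (elim y)
    have ext: "limit_field y \<in> (\<Pi>\<^sub>E x\<in>dyadic_rationals. ends dyadic_rationals schreier_edges)"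
      using measurable_space[OF measurable_limit_field] elim(1) by (simp add: space_Fun_space)
    have "\<psi> (\<pi> y) x = limit_field y x" if x: "x \<in> dyadic_rationals" for x
    proof -
      have "Schreier.decode default_end (\<lambda>K C. \<pi> y \<in> D x K C) = limit_field y x"
      proof (rule Schreier.decode_end[OF _ _ default_end_in_ends])
        show "limit_field y x \<in> ends dyadic_rationals schreier_edges"
          using ext x by (rule PiE_mem)
        show "\<pi> y \<in> D x K C \<longleftrightarrow> C = limit_field y x K" if "K \<in> ?P" "C \<in> Schreier.inf_components K" for K C
          using elim(2) x that by blast
      qed
      then show ?thesis using x by (simp add: \<psi>_def)
    qed
    moreover have "\<psi> (\<pi> y) \<in> extensional dyadic_rationals" by (simp add: \<psi>_def)
    moreover have "limit_field y \<in> extensional dyadic_rationals" using ext by (simp add: PiE_def)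
    ultimately show ?case by (intro extensionalityI[of _ dyadic_rationals])
  qed
  ultimately show ?thesis by blast
qed

lemma mu_boundary_limit_field:
  "mu_boundary F_tilde \<mu> (distr (walk_law F_tilde \<mu>) Fun_space limit_field) field_shift"
proof (rule mu_boundaryI[OF measurable_limit_field])
  let ?U = "\<lambda>(x, K, C). {\<phi> \<in> space Fun_space. \<phi> x K = C}"
  let ?I = "Sigma dyadic_rationals (\<lambda>_. Sigma (finite_parts dyadic_rationals) Schreier.inf_components)"
  show "countable (?U ` ?I)"
    by (intro countable_image countable_SIGMA countable_dyadic Schreier.countable_finite_parts
        Schreier.countable_inf_components)
  show "?U ` ?I \<subseteq> sets Fun_space"
    using sets_field_cylinder by auto
  show "\<phi> = \<phi>'" if \<phi>: "\<phi> \<in> space Fun_space" "\<phi>' \<in> space Fun_space"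
    and eq: "\<And>A. A \<in> ?U ` ?I \<Longrightarrow> \<phi> \<in> A \<longleftrightarrow> \<phi>' \<in> A" for \<phi> \<phi>'
  proof (rule PiE_ext[OF \<phi>[unfolded space_Fun_space]])
    fix x assume x: "x \<in> dyadic_rationals"
    have ends: "\<phi> x \<in> ends dyadic_rationals schreier_edges" "\<phi>' x \<in> ends dyadic_rationals schreier_edges"
      using \<phi> x by (auto simp: space_Fun_space)
    then show "\<phi> x = \<phi>' x"
    proof (rule Schreier.ends_eqI)
      fix K assume K: "K \<in> finite_parts dyadic_rationals"
      have "?U (x, K, \<phi> x K) \<in> ?U ` ?I"
        using x K Schreier.ends_component[OF ends(1) K] by (intro imageI) simp
      from eq[OF this] show "\<phi> x K = \<phi>' x K" using \<phi> by simp
    qed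
  qed
  show "limit_field (shift y) = limit_field y" for y
    by (simp add: shift_def limit_field_shift)
  show "limit_field (left_mult g y) = field_shift g (limit_field y)" if "g \<in> carrier F_tilde" for g y
    unfolding left_mult_def by (rule limit_field_left_mult[OF that])
  show "field_shift g \<in> Fun_space \<rightarrow>\<^sub>M Fun_space" if "g \<in> carrier F_tilde" for g
    by (rule measurable_field_shift[OF that])
  show "field_shift \<one>\<^bsub>F_tilde\<^esub> \<phi> = \<phi>" if "\<phi> \<in> space Fun_space" for \<phi>
    using that by (auto simp: space_Fun_space field_shift_def PiE_def extensional_restrict)
  show "field_shift (g \<otimes>\<^bsub>F_tilde\<^esub> h) \<phi> = field_shift g (field_shift h \<phi>)"
    if "g \<in> carrier F_tilde" "h \<in> carrier F_tilde" for g h \<phi>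
    unfolding field_shift_def by (rule restrict_ext) (simp add: dyadic_F_tilde[OF that(1)])
qed (rule limit_field_boundary_map)

section \<open>Non-triviality\<close>

text \<open>Applying Green functions to the finitely supported Laplacian f, and not to the indicator
  itself, keeps every approximant within the reach of \<open>level_mean_energy\<close>.\<close>

lemma branch_not_avoided:
  assumes c: "c \<in> {1, 3}"
    and lim: "\<And>x. x \<in> dyadic_rationals \<Longrightarrow> (\<lambda>n. (avg ^^ n) (indicator (branch c)) x) \<longlonglongrightarrow> 0"
  shows False
proof -
  let ?b = "indicator (branch c) :: real \<Rightarrow> real"
  define f where "f x = ?b x - avg ?b x" for x
  define A where "A = (\<Union>s \<in> S. {x. (x \<in> branch c) \<noteq> (s x \<in> branch c)})"
  have "finite A"
    unfolding A_def using finite_supp S_in_F by (intro finite_UN_I finite_branch_boundary[OF c])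
  moreover have "A \<subseteq> dyadic_rationals"
    using branch_dyadic[of c] S_in_F dyadic_F_tilde_iff by (auto simp: A_def)
  moreover have "f x = 0" if xA: "x \<notin> A" for x
  proof -
    have "?b (s x) = ?b x" if "s \<in> S" for s
      using that xA by (auto simp: A_def indicator_def)
    then have "avg ?b x = (\<Sum>s\<in>S. w s) * ?b x"
      by (simp add: avg_def sum_distrib_right)
    then show ?thesis by (simp add: f_def sum_w)
  qed
  ultimately have "finsupp f" and "\<exists>E. \<forall>N. energy (green N f) \<le> E"
    using finite_subset[of "{x. f x \<noteq> 0}" A] by (auto simp: finsupp_def intro: energy_green_bounded)
  then obtain E where E: "\<And>N. energy (green N f) \<le> E" by blast
  have green: "green N f x = ?b x - (avg ^^ N) ?b x" for N x
  proof -
    have "f = (\<lambda>x. ?b x - avg ?b x)" by (simp add: f_def fun_eq_iff)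
    then have "(avg ^^ n) f = (\<lambda>x. (avg ^^ n) ?b x - (avg ^^ Suc n) ?b x)" for n
      by (simp only: avg_power_diff funpow_Suc_right o_apply)
    then have "green N f x = (\<Sum>n<N. (avg ^^ n) ?b x - (avg ^^ Suc n) ?b x)"
      by (simp only: green_def)
    also have "\<dots> = (avg ^^ 0) ?b x - (avg ^^ N) ?b x"
      by (rule sum_lessThan_telescope')
    finally show ?thesis by simp
  qed
  \<comment> \<open>With root c / 4 the whole subtree stays in the branch: its points are (4 j + c)
    / 2^(k + 2).\<close>
  define v :: real where "v = of_int c / 4"
  have v: "0 < v" "v < 1" using c by (auto simp: v_def)
  obtain C where C: "C \<ge> 0" "\<And>u k v. finsupp u \<Longrightarrow> 0 < v \<Longrightarrow> v < 1 \<Longrightarrow> \<bar>level_mean k u v\<bar> \<le> (3/4) ^ k * sqrt (C * energy u)"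
    using level_mean_energy by blast
  \<comment> \<open>The limit N to infinity is taken first, at fixed depth k, where only 2^k points
    are involved. As \<open>E\<close> does not depend on k, letting k grow then gives the
    contradiction.\<close>
  have "1 \<le> (3/4) ^ k * sqrt (C * E)" for k
  proof -
    have pt: "(real j + v) / 2 ^ k \<in> branch c" for j
    proof -
      have "(real j + v) / 2 ^ k = of_int (4 * int j + c) / 2 ^ (k + 2)"
        by (simp add: v_def power_add field_simps)
      moreover have "(4 * int j + c) mod 4 = c" using c by auto
      ultimately show ?thesis using branchI[of "k + 2" "4 * int j + c" c] by simp
    qed
    have lim_pt: "(\<lambda>N. green N f ((real j + v) / 2 ^ k)) \<longlonglongrightarrow> 1 - 0" for j
      unfolding green using pt[of j] branch_dyadic[of c]
      by (intro tendsto_diff lim) auto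
    have "(\<lambda>N. level_mean k (green N f) v) \<longlonglongrightarrow> (\<Sum>j<(2::nat) ^ k. 1 - 0) / 2 ^ k"
      unfolding level_mean_def
      by (rule tendsto_divide[OF tendsto_sum tendsto_const]) (rule lim_pt, simp)
    then have "(\<lambda>N. level_mean k (green N f) v) \<longlonglongrightarrow> 1" by simp
    moreover have "level_mean k (green N f) v \<le> (3/4) ^ k * sqrt (C * E)" for N
    proof -
      have "level_mean k (green N f) v \<le> (3/4) ^ k * sqrt (C * energy (green N f))"
        using C(2)[OF finsupp_green[OF \<open>finsupp f\<close>] v, of k N] by simp
      also have "\<dots> \<le> (3/4) ^ k * sqrt (C * E)"
        using C(1) E by (intro mult_left_mono real_sqrt_le_mono) simp_all
      finally show ?thesis .
    qed
    ultimately show ?thesis by (intro LIMSEQ_le_const2) auto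
  qed
  moreover have "(\<lambda>k. (3/4) ^ k * sqrt (C * E)) \<longlonglongrightarrow> 0"
    by (intro tendsto_mult_left_zero LIMSEQ_realpow_zero) simp_all
  ultimately have "1 \<le> (0 :: real)"
    by (intro LIMSEQ_le_const) auto
  then show False by simp
qed

lemma not_point_measure:
  "\<not> is_point_measure (distr (walk_law F_tilde \<mu>) Fun_space limit_field)"
proof
  let ?lam = "distr (walk_law F_tilde \<mu>) Fun_space limit_field"
  assume "is_point_measure ?lam"
  then obtain \<phi> where \<phi>: "\<phi> \<in> space Fun_space" and lam: "?lam = return ?lam \<phi>"
    by (auto simp: is_point_measure_def)
  have em: "emeasure ?lam N = indicator N \<phi>" if "N \<in> sets Fun_space" for N
    using that by (subst lam) simp
  interpret W: prob_space "walk_from \<one>\<^bsub>F_tilde\<^esub>"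
    by (rule prob_space_walk_from[OF one_closed])
  have gs: "measure_G_space F_tilde field_shift ?lam"
    using mu_boundary_limit_field by (simp add: mu_boundary_def)
  \<comment> \<open>For a point mass at \<open>\<phi>\<close> a measurable set is null exactly if it
    misses \<open>\<phi>\<close>. Quasi-invariance, tested on a single cylinder at
    \<open>gate\<close>, then forces the shifted field to agree with \<open>\<phi>\<close>
    there.\<close>
  have const: "\<phi> x gate = \<phi> (1/2) gate" if x: "x \<in> dyadic_rationals" for x
  proof -
    obtain g where g: "g \<in> carrier F_tilde" "g (1/2) = x"
      using F_tilde_transitive[OF x] by blast
    have half: "(1/2 :: real) \<in> dyadic_rationals" using dyadicI[of 1 1] by simp
    define N where "N = space Fun_space - {\<psi> \<in> space Fun_space. \<psi> (1/2) gate = \<phi> (1/2) gate}"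
    have N: "N \<in> sets Fun_space"
      unfolding N_def using sets_field_cylinder[OF half gate_finite_part] by blast
    have "N \<in> null_sets ?lam"
      using N em[OF N] by (intro null_setsI) (simp_all add: N_def \<phi>)
    then have "field_shift g -` N \<inter> space ?lam \<in> null_sets ?lam"
      using gs g(1) by (simp add: measure_G_space_def)
    then have null: "field_shift g -` N \<inter> space Fun_space \<in> null_sets ?lam" by simp
    then have "field_shift g -` N \<inter> space Fun_space \<in> sets Fun_space"
      by (auto simp: null_sets_def)
    from em[OF this] null have "\<phi> \<notin> field_shift g -` N \<inter> space Fun_space"
      by (auto simp: null_sets_def indicator_def split: if_splits)
    then have "field_shift g \<phi> (1/2) gate = \<phi> (1/2) gate"
      using \<phi> measurable_space[OF measurable_field_shift[OF g(1)] \<phi>] by (auto simp: N_def)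
    then show ?thesis using half g(2) by (simp add: field_shift_def)
  qed
  define C where "C = \<phi> (1/2) gate"
  have "\<phi> (1/2) \<in> ends dyadic_rationals schreier_edges"
    using \<phi> dyadicI[of 1 1] by (auto simp: space_Fun_space)
  then have C: "C \<in> components_off dyadic_rationals schreier_edges gate"
    unfolding C_def
    by (intro Schreier.inf_components_components Schreier.ends_component gate_finite_part)
  \<comment> \<open>A component off \<open>gate\<close> that meets a branch is contained in it, and
    the branches are disjoint, so \<open>C\<close> misses at least one of them.\<close>
  obtain c where c: "c \<in> {1, 3}" "C \<inter> branch c = {}"
  proof (cases "C \<inter> branch 1 = {}")
    case False
    then have "C \<subseteq> branch 1" using component_in_branch[of 1, OF _ C] by auto
    then have "C \<inter> branch 3 = {}" using branches_disjoint by blast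
    then show ?thesis using that[of 3] by simp
  qed (use that[of 1] in simp)
  have "(\<lambda>n. (avg ^^ n) (indicator (branch c)) x) \<longlonglongrightarrow> 0" if x: "x \<in> dyadic_rationals" for x
  proof -
    define B where "B n = {y \<in> space paths. y n x \<in> branch c}" for n
    have B: "B n \<in> sets (walk_from \<one>\<^bsub>F_tilde\<^esub>)" for n
    proof -
      have "B n = (\<lambda>y. y n) -` {g \<in> carrier F_tilde. g x \<in> branch c} \<inter> space paths"
        by (auto simp: B_def space_paths)
      then show ?thesis
        using measurable_sets[OF measurable_coordinate, of "{g \<in> carrier F_tilde. g x \<in> branch c}" n] by simp
    qed
    have "AE \<psi> in ?lam. \<psi> x gate = C"
    proof (rule AE_I')
      define N where "N = space Fun_space - {\<psi> \<in> space Fun_space. \<psi> x gate = C}"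
      have N: "N \<in> sets Fun_space"
        unfolding N_def using sets_field_cylinder[OF x gate_finite_part] by blast
      show "N \<in> null_sets ?lam"
        using N em[OF N] const[OF x] by (intro null_setsI) (simp_all add: N_def \<phi> C_def)
      show "{\<psi> \<in> space ?lam. \<psi> x gate \<noteq> C} \<subseteq> N" by (auto simp: N_def)
    qed
    then have "AE y in walk_law F_tilde \<mu>. limit_field y x gate = C"
      by (rule AE_distrD[rotated]) (simp add: measurable_walk_law measurable_limit_field)
    then have "AE y in walk_from \<one>\<^bsub>F_tilde\<^esub>. limit_field y x gate = C"
      by (simp only: walk_law_eq)
    with AE_limit_field
    have ev: "AE y in walk_from \<one>\<^bsub>F_tilde\<^esub>. eventually (\<lambda>n. y \<notin> B n) sequentially"
    proof eventually_elim
      case (elim y)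
      then have "eventually (\<lambda>n. y n x \<in> C) sequentially"
        using x gate_finite_part by (auto simp: Schreier.converges_to_end_iff)
      then show ?case
        by (rule eventually_mono) (use c(2) in \<open>auto simp: B_def\<close>)
    qed
    have "(\<lambda>n. \<integral>y. indicator (B n) y \<partial>walk_from \<one>\<^bsub>F_tilde\<^esub>) \<longlonglongrightarrow> (\<integral>y. 0 \<partial>walk_from \<one>\<^bsub>F_tilde\<^esub> :: real)"
    proof (rule integral_dominated_convergence[where w = "\<lambda>_. 1"])
      show "AE y in walk_from \<one>\<^bsub>F_tilde\<^esub>. (\<lambda>n. indicator (B n) y :: real) \<longlonglongrightarrow> 0"
        using ev
      proof eventually_elim
        case (elim y)
        then have "eventually (\<lambda>n. indicator (B n) y = (0 :: real)) sequentially"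
          by (rule eventually_mono) simp
        then show ?case by (rule tendsto_eventually)
      qed
      show "indicator (B n) \<in> borel_measurable (walk_from \<one>\<^bsub>F_tilde\<^esub>)" for n
        by (rule borel_measurable_indicator[OF B])
      show "AE y in walk_from \<one>\<^bsub>F_tilde\<^esub>. norm (indicator (B n) y :: real) \<le> 1" for n
        by (simp add: indicator_def)
      show "integrable (walk_from \<one>\<^bsub>F_tilde\<^esub>) (\<lambda>_. 1 :: real)"
        by (rule W.integrable_const)
    qed simp
    moreover have "(\<integral>y. indicator (B n) y \<partial>walk_from \<one>\<^bsub>F_tilde\<^esub>) = (avg ^^ n) (indicator (branch c)) x" for n
      using B sets.sets_into_space[OF B] by (simp add: walk_prob[symmetric] B_def[symmetric] Int_absorb1)
    ultimately show ?thesis by simp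
  qed
  then show False by (rule branch_not_avoided[OF c(1)])
qed

end

theorem theorem38:
  fixes \<mu> :: "(real \<Rightarrow> real) measure"
  assumes "is_prob_on F_tilde \<mu>"
    and "strictly_nondegenerate F_tilde \<mu>"
    and "finite (supp F_tilde \<mu>)"
  defines "lam \<equiv> distr (walk_law F_tilde \<mu>) Fun_space limit_field"
  shows "(AE g in walk_law F_tilde \<mu>. \<forall>x \<in> dyadic_rationals.
            converges_to_end dyadic_rationals schreier_edges (\<lambda>n. g n x) (limit_field g x))
       \<and> limit_field \<in> walk_law F_tilde \<mu> \<rightarrow>\<^sub>M Fun_space
       \<and> mu_boundary F_tilde \<mu> lam field_shift
       \<and> \<not> is_point_measure lam"
proof -
  interpret F_walk \<mu>
    using assms(1-3) by (intro F_walk.intro random_walk.intro random_walk_axioms.intro F_walk_axioms.intro)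
      (simp_all add: group_F_tilde countable_F_tilde)
  show ?thesis
    unfolding lam_def
  proof (intro conjI)
    show "AE g in walk_law F_tilde \<mu>. \<forall>x \<in> dyadic_rationals.
        converges_to_end dyadic_rationals schreier_edges (\<lambda>n. g n x) (limit_field g x)"
      unfolding walk_law_eq by (rule AE_limit_field)
    show "limit_field \<in> walk_law F_tilde \<mu> \<rightarrow>\<^sub>M Fun_space"
      unfolding measurable_walk_law by (rule measurable_limit_field)
  qed (rule mu_boundary_limit_field not_point_measure)+
qed

end
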